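(* Let $\Omega_k\subset\mathbb R^2$ be bounded convex domains with $|\Omega_k|=\pi$, and let $u_k$ be the normalized Neumann torsion function on $\Omega_k$, in the sense that $\int_{\partial\Omega_k}u_k\,d\sigma=0$. If $$O(\Omega_k)=\max_{\partial\Omega_k}u_k-\min_{\partial\Omega_k}u_k\to0,$$ then $\sup_k\operatorname{diam}(\Omega_k)<\infty$.
   Context: For a bounded connected Lipschitz domain $\Omega\subset\mathbb R^2$ (in particular a bounded convex domain) with area $|\Omega|$, perimeter $P(\Omega)$ and outer unit normal $\nu$, a Neumann torsion function is a weak solution $u$ (unique up to additive constants) of $-\Delta u=1$ in $\Omega$, $\partial_\nu u=-|\Omega|/P(\Omega)$ on $\partial\Omega$, i.e. $u\in H^1(\Omega)$ and $\int_\Omega\nabla u\cdot\nabla\varphi\,dx=\int_\Omega\varphi\,dx-\frac{|\Omega|}{P(\Omega)}\int_{\partial\Omega}\varphi\,d\sigma$ for all $\varphi\in H^1(\Omega)$. It has a Hölder continuous representative on $\overline\Omega$, which is always used. *)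

theory Defs
  imports "HOL-Analysis.Analysis"
begin

section \<open>Arc length on the boundary\<close>

text \<open>
  One-dimensional Hausdorff measure in the plane, normalised so that a segment has its length as
  measure. Covering sets are required to be bounded because \<^const>\<open>diameter\<close> is real-valued and
  carries no information on unbounded sets.
\<close>

definition hausdorff1_pre :: "real \<Rightarrow> (real^2) set \<Rightarrow> ennreal" where
  "hausdorff1_pre \<delta> A =
     (INF C \<in> {C :: nat \<Rightarrow> (real^2) set.
                 A \<subseteq> (\<Union>i. C i) \<and> (\<forall>i. bounded (C i) \<and> diameter (C i) \<le> \<delta>)}.
        (\<Sum>i. ennreal (diameter (C i))))"

definition hausdorff1_outer :: "(real^2) set \<Rightarrow> ennreal" where
  "hausdorff1_outer A = (SUP \<delta> \<in> {0<..}. hausdorff1_pre \<delta> A)"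

text \<open>
  \<^const>\<open>hausdorff1_outer\<close> is a metric outer measure, hence countably additive on Borel sets, so
  \<^const>\<open>measure_of\<close> does return it (and not the zero measure) here.
\<close>

definition hausdorff1 :: "(real^2) measure" where
  "hausdorff1 = measure_of UNIV (sets borel) hausdorff1_outer"

definition boundary_measure :: "(real^2) set \<Rightarrow> (real^2) measure" where
  "boundary_measure \<Omega> = restrict_space hausdorff1 (frontier \<Omega>)"

text \<open>For a Lipschitz domain this coincides with the De Giorgi perimeter.\<close>

definition perimeter :: "(real^2) set \<Rightarrow> real" where
  "perimeter \<Omega> = measure hausdorff1 (frontier \<Omega>)"

section \<open>The Sobolev space $H^1$ and its trace\<close>

definition grad :: "(real^2 \<Rightarrow> real) \<Rightarrow> real^2 \<Rightarrow> real^2" where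
  "grad f x = (\<chi> i. frechet_derivative f (at x) (axis i 1))"

fun C_k :: "nat \<Rightarrow> (real^2 \<Rightarrow> real) \<Rightarrow> bool" where
  "C_k 0 f \<longleftrightarrow> continuous_on UNIV f"
| "C_k (Suc n) f \<longleftrightarrow> (\<forall>x. f differentiable (at x)) \<and> (\<forall>i. C_k n (\<lambda>x. grad f x $ i))"

definition smooth :: "(real^2 \<Rightarrow> real) \<Rightarrow> bool" where
  "smooth f \<longleftrightarrow> (\<forall>n. C_k n f)"

definition test_function :: "(real^2) set \<Rightarrow> (real^2 \<Rightarrow> real) \<Rightarrow> bool" where
  "test_function \<Omega> \<psi> \<longleftrightarrow>
     smooth \<psi> \<and> compact (closure {x. \<psi> x \<noteq> 0}) \<and> closure {x. \<psi> x \<noteq> 0} \<subseteq> \<Omega>"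

definition square_integrable ::
  "'a measure \<Rightarrow> ('a \<Rightarrow> 'b :: {real_normed_vector, second_countable_topology}) \<Rightarrow> bool" where
  "square_integrable M f \<longleftrightarrow> f \<in> borel_measurable M \<and> integrable M (\<lambda>x. (norm (f x))\<^sup>2)"

text \<open>
  \<open>H1_with_grad \<Omega> u g\<close>: \<open>u \<in> H\<^sup>1(\<Omega>)\<close> with weak gradient \<open>g\<close>. The weak gradient is carried as an
  argument since it is determined only almost everywhere; values outside \<open>\<Omega>\<close> are irrelevant.
\<close>

definition H1_with_grad ::
  "(real^2) set \<Rightarrow> (real^2 \<Rightarrow> real) \<Rightarrow> (real^2 \<Rightarrow> real^2) \<Rightarrow> bool" where
  "H1_with_grad \<Omega> u g \<longleftrightarrow>
     square_integrable (lebesgue_on \<Omega>) u \<and>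
     square_integrable (lebesgue_on \<Omega>) g \<and>
     (\<forall>\<psi> i. test_function \<Omega> \<psi> \<longrightarrow>
        (LINT x|lebesgue_on \<Omega>. u x * grad \<psi> x $ i) = - (LINT x|lebesgue_on \<Omega>. g x $ i * \<psi> x))"

text \<open>
  The trace is the continuous extension to \<open>H\<^sup>1(\<Omega>)\<close> of the restriction of smooth functions to the
  boundary: \<open>w\<close> is the trace of \<open>\<phi>\<close> (with weak gradient \<open>h\<close>) if some functions smooth up to the
  boundary converge to \<open>\<phi>\<close> in \<open>H\<^sup>1(\<Omega>)\<close> and to \<open>w\<close> in $L^2(\partial\Omega)$. By the trace theorem, on a bounded
  Lipschitz domain every \<open>\<phi>\<close> has such a \<open>w\<close>, unique almost everywhere on the boundary.
\<close>

definition is_trace ::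
  "(real^2) set \<Rightarrow> (real^2 \<Rightarrow> real) \<Rightarrow> (real^2 \<Rightarrow> real^2) \<Rightarrow> (real^2 \<Rightarrow> real) \<Rightarrow> bool" where
  "is_trace \<Omega> \<phi> h w \<longleftrightarrow>
     square_integrable (boundary_measure \<Omega>) w \<and>
     (\<exists>\<psi> :: nat \<Rightarrow> real^2 \<Rightarrow> real.
        (\<forall>n. smooth (\<psi> n)) \<and>
        (\<lambda>n. LINT x|lebesgue_on \<Omega>. (\<psi> n x - \<phi> x)\<^sup>2) \<longlonglongrightarrow> 0 \<and>
        (\<lambda>n. LINT x|lebesgue_on \<Omega>. (norm (grad (\<psi> n) x - h x))\<^sup>2) \<longlonglongrightarrow> 0 \<and>
        (\<lambda>n. LINT x|boundary_measure \<Omega>. (\<psi> n x - w x)\<^sup>2) \<longlonglongrightarrow> 0)"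

section \<open>Neumann torsion functions\<close>

definition neumann_weak_solution :: "(real^2) set \<Rightarrow> (real^2 \<Rightarrow> real) \<Rightarrow> bool" where
  "neumann_weak_solution \<Omega> u \<longleftrightarrow>
     (\<exists>g. H1_with_grad \<Omega> u g \<and>
        (\<forall>\<phi> h w. H1_with_grad \<Omega> \<phi> h \<and> is_trace \<Omega> \<phi> h w \<longrightarrow>
           (LINT x|lebesgue_on \<Omega>. g x \<bullet> h x) =
             (LINT x|lebesgue_on \<Omega>. \<phi> x)
             - measure lebesgue \<Omega> / perimeter \<Omega> * (LINT x|boundary_measure \<Omega>. w x)))"

definition hoelder_continuous_on :: "(real^2) set \<Rightarrow> (real^2 \<Rightarrow> real) \<Rightarrow> bool" where
  "hoelder_continuous_on S u \<longleftrightarrow>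
     (\<exists>\<alpha> C. 0 < \<alpha> \<and> \<alpha> \<le> 1 \<and> (\<forall>x\<in>S. \<forall>y\<in>S. \<bar>u x - u y\<bar> \<le> C * dist x y powr \<alpha>))"

text \<open>The function itself, not its almost-everywhere class, is the Hoelder representative.\<close>

definition neumann_torsion_function :: "(real^2) set \<Rightarrow> (real^2 \<Rightarrow> real) \<Rightarrow> bool" where
  "neumann_torsion_function \<Omega> u \<longleftrightarrow>
     neumann_weak_solution \<Omega> u \<and> hoelder_continuous_on (closure \<Omega>) u"

definition normalized_neumann_torsion_function :: "(real^2) set \<Rightarrow> (real^2 \<Rightarrow> real) \<Rightarrow> bool" where
  "normalized_neumann_torsion_function \<Omega> u \<longleftrightarrow>
     neumann_torsion_function \<Omega> u \<and> (LINT x|boundary_measure \<Omega>. u x) = 0"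

text \<open>
  Supremum and infimum are attained, the boundary of a bounded domain being compact and nonempty.
\<close>

definition boundary_oscillation :: "(real^2) set \<Rightarrow> (real^2 \<Rightarrow> real) \<Rightarrow> real" where
  "boundary_oscillation \<Omega> u = (SUP x\<in>frontier \<Omega>. u x) - (INF x\<in>frontier \<Omega>. u x)"

end

theory Submission
  imports Defs
begin

text \<open>
Let \<open>\<Omega>\<close> be a convex domain of area \<open>\<pi>\<close> and large diameter. Put the \<open>X\<close>-axis of an orthonormal frame along
an almost longest chord, of length \<open>2R\<close>, with the midpoint of the chord as origin. The domain contains the
triangles over that chord, so \<open>\<bar>Y\<bar> \<le> \<pi> / R\<close>: it is a thin sliver.

Everything comes from testing the weak equation with one harmonic polynomial,
\<open>\<phi> = X\<^sup>2 - Y\<^sup>2 - R\<^sup>2 / 3\<close>. The value \<open>R\<^sup>2 / 3\<close> is the mean of \<open>x\<^sup>2\<close> on \<open>[-R, R]\<close>, so that \<open>\<phi>\<close> balances a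
long rectangle. Write \<open>P\<close> for the perimeter and \<open>g\<close> for the gradient of the torsion function \<open>u\<close>; the equation reads
\<open>\<integral>\<^bsub>\<Omega>\<^esub> g \<bullet> \<nabla>\<phi> = \<integral>\<^bsub>\<Omega>\<^esub> \<phi> - \<pi> / P * \<integral>\<^bsub>\<partial>\<Omega>\<^esub> \<phi>\<close>.

The left-hand side is a boundary quantity because \<open>\<phi>\<close> is harmonic. Multiply \<open>\<nabla>\<phi>\<close> by a cut-off that is a product of
smooth steps over the sides of an inscribed polygon and integrate by parts: only the values of \<open>u\<close> near \<open>\<partial>\<Omega>\<close>
survive, weighted with the variation of the cut-off. That cut-off is the product of an increasing and a decreasing
function on every line, hence has variation at most 2 there, and Fubini bounds the left-hand side by a constant times
\<open>max \<bar>u\<bar>\<close> on the boundary (\<open>green_bound\<close>). As \<open>u\<close> has mean zero on \<open>\<partial>\<Omega>\<close>, this maximum is at most the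
oscillation.

The right-hand side stays below a fixed negative number (\<open>moment_gap\<close>). The length of the slice of
\<open>\<Omega>\<close> over \<open>x\<close> is a concave function of \<open>x\<close>, and symmetrised in \<open>x\<close> it decreases in \<open>\<bar>x\<bar>\<close>; so \<open>\<Omega>\<close> has at most the
moment of a rectangle and \<open>\<integral>\<^bsub>\<Omega>\<^esub> \<phi>\<close> is at most a negligible error. On the boundary, arc length dominates Lebesgue measure under projection to
the axis, and exceeds it only by \<open>O(R\<^sup>-\<^sup>3)\<close> on the middle part, where the convex arcs have slope \<open>O(R\<^sup>-\<^sup>2)\<close>; so
\<open>\<integral>\<^bsub>\<partial>\<Omega>\<^esub> \<phi>\<close> is at least \<open>- O(1 / R)\<close>. One of the two estimates has room to spare. Look at
distance \<open>T = \<pi> / (2R)\<close>, about the mean height, from the ends of the chord. If the domain reaches height \<open>T / 8\<close> there, the boundary has to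
climb over that height within the distance \<open>T\<close>, and the additional arc length, located where \<open>\<phi>\<close> is of size
\<open>R\<^sup>2\<close>, makes the boundary integral at least a multiple of \<open>R\<close> (\<open>boundary_excess\<close>). Otherwise the domain tapers off
and its moment falls short of that of a rectangle by a fixed amount (\<open>area_moment_tapered\<close>).

Hence the oscillation is bounded below by a positive constant as soon as the diameter is at least 3000
(\<open>oscillation_lower_bound\<close>), which contradicts an oscillation tending to zero along unbounded diameters.
\<close>


section \<open>Gradients and a supply of smooth functions\<close>

lemma has_derivative_grad:
  assumes "f differentiable (at z)"
  shows "(f has_derivative (\<lambda>v. grad f z \<bullet> v)) (at z)"
proof -
  let ?D = "frechet_derivative f (at z)"
  have D: "(f has_derivative ?D) (at z)"
    using assms by (simp add: frechet_derivative_works)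
  then have lin: "linear ?D" by (rule has_derivative_linear)
  have "?D v = grad f z \<bullet> v" for v
  proof -
    have "?D v = ?D (\<Sum>i\<in>UNIV. (v $ i) *\<^sub>R axis i 1)"
      by (simp only: basis_expansion scalar_mult_eq_scaleR[symmetric])
    also have "\<dots> = grad f z \<bullet> v"
      by (simp add: linear_sum[OF lin] linear_cmul[OF lin] grad_def inner_vec_def mult.commute)
    finally show ?thesis .
  qed
  then have "?D = (\<lambda>v. grad f z \<bullet> v)" by (rule ext)
  with D show ?thesis by simp
qed

lemma grad_eqI:
  assumes "(f has_derivative (\<lambda>v. w \<bullet> v)) (at z)"
  shows "grad f z = w"
proof -
  have "frechet_derivative f (at z) = (\<lambda>v. w \<bullet> v)"
    using frechet_derivative_at[OF assms] by simp
  then show ?thesis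
    by (simp add: grad_def vec_eq_iff inner_axis)
qed

text \<open>
The classical flat functions \<open>exp (- 1 / t) / t\<^sup>n\<close>: the family in \<open>n\<close> is closed under differentiation up to linear
combinations, which is what makes smoothness of \<open>exp (- 1 / t)\<close> provable by a closure argument.
\<close>

definition flat :: "nat \<Rightarrow> real \<Rightarrow> real" where
  "flat n t = (if t > 0 then exp (- (1 / t)) / t ^ n else 0)"

lemma flat_limit: "((\<lambda>t. flat n t) \<longlongrightarrow> 0) (at_right 0)"
proof -
  have "((\<lambda>x::real. x ^ n / exp x) \<longlongrightarrow> 0) at_top" by (rule tendsto_power_div_exp_0)
  then have "((\<lambda>t::real. (inverse t) ^ n / exp (inverse t)) \<longlongrightarrow> 0) (at_right 0)"
    by (rule filterlim_compose[OF _ filterlim_inverse_at_top_right])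
  moreover have "\<forall>\<^sub>F t in at_right 0. (inverse t) ^ n / exp (inverse t) = flat n t"
    unfolding eventually_at_right_field
    by (intro exI[of _ 1]) (auto simp: flat_def field_simps exp_minus)
  ultimately show ?thesis by (simp add: filterlim_cong)
qed

lemma flat_has_derivative:
  "(flat n has_real_derivative flat (n + 2) t - real n * flat (n + 1) t) (at t)"
proof -
  consider "t > 0" | "t = 0" | "t < 0" by linarith
  then show ?thesis
  proof cases
    case 1
    have p: "((\<lambda>t. t ^ n) has_real_derivative real n * t ^ n / t) (at t)"
      using 1 DERIV_pow[of n t] by (cases n) auto
    have q: "((\<lambda>t. exp (- (1 / t))) has_real_derivative exp (- (1 / t)) / t\<^sup>2) (at t)"
      using 1 by (auto intro!: derivative_eq_intros simp: field_simps power2_eq_square)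
    have "((\<lambda>t. exp (- (1 / t)) / t ^ n) has_real_derivative
        flat (n + 2) t - real n * flat (n + 1) t) (at t)"
      by (rule DERIV_cong[OF DERIV_divide[OF q p]])
        (use 1 in \<open>auto simp: flat_def field_simps power2_eq_square\<close>)
    then show ?thesis
      by (rule has_field_derivative_transform_within_open[of _ _ _ "{0<..}"])
        (use 1 in \<open>auto simp: flat_def\<close>)
  next
    case 3
    have "((\<lambda>t. 0) has_real_derivative flat (n + 2) t - real n * flat (n + 1) t) (at t)"
      using 3 by (simp add: flat_def)
    then show ?thesis
      by (rule has_field_derivative_transform_within_open[of _ _ _ "{..<0}"])
        (use 3 in \<open>auto simp: flat_def\<close>)
  next
    case 2
    have r: "((\<lambda>h. flat n h / h) \<longlongrightarrow> 0) (at_right 0)"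
      using flat_limit[of "Suc n"]
      by (rule Lim_transform_eventually)
        (auto simp: eventually_at_right_field flat_def intro!: exI[of _ 1])
    have l: "((\<lambda>h. flat n h / h) \<longlongrightarrow> 0) (at_left 0)"
      by (rule Lim_transform_eventually[of "\<lambda>_. 0"])
        (auto simp: eventually_at_left_field flat_def intro!: exI[of _ "-1"])
    have "((\<lambda>h. flat n h / h) \<longlongrightarrow> 0) (at 0)"
      using r l by (simp add: filterlim_split_at)
    then show ?thesis using 2
      by (simp add: DERIV_def) (simp add: flat_def)
  qed
qed

text \<open>
Smoothness asks for all iterated partial derivatives. A class of differentiable functions that is closed under partial
derivatives consists of smooth functions; this is such a class, large enough for the cut-off functions.
\<close>

inductive elementary :: "(real^2 \<Rightarrow> real) \<Rightarrow> bool" where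
  const: "elementary (\<lambda>z. c)"
| inner: "elementary (\<lambda>z. a \<bullet> z)"
| add: "elementary f \<Longrightarrow> elementary g \<Longrightarrow> elementary (\<lambda>z. f z + g z)"
| mult: "elementary f \<Longrightarrow> elementary g \<Longrightarrow> elementary (\<lambda>z. f z * g z)"
| flat: "elementary f \<Longrightarrow> elementary (\<lambda>z. flat n (f z))"
| recip: "elementary f \<Longrightarrow> (\<And>z. f z \<noteq> 0) \<Longrightarrow> elementary (\<lambda>z. 1 / f z)"

lemma elementary_diff: "elementary f \<Longrightarrow> elementary g \<Longrightarrow> elementary (\<lambda>z. f z - g z)"
  using elementary.add[OF _ elementary.mult[OF elementary.const[of "-1"]], of f g] by simp

lemma elementary_prod:
  "finite I \<Longrightarrow> (\<And>i. i \<in> I \<Longrightarrow> elementary (f i)) \<Longrightarrow> elementary (\<lambda>z. \<Prod>i\<in>I. f i z)"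
  by (induction I rule: finite_induct) (auto intro: elementary.const elementary.mult)

lemma elementary_grad:
  assumes "elementary f"
  shows "(\<forall>z. f differentiable (at z)) \<and> (\<forall>i. elementary (\<lambda>z. grad f z $ i))"
  using assms
proof induction
  case (const c)
  have "grad (\<lambda>z. c) z = 0" for z by (rule grad_eqI) simp
  then show ?case by (auto intro: elementary.const)
next
  case (inner a)
  have d: "((\<lambda>z. a \<bullet> z) has_derivative (\<lambda>v. a \<bullet> v)) (at z)" for z
    by (auto intro!: derivative_eq_intros)
  then have "grad (\<lambda>z. a \<bullet> z) z = a" for z by (rule grad_eqI)
  with d show ?case by (auto intro: elementary.const simp: differentiable_def)
next
  case (add f g)
  have d: "((\<lambda>z. f z + g z) has_derivative (\<lambda>v. (grad f z + grad g z) \<bullet> v)) (at z)" for z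
    using add.IH has_derivative_grad[of f z] has_derivative_grad[of g z]
    by (auto intro!: derivative_eq_intros simp: inner_add_left)
  then have "grad (\<lambda>z. f z + g z) z = grad f z + grad g z" for z by (rule grad_eqI)
  with d add.IH show ?case by (auto intro!: elementary.add simp: differentiable_def)
next
  case (mult f g)
  have d: "((\<lambda>z. f z * g z) has_derivative (\<lambda>v. (f z *\<^sub>R grad g z + g z *\<^sub>R grad f z) \<bullet> v)) (at z)" for z
    using mult.IH has_derivative_grad[of f z] has_derivative_grad[of g z]
    by (auto intro!: derivative_eq_intros simp: inner_add_left algebra_simps)
  then have "grad (\<lambda>z. f z * g z) z = f z *\<^sub>R grad g z + g z *\<^sub>R grad f z" for z by (rule grad_eqI)
  with d mult show ?case
    by (auto intro!: elementary.add elementary.mult simp: differentiable_def)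
next
  case (flat f n)
  have d: "((\<lambda>z. flat n (f z)) has_derivative
      (\<lambda>v. ((flat (n + 2) (f z) - real n * flat (n + 1) (f z)) *\<^sub>R grad f z) \<bullet> v)) (at z)" for z
    using has_derivative_compose[OF has_derivative_grad[of f z]
        flat_has_derivative[of n "f z", THEN has_field_derivative_imp_has_derivative]] flat.IH
    by (simp add: mult.commute)
  then have g: "grad (\<lambda>z. flat n (f z)) z =
      (flat (n + 2) (f z) - real n * flat (n + 1) (f z)) *\<^sub>R grad f z" for z by (rule grad_eqI)
  show ?case unfolding g
    using d flat by (auto intro!: elementary.mult elementary_diff elementary.flat elementary.const simp: differentiable_def)
next
  case (recip f)
  have d: "((\<lambda>z. 1 / f z) has_derivative (\<lambda>v. ((-1) * (1 / f z) * (1 / f z)) *\<^sub>R grad f z \<bullet> v)) (at z)" for z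
    using recip has_derivative_grad[of f z]
    by (auto intro!: derivative_eq_intros simp: field_simps power2_eq_square)
  then have g: "grad (\<lambda>z. 1 / f z) z = ((-1) * (1 / f z) * (1 / f z)) *\<^sub>R grad f z" for z
    by (rule grad_eqI)
  show ?case unfolding g vector_scaleR_component real_scaleR_def
  proof (intro conjI allI)
    show "(\<lambda>z. 1 / f z) differentiable (at z)" for z using d by (auto simp: differentiable_def)
    show "elementary (\<lambda>z. ((-1) * (1 / f z) * (1 / f z)) * grad f z $ i)" for i
      using recip by (intro elementary.mult elementary.const elementary.recip) auto
  qed
qed

lemma elementary_smooth: "elementary f \<Longrightarrow> smooth f"
proof -
  have "elementary f \<Longrightarrow> C_k n f" for n
  proof (induction n arbitrary: f)
    case 0
    then show ?case
      using elementary_grad[of f]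
      by (auto intro!: differentiable_imp_continuous_on simp: differentiable_on_def differentiable_at_withinI)
  next
    case (Suc n)
    then show ?case using elementary_grad[of f] by auto
  qed
  then show "elementary f \<Longrightarrow> smooth f" by (simp add: smooth_def)
qed

lemma smooth_differentiable: "smooth f \<Longrightarrow> f differentiable (at z)"
  unfolding smooth_def by (metis C_k.simps(2))

lemma smooth_continuous: "smooth f \<Longrightarrow> continuous_on UNIV f"
  unfolding smooth_def by (metis C_k.simps(1))

lemma smooth_continuous_grad:
  assumes "smooth f" shows "continuous_on UNIV (grad f)"
proof -
  have "C_k (Suc 0) f" using assms by (simp add: smooth_def)
  then have "\<And>i. continuous_on UNIV (\<lambda>x. grad f x $ i)" by simp
  then show ?thesis by (rule continuous_on_vec_lambda[of UNIV "\<lambda>i x. grad f x $ i", simplified])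
qed

text \<open>
A smooth monotone step from 0 (left of 0) to 1 (right of 1).
\<close>

definition step :: "real \<Rightarrow> real" where
  "step t = flat 0 t / (flat 0 t + flat 0 (1 - t))"

lemma flat0_mono: "s \<le> t \<Longrightarrow> flat 0 s \<le> flat 0 t"
  by (auto simp: flat_def frac_le)

lemma flat_nonneg: "0 \<le> flat n t"
  by (simp add: flat_def)

lemma step_denominator_pos: "0 < flat 0 t + flat 0 (1 - t)"
proof -
  have "0 < t \<or> 0 < 1 - t" by linarith
  then have "0 < flat 0 t \<or> 0 < flat 0 (1 - t)" by (auto simp: flat_def)
  then show ?thesis using flat_nonneg[of 0 t] flat_nonneg[of 0 "1 - t"] by linarith
qed

lemma step_range: "0 \<le> step t" "step t \<le> 1"
  using step_denominator_pos[of t] flat_nonneg[of 0 t] flat_nonneg[of 0 "1 - t"]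
  by (auto simp: step_def)

lemma step_le_0: "t \<le> 0 \<Longrightarrow> step t = 0" and step_ge_1: "t \<ge> 1 \<Longrightarrow> step t = 1"
  by (auto simp: step_def flat_def)

lemma step_mono: "s \<le> t \<Longrightarrow> step s \<le> step t"
proof -
  assume "s \<le> t"
  then have 1: "flat 0 s \<le> flat 0 t" "flat 0 (1 - t) \<le> flat 0 (1 - s)"
    by (auto intro: flat0_mono)
  have "flat 0 s * flat 0 (1 - t) \<le> flat 0 t * flat 0 (1 - s)"
    using 1 by (intro mult_mono flat_nonneg)
  then show ?thesis
    unfolding step_def using step_denominator_pos[of s] step_denominator_pos[of t]
    by (simp add: divide_simps algebra_simps)
qed

lemma elementary_step: "elementary f \<Longrightarrow> elementary (\<lambda>z. step (f z))"
proof -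
  assume f: "elementary f"
  have "elementary (\<lambda>z. flat 0 (f z) * (1 / (flat 0 (f z) + flat 0 (1 - f z))))"
    using f step_denominator_pos
    by (intro elementary.mult elementary.recip elementary.add elementary.flat elementary_diff elementary.const)
      (auto simp: less_le)
  then show ?thesis by (simp add: step_def)
qed

section \<open>Fubini in a rotated frame\<close>

lemma lborel_vec2: "distr (lborel :: (real \<times> real) measure) lborel (\<lambda>p. vector [fst p, snd p] :: real^2) = lborel"
proof (rule sym, rule lborel_eqI)
  let ?S = "\<lambda>p. vector [fst p, snd p] :: real^2"
  have S: "?S = (\<lambda>p. fst p *\<^sub>R axis 1 1 + snd p *\<^sub>R axis 2 1)"
    by (rule ext) (simp add: vec_eq_iff forall_2 axis_def)
  have meas: "?S \<in> borel_measurable borel"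
    unfolding S by (intro borel_measurable_continuous_onI continuous_intros)
  show "sets (distr lborel lborel ?S) = sets borel" by simp
  fix l u :: "real^2"
  assume lu: "\<And>b. b \<in> Basis \<Longrightarrow> l \<bullet> b \<le> u \<bullet> b"
  have le: "l $ i \<le> u $ i" for i
    using lu[of "axis i 1"] by (simp add: inner_axis axis_in_Basis_iff)
  have "?S -` box l u = box (l$1, l$2) (u$1, u$2)"
    by (auto simp: mem_box_cart forall_2 mem_box Basis_prod_def)
  then have "emeasure (distr lborel lborel ?S) (box l u) = emeasure lborel (box (l$1, l$2) (u$1, u$2))"
    using meas by (simp add: emeasure_distr)
  also have "\<dots> = ennreal (\<Prod>b\<in>Basis. ((u$1, u$2) - (l$1, l$2)) \<bullet> b)"
    by (rule emeasure_lborel_box) (auto simp: Basis_prod_def le)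
  also have "(\<Prod>b\<in>Basis. ((u$1, u$2) - (l$1, l$2)) \<bullet> b) = (u$1 - l$1) * (u$2 - l$2)"
    by (simp add: Basis_prod_def)
  also have "\<dots> = (\<Prod>b\<in>Basis. (u - l) \<bullet> b)"
  proof -
    have B: "(Basis :: (real^2) set) = {axis 1 1, axis 2 1}"
      by (auto simp: Basis_vec_def UNIV_2)
    have "axis 1 1 \<noteq> (axis 2 1 :: real^2)" by (simp add: axis_eq_axis)
    then show ?thesis unfolding B by (simp add: inner_axis)
  qed
  finally show "emeasure (distr lborel lborel ?S) (box l u) = (\<Prod>b\<in>Basis. (u - l) \<bullet> b)" .
qed

lemma lborel_orthogonal:
  fixes f :: "real^2 \<Rightarrow> real^2"
  assumes "orthogonal_transformation f"
  shows "distr lborel lborel f = lborel"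
proof (rule sym, rule lborel_eqI)
  show "sets (distr lborel lborel f) = sets borel" by simp
  have lin: "linear f" using assms by (rule orthogonal_transformation_linear)
  then have meas: "f \<in> borel_measurable borel"
    by (intro borel_measurable_continuous_onI linear_continuous_on)
      (simp add: linear_conv_bounded_linear)
  fix l u :: "real^2"
  assume lu: "\<And>b. b \<in> Basis \<Longrightarrow> l \<bullet> b \<le> u \<bullet> b"
  obtain g where g: "orthogonal_transformation g" "\<And>x. f (g x) = x" "\<And>x. g (f x) = x"
    using assms orthogonal_transformation_inv orthogonal_transformation_bij
    by (metis bij_inv_eq_iff)
  have eq: "f -` box l u = g ` box l u"
  proof (intro set_eqI iffI)
    show "x \<in> g ` box l u" if "x \<in> f -` box l u" for x
      using that g(3)[of x] by (intro image_eqI[of _ _ "f x"]) auto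
    show "x \<in> f -` box l u" if "x \<in> g ` box l u" for x
      using that g(2) by auto
  qed
  have b: "f -` box l u \<in> sets borel" using measurable_sets[OF meas, of "box l u"] by simp
  have lm: "g ` box l u \<in> lmeasurable"
    by (rule measurable_orthogonal_image) (auto simp: g)
  have "emeasure (distr lborel lborel f) (box l u) = emeasure lborel (f -` box l u)"
    using meas by (simp add: emeasure_distr)
  also have "\<dots> = emeasure lebesgue (g ` box l u)" using b by (simp add: eq)
  also have "\<dots> = ennreal (measure lebesgue (g ` box l u))"
    using lm by (simp add: emeasure_eq_measure2)
  also have "measure lebesgue (g ` box l u) = measure lebesgue (box l u)"
    by (rule measure_orthogonal_image) (auto simp: g)
  also have "\<dots> = (\<Prod>b\<in>Basis. (u - l) \<bullet> b)"
    using lu by (simp add: measure_lborel_box_eq)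
  finally show "emeasure (distr lborel lborel f) (box l u) = (\<Prod>b\<in>Basis. (u - l) \<bullet> b)" .
qed

text \<open>
Cartesian coordinates \<open>X\<close>, \<open>Y\<close> with origin \<open>c\<close> and axes \<open>e\<close>, \<open>e'\<close>; \<open>P\<close> is the inverse chart.
\<close>

locale frame =
  fixes c e e' :: "real^2"
  assumes orthonormal: "e \<bullet> e = 1" "e' \<bullet> e' = 1" "e \<bullet> e' = 0"
begin

lemma inner_frame: "e \<bullet> e = 1" "e' \<bullet> e' = 1" "e \<bullet> e' = 0" "e' \<bullet> e = 0"
  using orthonormal by (auto simp: inner_commute)

definition X :: "real^2 \<Rightarrow> real" where "X z = (z - c) \<bullet> e"
definition Y :: "real^2 \<Rightarrow> real" where "Y z = (z - c) \<bullet> e'"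
definition P :: "real \<Rightarrow> real \<Rightarrow> real^2" where "P x y = c + x *\<^sub>R e + y *\<^sub>R e'"

lemma X_P [simp]: "X (P x y) = x" and Y_P [simp]: "Y (P x y) = y"
  by (auto simp: X_def Y_def P_def inner_add_left inner_frame)

lemma orthogonal_frame: "orthogonal_transformation (\<lambda>v::real^2. v $ 1 *\<^sub>R e + v $ 2 *\<^sub>R e')"
  unfolding orthogonal_transformation_def
proof (intro conjI allI)
  show "linear (\<lambda>v::real^2. v $ 1 *\<^sub>R e + v $ 2 *\<^sub>R e')"
    by (rule linearI) (auto simp: algebra_simps)
  show "(v $ 1 *\<^sub>R e + v $ 2 *\<^sub>R e') \<bullet> (w $ 1 *\<^sub>R e + w $ 2 *\<^sub>R e') = v \<bullet> w"
    for v w :: "real^2"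
    by (simp add: inner_add_left inner_add_right inner_frame) (simp add: inner_vec_def sum_2)
qed

lemma P_X_Y [simp]: "P (X z) (Y z) = z"
proof -
  have "surj (\<lambda>v::real^2. v $ 1 *\<^sub>R e + v $ 2 *\<^sub>R e')"
    using orthogonal_frame by (rule orthogonal_transformation_surj)
  then obtain v :: "real^2" where v: "z - c = v $ 1 *\<^sub>R e + v $ 2 *\<^sub>R e'" unfolding surj_def by blast
  then have "P (v $ 1) (v $ 2) = z"
    unfolding P_def by (metis add.assoc add_diff_cancel_left' diff_add_cancel add.commute)
  then show ?thesis using X_P Y_P by metis
qed

lemma norm_P: "(norm (P x y - P x' y'))\<^sup>2 = (x - x')\<^sup>2 + (y - y')\<^sup>2"
proof -
  have "P x y - P x' y' = (x - x') *\<^sub>R e + (y - y') *\<^sub>R e'" by (simp add: P_def algebra_simps)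
  then have "(norm (P x y - P x' y'))\<^sup>2 =
      ((x - x') *\<^sub>R e + (y - y') *\<^sub>R e') \<bullet> ((x - x') *\<^sub>R e + (y - y') *\<^sub>R e')"
    by (simp only: power2_norm_eq_inner)
  also have "\<dots> = (x - x')\<^sup>2 + (y - y')\<^sup>2"
    by (simp only: inner_add_left inner_add_right inner_scaleR_left inner_scaleR_right inner_frame)
      (simp add: power2_eq_square)
  finally show ?thesis .
qed

lemma dist_XY: "(dist z w)\<^sup>2 = (X z - X w)\<^sup>2 + (Y z - Y w)\<^sup>2"
  using norm_P[of "X z" "Y z" "X w" "Y w"] by (simp add: dist_norm)

lemma continuous_X [continuous_intros]: "continuous_on S f \<Longrightarrow> continuous_on S (\<lambda>t. X (f t))"
  and continuous_Y [continuous_intros]: "continuous_on S f \<Longrightarrow> continuous_on S (\<lambda>t. Y (f t))"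
  unfolding X_def Y_def by (auto intro!: continuous_intros)

lemma continuous_P [continuous_intros]:
  "continuous_on S f \<Longrightarrow> continuous_on S g \<Longrightarrow> continuous_on S (\<lambda>t. P (f t) (g t))"
  unfolding P_def by (intro continuous_intros)

lemma measurable_XY [measurable]: "X \<in> borel_measurable borel" "Y \<in> borel_measurable borel"
  by (auto intro!: borel_measurable_continuous_onI continuous_X[where f="\<lambda>z. z"] continuous_Y[where f="\<lambda>z. z"])

lemma measurable_P [measurable]: "(\<lambda>p. P (fst p) (snd p)) \<in> borel_measurable borel"
  by (intro borel_measurable_continuous_onI continuous_P continuous_on_fst continuous_on_snd continuous_on_id)

lemma P_affine: "P ((1 - t) * x + t * x') ((1 - t) * y + t * y') = (1 - t) *\<^sub>R P x y + t *\<^sub>R P x' y'"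
  by (simp add: P_def algebra_simps)

lemma X_affine: "X ((1 - t) *\<^sub>R z + t *\<^sub>R w) = (1 - t) * X z + t * X w"
  and Y_affine: "Y ((1 - t) *\<^sub>R z + t *\<^sub>R w) = (1 - t) * Y z + t * Y w"
  by (simp_all add: X_def Y_def inner_diff_left inner_add_left algebra_simps)

lemma lborel_frame: "distr (lborel :: (real \<times> real) measure) lborel (\<lambda>p. P (fst p) (snd p)) = lborel"
proof -
  let ?S = "\<lambda>p. vector [fst p, snd p] :: real^2"
  let ?L = "\<lambda>v::real^2. v $ 1 *\<^sub>R e + v $ 2 *\<^sub>R e'"
  have S: "?S = (\<lambda>p. fst p *\<^sub>R axis 1 1 + snd p *\<^sub>R axis 2 1)"
    by (rule ext) (simp add: vec_eq_iff forall_2 axis_def)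
  have mS: "?S \<in> borel_measurable borel"
    unfolding S by (intro borel_measurable_continuous_onI continuous_intros)
  have mL: "?L \<in> borel_measurable borel"
    by (intro borel_measurable_continuous_onI continuous_intros)
  have 1: "((+) c \<circ> ?L) \<circ> ?S = (\<lambda>p. P (fst p) (snd p))"
    by (rule ext) (simp add: P_def)
  have "distr (lborel :: (real \<times> real) measure) lborel (\<lambda>p. P (fst p) (snd p)) =
      distr (lborel :: (real \<times> real) measure) borel (((+) c \<circ> ?L) \<circ> ?S)"
    unfolding 1 by (rule distr_cong) auto
  also have "\<dots> = distr (distr (lborel :: (real \<times> real) measure) lborel ?S) borel ((+) c \<circ> ?L)"
    using mS mL by (intro distr_distr[symmetric]) (auto intro!: measurable_comp)
  also have "\<dots> = distr lborel borel ((+) c \<circ> ?L)"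
    by (simp only: lborel_vec2)
  also have "\<dots> = distr (distr lborel lborel ?L) borel ((+) c)"
    using mL by (intro distr_distr[symmetric]) auto
  also have "\<dots> = distr lborel borel ((+) c)"
    by (simp only: lborel_orthogonal[OF orthogonal_frame])
  also have "\<dots> = lborel" by (rule lborel_distr_plus)
  finally show ?thesis .
qed

lemma nn_integral_frame:
  fixes F :: "real^2 \<Rightarrow> ennreal"
  assumes [measurable]: "F \<in> borel_measurable borel"
  shows "(\<integral>\<^sup>+z. F z \<partial>lborel) = (\<integral>\<^sup>+x. \<integral>\<^sup>+y. F (P x y) \<partial>lborel \<partial>lborel)"
    and "(\<integral>\<^sup>+z. F z \<partial>lborel) = (\<integral>\<^sup>+y. \<integral>\<^sup>+x. F (P x y) \<partial>lborel \<partial>lborel)"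
proof -
  have m: "(\<lambda>(x, y). F (P x y)) \<in> borel_measurable (lborel \<Otimes>\<^sub>M lborel)"
    using measurable_compose[OF measurable_P assms] by (simp add: lborel_prod case_prod_unfold)
  have "(\<integral>\<^sup>+z. F z \<partial>lborel) = (\<integral>\<^sup>+p. F (P (fst p) (snd p)) \<partial>(lborel \<Otimes>\<^sub>M lborel))"
    by (subst lborel_frame[symmetric]) (simp add: nn_integral_distr lborel_prod)
  also have "\<dots> = (\<integral>\<^sup>+p. (\<lambda>(x, y). F (P x y)) p \<partial>(lborel \<Otimes>\<^sub>M lborel))"
    by (simp add: case_prod_unfold)
  finally have *: "(\<integral>\<^sup>+z. F z \<partial>lborel) = \<dots>" .
  show "(\<integral>\<^sup>+z. F z \<partial>lborel) = (\<integral>\<^sup>+x. \<integral>\<^sup>+y. F (P x y) \<partial>lborel \<partial>lborel)"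
    unfolding * using lborel.nn_integral_fst[OF m] by simp
  show "(\<integral>\<^sup>+z. F z \<partial>lborel) = (\<integral>\<^sup>+y. \<integral>\<^sup>+x. F (P x y) \<partial>lborel \<partial>lborel)"
    unfolding * using lborel_pair.nn_integral_snd[OF m] by simp
qed

lemma lborel_integral_frame:
  fixes F :: "real^2 \<Rightarrow> real"
  assumes "integrable lborel F"
  shows "(LINT z|lborel. F z) = (LINT x|lborel. LINT y|lborel. F (P x y))"
    and "(LINT z|lborel. F z) = (LINT y|lborel. LINT x|lborel. F (P x y))"
    and "integrable lborel (\<lambda>x. LINT y|lborel. F (P x y))"
proof -
  have [measurable]: "F \<in> borel_measurable borel" using assms by simp
  have "integrable (distr (lborel :: (real \<times> real) measure) lborel (\<lambda>p. P (fst p) (snd p))) F"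
    using assms by (simp add: lborel_frame)
  then have i: "integrable (lborel \<Otimes>\<^sub>M lborel) (\<lambda>(x, y). F (P x y))"
    by (subst (asm) integrable_distr_eq) (auto simp: lborel_prod case_prod_unfold)
  have "(LINT z|lborel. F z) = (LINT p|(lborel \<Otimes>\<^sub>M lborel). F (P (fst p) (snd p)))"
    by (subst lborel_frame[symmetric]) (simp add: integral_distr lborel_prod)
  then have *: "(LINT z|lborel. F z) = (LINT p|(lborel \<Otimes>\<^sub>M lborel). (\<lambda>(x, y). F (P x y)) p)"
    by (simp add: case_prod_unfold)
  show "(LINT z|lborel. F z) = (LINT x|lborel. LINT y|lborel. F (P x y))"
    unfolding * using lborel_pair.integral_fst'[OF i] by (simp add: case_prod_unfold)
  show "(LINT z|lborel. F z) = (LINT y|lborel. LINT x|lborel. F (P x y))"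
    unfolding * using lborel_pair.integral_snd[OF i] by (simp add: case_prod_unfold)
  show "integrable lborel (\<lambda>x. LINT y|lborel. F (P x y))"
    using lborel_pair.integrable_fst'[OF i] by simp
qed

end

section \<open>One-dimensional Hausdorff measure\<close>

lemma interval_cover:
  fixes D :: "real set"
  assumes "bounded D"
  obtains J where "J \<in> sets borel" "D \<subseteq> J" "emeasure lborel J \<le> ennreal (diameter D)"
proof (cases "D = {}")
  case True
  then show ?thesis using that[of "{}"] by simp
next
  case False
  have bd: "bdd_below D" "bdd_above D"
    using assms by (auto intro: bounded_imp_bdd_below bounded_imp_bdd_above)
  have "Sup D - Inf D \<le> diameter D"
  proof -
    have "x \<le> y + diameter D" if "x \<in> D" "y \<in> D" for x y
      using diameter_bounded_bound[OF assms that] by (auto simp: dist_real_def)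
    then have "Sup D \<le> y + diameter D" if "y \<in> D" for y
      using False that by (intro cSup_least) auto
    then have "Sup D - diameter D \<le> Inf D"
      using False by (intro cInf_greatest) (auto simp: algebra_simps)
    then show ?thesis by simp
  qed
  moreover have "D \<subseteq> {Inf D..Sup D}" using bd by (auto intro: cInf_lower cSup_upper)
  moreover have "Inf D \<le> Sup D" using False bd by (metis all_not_in_conv cInf_lower cSup_upper order_trans)
  ultimately show ?thesis
    using that[of "{Inf D..Sup D}"] by (auto intro: ennreal_leI)
qed

text \<open>
A 1-Lipschitz function maps every cover to a cover by sets of no larger diameter, and sets of reals have at most their
diameter as Lebesgue measure. All lower bounds for arc length are obtained from linear functions in this way.
\<close>

lemma lborel_le_hausdorff1_outer:
  fixes f :: "real^2 \<Rightarrow> real"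
  assumes B: "B \<in> sets borel" "B \<subseteq> f ` A"
    and lip: "\<And>z w. \<bar>f z - f w\<bar> \<le> dist z w"
  shows "emeasure lborel B \<le> hausdorff1_outer A"
proof -
  have "emeasure lborel B \<le> hausdorff1_pre 1 A"
    unfolding hausdorff1_pre_def
  proof (rule INF_greatest)
    fix C :: "nat \<Rightarrow> (real^2) set"
    assume C: "C \<in> {C. A \<subseteq> (\<Union>i. C i) \<and> (\<forall>i. bounded (C i) \<and> diameter (C i) \<le> 1)}"
    have "\<exists>J. J \<in> sets borel \<and> f ` C i \<subseteq> J \<and> emeasure lborel J \<le> ennreal (diameter (C i))" for i
    proof -
      have d: "dist (f z) (f w) \<le> diameter (C i)" if "z \<in> C i" "w \<in> C i" for z w
        using lip[of z w] diameter_bounded_bound[of "C i" z w] C that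
        by (auto simp: dist_real_def)
      have b: "bounded (f ` C i)"
        unfolding bounded_two_points using d by blast
      have "diameter (f ` C i) \<le> diameter (C i)"
        using d diameter_ge_0[of "C i"] C by (intro diameter_le) (auto simp: dist_real_def)
      then show ?thesis using interval_cover[OF b] by (metis ennreal_leI order_trans)
    qed
    then obtain J where J: "\<And>i. J i \<in> sets borel" "\<And>i. f ` C i \<subseteq> J i"
        "\<And>i. emeasure lborel (J i) \<le> ennreal (diameter (C i))"
      by metis
    have "f ` A \<subseteq> (\<Union>i. f ` C i)" using C by blast
    also have "\<dots> \<subseteq> (\<Union>i. J i)" using J(2) by (rule UN_mono[OF order_refl])
    finally have "B \<subseteq> (\<Union>i. J i)" using B(2) by (rule order_trans[rotated])
    then have "emeasure lborel B \<le> emeasure lborel (\<Union>i. J i)"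
      using J(1) by (intro emeasure_mono) auto
    also have "\<dots> \<le> (\<Sum>i. emeasure lborel (J i))"
      using J(1) by (intro emeasure_subadditive_countably) auto
    also have "\<dots> \<le> (\<Sum>i. ennreal (diameter (C i)))"
      using J(3) by (intro suminf_le) auto
    finally show "emeasure lborel B \<le> (\<Sum>i. ennreal (diameter (C i)))" .
  qed
  also have "\<dots> \<le> hausdorff1_outer A"
    unfolding hausdorff1_outer_def by (rule SUP_upper) simp
  finally show ?thesis .
qed

text \<open>
The parameter interval is divided into pieces so short that their images have diameter at most \<open>\<delta>\<close>; the
sum of the diameters is bounded independently of the number of pieces.
\<close>

lemma hausdorff1_outer_lipschitz_image:
  fixes \<gamma> :: "real \<Rightarrow> real^2"
  assumes I: "I \<subseteq> {s..t}" and st: "s \<le> t" and C: "0 \<le> C"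
    and lip: "\<And>x y. x \<in> I \<Longrightarrow> y \<in> I \<Longrightarrow> dist (\<gamma> x) (\<gamma> y) \<le> C * \<bar>x - y\<bar>"
  shows "hausdorff1_outer (\<gamma> ` I) \<le> ennreal (C * (t - s))"
  unfolding hausdorff1_outer_def
proof (rule SUP_least)
  fix \<delta> :: real assume "\<delta> \<in> {0<..}"
  then have \<delta>: "0 < \<delta>" by simp
  obtain n where n: "C * (t - s) / \<delta> < real n" using reals_Archimedean2 by blast
  define h where "h = (t - s) / real (Suc n)"
  have h: "0 \<le> h" "C * h \<le> \<delta>"
  proof -
    show "0 \<le> h" using st by (simp add: h_def)
    have "C * (t - s) \<le> real (Suc n) * \<delta>" using n \<delta> by (simp add: field_simps)
    then show "C * h \<le> \<delta>" by (simp add: h_def field_simps)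
  qed
  define D where "D i = (if i < Suc n then \<gamma> ` (I \<inter> {s + real i * h .. s + real (Suc i) * h}) else {})" for i
  have d: "dist x y \<le> C * h" if xy: "x \<in> D i" "y \<in> D i" for x y i
  proof -
    have "i < Suc n" using xy by (auto simp: D_def split: if_splits)
    then obtain a b where ab: "x = \<gamma> a" "y = \<gamma> b" "a \<in> I" "b \<in> I"
        "s + real i * h \<le> a" "a \<le> s + real (Suc i) * h" "s + real i * h \<le> b" "b \<le> s + real (Suc i) * h"
      using xy by (auto simp: D_def)
    then have "\<bar>a - b\<bar> \<le> h" by (auto simp: algebra_simps)
    then show ?thesis using lip[OF ab(3,4)] C ab(1,2)
      by (meson mult_left_mono order_trans)
  qed
  have bd: "bounded (D i)" for i unfolding bounded_two_points using d by blast
  have dm: "diameter (D i) \<le> C * h" for i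
    using d[of _ i] h C by (intro diameter_le) (auto simp: dist_norm[symmetric])
  have cov: "\<gamma> ` I \<subseteq> (\<Union>i. D i)"
  proof
    fix z assume "z \<in> \<gamma> ` I"
    then obtain a where a: "a \<in> I" "z = \<gamma> a" by auto
    show "z \<in> (\<Union>i. D i)"
    proof (cases "h = 0")
      case True
      then have "s = t" by (simp add: h_def)
      then have "z \<in> D 0" using a I True by (auto simp: D_def)
      then show ?thesis by auto
    next
      case False
      then have hp: "0 < h" using h by simp
      define q where "q = (a - s) / h"
      have q: "0 \<le> q" "q \<le> real (Suc n)" "a = s + q * h"
      proof -
        show "0 \<le> q" "a = s + q * h" using hp a I by (auto simp: q_def)
        have "a - s \<le> real (Suc n) * h" using a I by (auto simp: h_def)
        then show "q \<le> real (Suc n)" using hp by (simp add: q_def field_simps)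
      qed
      define i where "i = (if q = real (Suc n) then n else nat \<lfloor>q\<rfloor>)"
      have i: "i < Suc n" "real i \<le> q" "q \<le> real (Suc i)"
        unfolding i_def using q by (auto; linarith)+
      have "z \<in> D i" using i a q hp by (auto simp: D_def intro!: mult_right_mono)
      then show ?thesis by auto
    qed
  qed
  have "hausdorff1_pre \<delta> (\<gamma> ` I) \<le> (\<Sum>i. ennreal (diameter (D i)))"
    unfolding hausdorff1_pre_def
    by (rule INF_lower) (use cov bd order_trans[OF dm h(2)] in auto)
  also have "\<dots> = (\<Sum>i<Suc n. ennreal (diameter (D i)))"
    by (intro suminf_finite) (auto simp: D_def)
  also have "\<dots> \<le> (\<Sum>i<Suc n. ennreal (C * h))"
    using dm by (intro sum_mono ennreal_leI)
  also have "\<dots> = ennreal (C * (t - s))"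
  proof -
    have "(\<Sum>i<Suc n. ennreal (C * h)) = ennreal (\<Sum>i<Suc n. C * h)"
      using C h by (intro sum_ennreal) auto
    also have "(\<Sum>i<Suc n. C * h) = C * (t - s)"
      by (simp add: h_def field_simps del: sum.lessThan_Suc)
    finally show ?thesis .
  qed
  finally show "hausdorff1_pre \<delta> (\<gamma> ` I) \<le> ennreal (C * (t - s))" .
qed

lemma sets_hausdorff1 [simp, measurable_cong]: "sets hausdorff1 = sets borel"
  and space_hausdorff1 [simp]: "space hausdorff1 = UNIV"
proof -
  have "sigma_sets UNIV (sets (borel :: (real^2) measure)) = sets borel"
    by (metis sets.sigma_sets_eq space_borel)
  then show "sets hausdorff1 = sets borel" "space hausdorff1 = UNIV"
    by (simp_all add: hausdorff1_def sets_measure_of_conv space_measure_of_conv)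
qed

text \<open>
If the outer measure were not countably additive on Borel sets, the measure generated from it would vanish
identically. So one set of nonzero measure certifies that the measure agrees with the outer measure.
\<close>

lemma emeasure_hausdorff1:
  assumes "emeasure hausdorff1 S \<noteq> 0" "A \<in> sets borel"
  shows "emeasure hausdorff1 A = hausdorff1_outer A"
proof -
  have "sigma_sets UNIV (sets (borel :: (real^2) measure)) = sets borel"
    by (metis sets.sigma_sets_eq space_borel)
  then show ?thesis using assms
    unfolding hausdorff1_def by (auto simp: emeasure_measure_of_conv split: if_splits)
qed

lemma hausdorff1_outer_mono: "A \<subseteq> B \<Longrightarrow> hausdorff1_outer A \<le> hausdorff1_outer B"
  unfolding hausdorff1_outer_def hausdorff1_pre_def
  by (intro SUP_mono' INF_superset_mono) auto

lemma circle_lipschitz: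
  "(dist (vector [cos s, sin s] :: real^2) (vector [cos t, sin t])) \<le> \<bar>s - t\<bar>"
proof -
  have "(dist (vector [cos s, sin s] :: real^2) (vector [cos t, sin t]))\<^sup>2
      = (cos s - cos t)\<^sup>2 + (sin s - sin t)\<^sup>2"
    by (simp add: dist_vec_def L2_set_def sum_2 dist_real_def)
  also have "\<dots> = 2 - 2 * cos (s - t)"
    using sin_cos_squared_add[of s] sin_cos_squared_add[of t]
    by (simp add: cos_diff power2_eq_square algebra_simps)
  also have "\<dots> = 4 * (sin ((s - t) / 2))\<^sup>2"
  proof -
    have "cos (s - t) = 1 - 2 * (sin ((s - t) / 2))\<^sup>2"
      by (metis cos_double_sin field_sum_of_halves mult_2)
    then show ?thesis by simp
  qed
  also have "\<dots> \<le> 4 * ((s - t) / 2)\<^sup>2"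
    using abs_sin_x_le_abs_x[of "(s - t) / 2"] by (simp only: abs_le_square_iff)
  also have "\<dots> = \<bar>s - t\<bar>\<^sup>2" by (simp add: power2_eq_square)
  finally show ?thesis by (rule power2_le_imp_le) simp
qed

text \<open>
The nearest-point projection onto a convex set is 1-Lipschitz. It maps a surrounding circle onto the boundary: the ray
along an outer normal at a boundary point meets the circle and is projected back to that point. Hence
the boundary is no longer than the circle.
\<close>

lemma hausdorff1_outer_frontier_le:
  fixes S :: "(real^2) set"
  assumes S: "convex S" "open S" "S \<noteq> {}" "closure S \<subseteq> cball c \<rho>"
  shows "hausdorff1_outer (frontier S) \<le> ennreal (\<rho> * (2 * pi))"
proof -
  let ?K = "closure S"
  let ?\<gamma> = "\<lambda>t. closest_point ?K (c + \<rho> *\<^sub>R vector [cos t, sin t])"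
  have K: "convex ?K" "closed ?K" "?K \<noteq> {}" using S by (auto intro: convex_closure)
  have \<rho>: "0 \<le> \<rho>" using S K(3) by (metis cball_empty ex_in_conv linorder_not_le subset_empty)
  have lip: "dist (?\<gamma> s) (?\<gamma> t) \<le> \<rho> * \<bar>s - t\<bar>" for s t
  proof -
    have "dist (?\<gamma> s) (?\<gamma> t) \<le> dist (c + \<rho> *\<^sub>R vector [cos s, sin s]) (c + \<rho> *\<^sub>R vector [cos t, sin t])"
      by (rule closest_point_lipschitz[OF K])
    also have "\<dots> = \<rho> * dist (vector [cos s, sin s] :: real^2) (vector [cos t, sin t])"
      using \<rho> by (simp add: dist_norm flip: scaleR_diff_right)
    also have "\<dots> \<le> \<rho> * \<bar>s - t\<bar>" using \<rho> circle_lipschitz by (intro mult_left_mono)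
    finally show ?thesis .
  qed
  have "frontier S \<subseteq> ?\<gamma> ` {0..2 * pi}"
  proof
    fix x assume x: "x \<in> frontier S"
    then have xK: "x \<in> ?K" by (simp add: frontier_def)
    obtain a where a: "a \<noteq> 0" "\<And>y. y \<in> ?K \<Longrightarrow> a \<bullet> x \<le> a \<bullet> y"
    proof (rule supporting_hyperplane_relative_frontier[OF S(1) xK])
      show "x \<notin> rel_interior S"
        using x S(2) by (simp add: rel_interior_open frontier_def interior_open)
    qed blast
    have "\<exists>t\<ge>0. norm (x - t *\<^sub>R a - c) = \<rho>"
    proof -
      let ?f = "\<lambda>t. norm (x - t *\<^sub>R a - c)"
      let ?T = "(\<rho> + norm (x - c)) / norm a"
      have cont: "continuous_on {0..?T} ?f" by (intro continuous_intros)
      have Tpos: "0 \<le> ?T" using \<rho> by simp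
      have "?f 0 \<le> \<rho>" using xK S(4) by (auto simp: dist_norm norm_minus_commute)
      moreover have "\<rho> \<le> ?f ?T"
      proof -
        have "norm (?T *\<^sub>R a) = \<rho> + norm (x - c)" using a(1) \<rho> by simp
        moreover have "norm (?T *\<^sub>R a) - norm (x - c) \<le> norm (?T *\<^sub>R a - (x - c))"
          by (rule norm_triangle_ineq2)
        moreover have "norm (?T *\<^sub>R a - (x - c)) = ?f ?T"
          
          using norm_minus_commute[of "?T *\<^sub>R a" "x - c"] by (simp only: diff_diff_eq add.commute)
        ultimately show ?thesis by simp
      qed
      ultimately show ?thesis
        using IVT'[of ?f 0 \<rho> ?T] Tpos cont by blast
    qed
    then obtain t where t: "0 \<le> t" "norm (x - t *\<^sub>R a - c) = \<rho>" by blast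
    have "x = closest_point ?K (x - t *\<^sub>R a)"
    proof (rule closest_point_unique[OF K(1,2) xK], rule ballI)
      fix z assume z: "z \<in> ?K"
      have "(dist (x - t *\<^sub>R a) x)\<^sup>2 = t * t * (a \<bullet> a)"
        by (simp add: dist_norm power_mult_distrib power2_norm_eq_inner power2_eq_square[of t])
      also have "\<dots> \<le> (x - z) \<bullet> (x - z) + 2 * t * (a \<bullet> z - a \<bullet> x) + t * t * (a \<bullet> a)"
        using a(2)[OF z] t(1) by simp
      also have "\<dots> = (dist (x - t *\<^sub>R a) z)\<^sup>2"
        by (simp add: dist_norm power2_norm_eq_inner inner_diff_left inner_diff_right inner_commute algebra_simps)
      finally show "dist (x - t *\<^sub>R a) x \<le> dist (x - t *\<^sub>R a) z" by (rule power2_le_imp_le) simp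
    qed
    moreover have "\<exists>s\<in>{0..2 * pi}. x - t *\<^sub>R a = c + \<rho> *\<^sub>R vector [cos s, sin s]"
    proof (cases "\<rho> = 0")
      case True
      then show ?thesis using t(2) by (auto intro!: bexI[of _ 0])
    next
      case False
      define v where "v = (1 / \<rho>) *\<^sub>R (x - t *\<^sub>R a - c)"
      have "norm v = 1" using t(2) False \<rho> by (simp add: v_def)
      then have "(v $ 1)\<^sup>2 + (v $ 2)\<^sup>2 = 1"
        by (simp add: norm_vec_def L2_set_def sum_2)
      then obtain s where s: "0 \<le> s" "s < 2 * pi" "v $ 1 = cos s" "v $ 2 = sin s"
        using sincos_total_2pi by metis
      then have "v = vector [cos s, sin s]" by (simp add: vec_eq_iff forall_2)
      moreover have "x - t *\<^sub>R a = c + \<rho> *\<^sub>R v" using False by (simp add: v_def)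
      ultimately show ?thesis using s by auto
    qed
    ultimately show "x \<in> ?\<gamma> ` {0..2 * pi}" by auto
  qed
  then have "hausdorff1_outer (frontier S) \<le> hausdorff1_outer (?\<gamma> ` {0..2 * pi})"
    by (rule hausdorff1_outer_mono)
  also have "\<dots> \<le> ennreal (\<rho> * (2 * pi - 0))"
    using lip \<rho> by (intro hausdorff1_outer_lipschitz_image) auto
  finally show ?thesis by simp
qed

section \<open>Cut-off functions of small variation\<close>

text \<open>
Cover \<open>K\<close> by finitely many boxes inside \<open>S\<close> and take the convex hull of all their vertices.
\<close>

lemma polytope_between:
  fixes S :: "'a::euclidean_space set"
  assumes "open S" "convex S" "compact K" "K \<subseteq> S"
  obtains Q where "polytope Q" "K \<subseteq> interior Q" "Q \<subseteq> S"
proof -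
  have "\<forall>x\<in>K. \<exists>ab. cbox (fst ab) (snd ab) \<subseteq> S \<and> x \<in> box (fst ab) (snd ab)"
    using assms(1,4) by (metis fst_conv in_mono open_contains_cbox snd_conv)
  then obtain ab where ab: "\<And>x. x \<in> K \<Longrightarrow> cbox (fst (ab x)) (snd (ab x)) \<subseteq> S"
      "\<And>x. x \<in> K \<Longrightarrow> x \<in> box (fst (ab x)) (snd (ab x))"
    by metis
  obtain K' where K': "K' \<subseteq> K" "finite K'" "K \<subseteq> (\<Union>x\<in>K'. box (fst (ab x)) (snd (ab x)))"
    by (rule compactE_image[OF assms(3), of K "\<lambda>x. box (fst (ab x)) (snd (ab x))"]) (use ab(2) in auto)
  have "\<forall>x. \<exists>V. finite V \<and> cbox (fst (ab x)) (snd (ab x)) = convex hull V"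
    by (intro allI) (rule polytope_interval[unfolded polytope_def])
  then obtain V where V: "\<And>x. finite (V x)" "\<And>x. cbox (fst (ab x)) (snd (ab x)) = convex hull (V x)"
    by metis
  let ?Q = "convex hull (\<Union>x\<in>K'. V x)"
  show ?thesis
  proof
    show "polytope ?Q" 
      unfolding polytope_def by (rule exI[of _ "\<Union>x\<in>K'. V x"]) (simp add: K'(2) V(1))
    have "V x \<subseteq> S" if "x \<in> K'" for x
      using ab(1)[of x] V(2)[of x] hull_subset[of "V x" convex] that K'(1) by blast
    then show "?Q \<subseteq> S" using assms(2) by (intro hull_minimal) auto
    have "box (fst (ab x)) (snd (ab x)) \<subseteq> interior ?Q" if "x \<in> K'" for x
    proof (rule interior_maximal)
      have "convex hull (V x) \<subseteq> ?Q" using that by (intro hull_mono) auto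
      then show "box (fst (ab x)) (snd (ab x)) \<subseteq> ?Q" using V(2)[of x] box_subset_cbox by blast
    qed (rule open_box)
    then show "K \<subseteq> interior ?Q" using K'(3) by blast
  qed
qed

lemma line_derivative:
  assumes "\<And>z. F differentiable (at z)"
  shows "((\<lambda>t. F (z + t *\<^sub>R v)) has_real_derivative grad F (z + t *\<^sub>R v) \<bullet> v) (at t)"
proof -
  have "((\<lambda>t. z + t *\<^sub>R v) has_derivative (\<lambda>h. h *\<^sub>R v)) (at t)"
    by (auto intro!: derivative_eq_intros)
  from has_derivative_compose[OF this has_derivative_grad[OF assms]]
  show ?thesis by (simp add: has_field_derivative_def mult_commute_abs)
qed

lemma grad_nonneg:
  assumes F: "smooth F" and mono: "\<And>z t. 0 \<le> t \<Longrightarrow> F z \<le> F (z + t *\<^sub>R v)"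
  shows "0 \<le> grad F z \<bullet> v"
proof (rule ccontr)
  assume "\<not> 0 \<le> grad F z \<bullet> v"
  then obtain d where "d > 0" "\<forall>h>0. h < d \<longrightarrow> F (z + 0 *\<^sub>R v) > F (z + (0 + h) *\<^sub>R v)"
    using DERIV_neg_dec_right[OF line_derivative[OF smooth_differentiable[OF F], of z v 0]] by auto
  then show False using mono[of "d / 2" z] by (auto dest!: spec[of _ "d / 2"])
qed

lemma grad_uminus: "smooth F \<Longrightarrow> grad (\<lambda>z. - F z) z = - grad F z"
  by (rule grad_eqI) (auto intro!: derivative_eq_intros has_derivative_grad smooth_differentiable)

lemma grad_mult:
  "smooth F \<Longrightarrow> smooth G \<Longrightarrow> grad (\<lambda>z. F z * G z) z = F z *\<^sub>R grad G z + G z *\<^sub>R grad F z"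
  by (rule grad_eqI)
    (auto intro!: derivative_eq_intros has_derivative_grad smooth_differentiable simp: inner_add_left)

lemma grad_eq_0_outside:
  assumes "z \<notin> closure {x. f x \<noteq> 0}"
  shows "grad f z = 0"
proof (rule grad_eqI)
  have "((\<lambda>_. 0) has_derivative (\<lambda>v. 0)) (at z)" by simp
  then have "(f has_derivative (\<lambda>v. 0)) (at z)"
    by (rule has_derivative_transform_within_open[of _ _ _ _ "- closure {x. f x \<noteq> 0}"])
      (use assms closure_subset[of "{x. f x \<noteq> 0}"] in auto)
  then show "(f has_derivative (\<lambda>v. 0 \<bullet> v)) (at z)" by simp
qed

text \<open>
Along every line in direction \<open>v\<close> the function is a product of an increasing and a decreasing function with values in
the unit interval. This is a smooth substitute for being the indicator of a convex set, and survives products.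
\<close>

definition unimodal_along :: "real^2 \<Rightarrow> (real^2 \<Rightarrow> real) \<Rightarrow> bool" where
  "unimodal_along v \<eta> \<longleftrightarrow> (\<exists>F G. smooth F \<and> smooth G \<and> (\<forall>z. \<eta> z = F z * G z) \<and>
     (\<forall>z. 0 \<le> F z \<and> F z \<le> 1 \<and> 0 \<le> G z \<and> G z \<le> 1) \<and>
     (\<forall>z. 0 \<le> grad F z \<bullet> v \<and> grad G z \<bullet> v \<le> 0))"

text \<open>
The cut-off is a product of steps, one for every side of a polygon between \<open>K\<close> and \<open>S\<close>. Given a
direction \<open>v\<close>, a factor increases along \<open>v\<close> or decreases, according to the sign of the inner product of \<open>v\<close> with the normal of the side.
\<close>

lemma cutoff:
  fixes S :: "(real^2) set"
  assumes S: "open S" "convex S" and K: "compact K" "K \<subseteq> S"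
  obtains \<eta> where "test_function S \<eta>" "elementary \<eta>" "\<And>z. 0 \<le> \<eta> z" "\<And>z. \<eta> z \<le> 1" "\<And>z. z \<in> K \<Longrightarrow> \<eta> z = 1"
    "\<And>v. unimodal_along v \<eta>"
proof -
  obtain Q where Q: "polytope Q" "K \<subseteq> interior Q" "Q \<subseteq> S"
    by (rule polytope_between[OF S K])
  obtain H where H: "finite H" "Q = \<Inter> H" "\<forall>h\<in>H. \<exists>a b. a \<noteq> 0 \<and> h = {x. a \<bullet> x \<le> b}"
    using polytope_imp_polyhedron[OF Q(1)] unfolding polyhedron_def by metis
  obtain a b where ab: "\<And>h. h \<in> H \<Longrightarrow> a h \<noteq> (0 :: real^2)" "\<And>h. h \<in> H \<Longrightarrow> h = {x. a h \<bullet> x \<le> b h}"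
    using H(3) by metis
  \<comment> \<open>\<open>K\<close> has a positive distance from every side; scale so that all steps have reached 1 on \<open>K\<close>.\<close>
  have "\<exists>n::nat. \<forall>z\<in>K. 1 \<le> real n * (b h - a h \<bullet> z)" if h: "h \<in> H" for h
  proof (cases "K = {}")
    case False
    have "continuous_on K (\<lambda>z. b h - a h \<bullet> z)" by (intro continuous_intros)
    then obtain z0 where z0: "z0 \<in> K" "\<And>z. z \<in> K \<Longrightarrow> b h - a h \<bullet> z0 \<le> b h - a h \<bullet> z"
      using continuous_attains_inf[OF K(1) False, of "\<lambda>z. b h - a h \<bullet> z"] by blast
    have "interior Q \<subseteq> interior {x. a h \<bullet> x \<le> b h}"
      using h ab(2)[OF h] H(2) by (intro interior_mono) auto
    then have "z0 \<in> {x. a h \<bullet> x < b h}"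
      using interior_halfspace_le[OF ab(1)[OF h]] z0(1) Q(2) by blast
    then have pos: "0 < b h - a h \<bullet> z0" by simp
    then obtain n :: nat where "1 \<le> real n * (b h - a h \<bullet> z0)"
      using reals_Archimedean3[of "b h - a h \<bullet> z0"] by (meson less_imp_le)
    then show ?thesis using z0(2) by (meson mult_left_mono of_nat_0_le_iff order_trans)
  qed auto
  then obtain n :: "(real^2) set \<Rightarrow> nat" where n: "\<And>h z. h \<in> H \<Longrightarrow> z \<in> K \<Longrightarrow> 1 \<le> real (n h) * (b h - a h \<bullet> z)"
    by metis
  define s where "s h z = step (real (n h) * (b h - a h \<bullet> z))" for h z
  define \<eta> where "\<eta> z = (\<Prod>h\<in>H. s h z)" for z
  have el_s: "elementary (s h)" for h
    unfolding s_def
    by (intro elementary_step elementary.mult elementary_diff elementary.const elementary.inner)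
  have s01: "0 \<le> s h z" "s h z \<le> 1" for h z by (simp_all add: s_def step_range)
  have el: "elementary \<eta>" unfolding \<eta>_def using H(1) by (intro elementary_prod el_s)
  have "{z. \<eta> z \<noteq> 0} \<subseteq> Q"
  proof
    fix z assume "z \<in> {z. \<eta> z \<noteq> 0}"
    then have "\<And>h. h \<in> H \<Longrightarrow> s h z \<noteq> 0" using H(1) by (simp add: \<eta>_def)
    then have "\<And>h. h \<in> H \<Longrightarrow> 0 < real (n h) * (b h - a h \<bullet> z)"
      unfolding s_def by (metis step_le_0 not_less)
    then have "\<And>h. h \<in> H \<Longrightarrow> a h \<bullet> z \<le> b h"
      by (simp add: zero_less_mult_iff less_imp_le)
    then have "\<And>h. h \<in> H \<Longrightarrow> z \<in> h" using ab(2) by blast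
    then show "z \<in> Q" using H(2) by auto
  qed
  then have cl: "closure {z. \<eta> z \<noteq> 0} \<subseteq> Q"
    using polytope_imp_compact[OF Q(1)] by (intro closure_minimal compact_imp_closed)
  have cp: "compact (closure {z. \<eta> z \<noteq> 0})"
    using cl polytope_imp_compact[OF Q(1)] by (metis closed_closure compact_Int_closed inf.absorb_iff2)
  show ?thesis
  proof (rule that)
    show "test_function S \<eta>"
      unfolding test_function_def using el cp cl Q(3) by (auto intro: elementary_smooth)
    show "elementary \<eta>" by (rule el)
    show "0 \<le> \<eta> z" "\<eta> z \<le> 1" for z
      unfolding \<eta>_def using s01 by (auto intro: prod_nonneg prod_le_1)
    show "\<eta> z = 1" if "z \<in> K" for z
      unfolding \<eta>_def s_def using n that by (intro prod.neutral) (auto intro: step_ge_1)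
    fix v
    let ?F = "\<lambda>z. \<Prod>h\<in>{h\<in>H. a h \<bullet> v \<le> 0}. s h z"
    let ?G = "\<lambda>z. \<Prod>h\<in>H - {h\<in>H. a h \<bullet> v \<le> 0}. s h z"
    have sm: "smooth ?F" "smooth ?G"
      using H(1) by (auto intro!: elementary_smooth elementary_prod el_s)
    have eq: "\<eta> z = ?F z * ?G z" for z
      unfolding \<eta>_def using H(1) by (subst prod.subset_diff[of "{h\<in>H. a h \<bullet> v \<le> 0}" H]) (auto simp: mult.commute)
    have mono: "s h z \<le> s h (z + t *\<^sub>R v)" if "0 \<le> t" "a h \<bullet> v \<le> 0" for h z t
      unfolding s_def using that
      by (intro step_mono mult_left_mono) (auto simp: inner_add_right mult_nonneg_nonpos)
    have anti: "s h (z + t *\<^sub>R v) \<le> s h z" if "0 \<le> t" "\<not> a h \<bullet> v \<le> 0" for h z t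
      unfolding s_def using that
      by (intro step_mono mult_left_mono) (auto simp: inner_add_right)
    have F: "0 \<le> grad ?F z \<bullet> v" for z
      using mono s01 by (intro grad_nonneg[OF sm(1)] prod_mono) auto
    have "0 \<le> grad (\<lambda>z. - ?G z) z \<bullet> v" for z
    proof (rule grad_nonneg)
      have "smooth (\<lambda>z. (-1) * ?G z)"
        using H(1) by (intro elementary_smooth elementary.mult elementary.const elementary_prod el_s) auto
      then show "smooth (\<lambda>z. - ?G z)" by simp
      show "- ?G z \<le> - ?G (z + t *\<^sub>R v)" if "0 \<le> t" for z t
        using anti[OF that] s01 by (auto intro!: prod_mono)
    qed
    then have G: "grad ?G z \<bullet> v \<le> 0" for z using grad_uminus[OF sm(2)] by simp
    have "\<forall>z. 0 \<le> ?F z \<and> ?F z \<le> 1 \<and> 0 \<le> ?G z \<and> ?G z \<le> 1"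
      using s01 by (auto intro!: prod_nonneg prod_le_1)
    then show "unimodal_along v \<eta>"
      unfolding unimodal_along_def using sm eq F G by (intro exI[of _ ?F] exI[of _ ?G]) auto
  qed
qed

text \<open>
With \<open>\<eta> = F G\<close> the derivative is at most \<open>F' - G'\<close> in absolute value, and the two terms integrate to at most 1 each.
\<close>

lemma variation_on_line:
  assumes "unimodal_along v \<eta>"
  shows "(\<integral>\<^sup>+t. ennreal \<bar>grad \<eta> (z + t *\<^sub>R v) \<bullet> v\<bar> * indicator {-M..M} t \<partial>lborel) \<le> 2"
proof (cases "- M \<le> M")
  case True
  obtain F G where F: "smooth F" "smooth G" and eq: "\<And>z. \<eta> z = F z * G z"
    and r: "\<And>z. 0 \<le> F z" "\<And>z. F z \<le> 1" "\<And>z. 0 \<le> G z" "\<And>z. G z \<le> 1"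
    and m: "\<And>z. 0 \<le> grad F z \<bullet> v" "\<And>z. grad G z \<bullet> v \<le> 0"
    using assms unfolding unimodal_along_def by (elim exE conjE) blast
  let ?f = "\<lambda>t. grad F (z + t *\<^sub>R v) \<bullet> v - grad G (z + t *\<^sub>R v) \<bullet> v"
  let ?g = "\<lambda>t. F (z + t *\<^sub>R v) - G (z + t *\<^sub>R v)"
  have "\<eta> = (\<lambda>z. F z * G z)" by (rule ext) (rule eq)
  then have "grad \<eta> w = F w *\<^sub>R grad G w + G w *\<^sub>R grad F w" for w
    using grad_mult[OF F] by simp
  then have "\<bar>grad \<eta> w \<bullet> v\<bar> = \<bar>F w * (grad G w \<bullet> v) + G w * (grad F w \<bullet> v)\<bar>" for w
    by (simp add: inner_add_left)
  moreover have "\<bar>F w * (grad G w \<bullet> v) + G w * (grad F w \<bullet> v)\<bar> \<le> grad F w \<bullet> v - grad G w \<bullet> v" for w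
  proof -
    have "\<bar>F w * (grad G w \<bullet> v)\<bar> \<le> 1 * (- (grad G w \<bullet> v))"
      unfolding abs_mult using r[of w] m[of w] by (intro mult_mono) auto
    moreover have "\<bar>G w * (grad F w \<bullet> v)\<bar> \<le> 1 * (grad F w \<bullet> v)"
      unfolding abs_mult using r[of w] m[of w] by (intro mult_mono) auto
    ultimately show ?thesis by linarith
  qed
  ultimately have le: "\<bar>grad \<eta> w \<bullet> v\<bar> \<le> grad F w \<bullet> v - grad G w \<bullet> v" for w by metis
  have cont: "continuous_on UNIV ?f"
    by (intro continuous_on_diff continuous_on_inner continuous_on_const
        continuous_on_compose2[OF smooth_continuous_grad[OF F(1)]]
        continuous_on_compose2[OF smooth_continuous_grad[OF F(2)]])
      (auto intro!: continuous_intros)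
  have "(\<integral>\<^sup>+t. ennreal \<bar>grad \<eta> (z + t *\<^sub>R v) \<bullet> v\<bar> * indicator {-M..M} t \<partial>lborel)
      \<le> (\<integral>\<^sup>+t. ennreal (?f t) * indicator {-M..M} t \<partial>lborel)"
    using le by (intro nn_integral_mono mult_right_mono ennreal_leI) auto
  also have "\<dots> = ennreal (?g M - ?g (-M))"
  proof (rule nn_integral_FTC_Icc[OF _ _ _ True])
    show "?f \<in> borel_measurable borel" using cont by (rule borel_measurable_continuous_onI)
    show "(?g has_real_derivative ?f t) (at t)" for t
      by (intro derivative_intros line_derivative smooth_differentiable F)
    show "0 \<le> ?f t" for t using m[of "z + t *\<^sub>R v"] by linarith
  qed
  also have "\<dots> \<le> ennreal 2"
    using r[of "z + M *\<^sub>R v"] r[of "z + (- M) *\<^sub>R v"] by (intro ennreal_leI) linarith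
  finally show ?thesis by simp
qed auto

section \<open>Smooth functions as Sobolev functions\<close>

lemma lebesgue_on_lborel:
  fixes F :: "real^2 \<Rightarrow> real"
  assumes S: "S \<in> sets borel" and F: "F \<in> borel_measurable borel"
  shows "(LINT x|lebesgue_on S. F x) = (LINT x|lborel. indicator S x * F x)"
    and "integrable (lebesgue_on S) F \<longleftrightarrow> integrable lborel (\<lambda>x. indicator S x * F x)"
proof -
  have [measurable]: "(\<lambda>x. indicator S x * F x) \<in> borel_measurable borel"
    using S F by measurable
  show "(LINT x|lebesgue_on S. F x) = (LINT x|lborel. indicator S x * F x)"
    using S by (simp add: integral_restrict_space integral_completion)
  show "integrable (lebesgue_on S) F \<longleftrightarrow> integrable lborel (\<lambda>x. indicator S x * F x)"
    using S by (simp add: integrable_restrict_space integrable_completion)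
qed

lemma borel_imp_measurable_lebesgue_on:
  "F \<in> borel_measurable borel \<Longrightarrow> F \<in> borel_measurable (lebesgue_on S)"
  by (intro measurable_restrict_space1 measurable_completion) simp

lemma continuous_bounded_on:
  fixes f :: "'a::heine_borel \<Rightarrow> 'b::real_normed_vector"
  assumes "continuous_on UNIV f" "bounded S"
  obtains B where "\<And>x. x \<in> S \<Longrightarrow> norm (f x) \<le> B" "0 \<le> B"
proof -
  have "compact (f ` closure S)"
    using assms by (intro compact_continuous_image) (auto intro: continuous_on_subset compact_closure[THEN iffD2])
  then obtain B where "\<And>x. x \<in> closure S \<Longrightarrow> norm (f x) \<le> B"
    using compact_imp_bounded bounded_iff by (metis imageI)
  then show ?thesis using that[of "max B 0"] closure_subset[of S] by (meson le_max_iff_disj subsetD max.cobounded2)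
qed

lemma integrable_lebesgue_on_bounded:
  fixes F :: "real^2 \<Rightarrow> real"
  assumes "bounded S" "open S" "F \<in> borel_measurable borel" "\<And>x. x \<in> S \<Longrightarrow> \<bar>F x\<bar> \<le> B"
  shows "integrable (lebesgue_on S) F"
proof -
  have "finite_measure (lebesgue_on S)"
    using assms by (intro finite_measure_lebesgue_on lmeasurable_open)
  then show ?thesis
    using assms borel_imp_measurable_lebesgue_on
    by (intro finite_measure.integrable_const_bound[where B=B]) (auto simp: space_restrict_space)
qed

lemma integrable_lebesgue_on_continuous:
  fixes F :: "real^2 \<Rightarrow> real"
  assumes "bounded S" "open S" "continuous_on UNIV F"
  shows "integrable (lebesgue_on S) F"
proof -
  obtain B where "\<And>x. x \<in> S \<Longrightarrow> norm (F x) \<le> B"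
    using continuous_bounded_on[OF assms(3,1)] by blast
  then show ?thesis
    using assms by (intro integrable_lebesgue_on_bounded[where B=B] borel_measurable_continuous_onI) auto
qed

lemma integrable_mult_bounded:
  fixes f h :: "'a \<Rightarrow> real"
  assumes "integrable M f" "h \<in> borel_measurable M" "\<And>x. x \<in> space M \<Longrightarrow> \<bar>h x\<bar> \<le> B"
  shows "integrable M (\<lambda>x. f x * h x)"
proof (rule Bochner_Integration.integrable_bound)
  show "integrable M (\<lambda>x. B * f x)" using assms(1) by simp
  show "(\<lambda>x. f x * h x) \<in> borel_measurable M" using assms(1,2) by simp
  show "AE x in M. norm (f x * h x) \<le> norm (B * f x)"
  proof (rule AE_I2)
    fix x assume "x \<in> space M"
    then have "\<bar>h x\<bar> \<le> \<bar>B\<bar>" using assms(3)[of x] by linarith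
    then show "norm (f x * h x) \<le> norm (B * f x)"
      by (simp add: abs_mult mult.commute[of "\<bar>B\<bar>"] mult_left_mono)
  qed
qed

lemma square_integrable_imp_integrable:
  fixes f :: "'a \<Rightarrow> 'b :: {banach, second_countable_topology}"
  assumes "finite_measure M" "square_integrable M f"
  shows "integrable M f"
proof (rule Bochner_Integration.integrable_bound)
  interpret finite_measure M by fact
  show "integrable M (\<lambda>x. 1 + (norm (f x))\<^sup>2)"
    using assms(2) by (simp add: square_integrable_def)
  show "f \<in> borel_measurable M" using assms(2) by (simp add: square_integrable_def)
  have "t \<le> 1 + t\<^sup>2" for t :: real
    using sum_power2_ge_zero[of "t - 1/2" 0] by (simp add: power2_eq_square algebra_simps)
  then show "AE x in M. norm (f x) \<le> norm (1 + (norm (f x))\<^sup>2)"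
    by (intro AE_I2) (simp add: add_nonneg_nonneg)
qed

text \<open>
Integrate first along the lines parallel to the \<open>i\<close>-th axis; on each of them the fundamental theorem of calculus applies.
\<close>

lemma integral_grad_eq_0:
  fixes F :: "real^2 \<Rightarrow> real"
  assumes diff: "\<And>z. F differentiable (at z)" and cont: "continuous_on UNIV (grad F)"
    and comp: "compact (closure {z. F z \<noteq> 0})"
  shows "(LINT z|lborel. grad F z $ i) = 0"
proof -
  obtain j :: 2 where j: "j \<noteq> i" by (metis exhaust_2 one_neq_zero zero_neq_one num1_eq1 verit_eq_simplify(10) rel_simps(28))
  interpret frame 0 "axis i 1" "axis j 1"
    using j by unfold_locales (auto simp: inner_axis_axis)
  let ?K = "closure {z. F z \<noteq> 0}"
  have contc: "continuous_on UNIV (\<lambda>z. grad F z $ i)" using cont by (intro continuous_intros)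
  have "integrable lborel (\<lambda>z. indicator ?K z *\<^sub>R (grad F z $ i))"
    using comp contc by (intro borel_integrable_compact) (auto intro: continuous_on_subset)
  moreover have "(\<lambda>z. indicator ?K z *\<^sub>R (grad F z $ i)) = (\<lambda>z. grad F z $ i)"
  proof
    fix z show "indicator ?K z *\<^sub>R (grad F z $ i) = grad F z $ i"
      using grad_eq_0_outside[of z F] by (cases "z \<in> ?K") auto
  qed
  ultimately have int: "integrable lborel (\<lambda>z. grad F z $ i)" by simp
  obtain M where M: "\<And>z. z \<in> ?K \<Longrightarrow> norm z \<le> M" "0 < M"
    using comp compact_imp_bounded bounded_pos by metis
  have "(LINT x|lborel. grad F (P x y) $ i) = 0" for y
  proof -
    let ?f = "\<lambda>x. grad F (P x y) $ i"
    have out: "P x y \<notin> ?K" if "\<bar>x\<bar> > M" for x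
    proof
      assume "P x y \<in> ?K"
      then have "norm (P x y) \<le> M" by (rule M(1))
      moreover have "\<bar>x\<bar> \<le> norm (P x y)"
      proof -
        have "P x y $ i = x" using j unfolding P_def by (simp add: axis_def)
        then show ?thesis using component_le_norm_cart[of "P x y" i] by simp
      qed
      ultimately show False using that by simp
    qed
    have out0: "F (P x y) = 0" if "\<bar>x\<bar> > M" for x
      using out[OF that] closure_subset[of "{z. F z \<noteq> 0}"] by auto
    have "(\<lambda>x. ?f x * indicator {- (M + 1)..M + 1} x) = ?f"
    proof
      fix x show "?f x * indicator {- (M + 1)..M + 1} x = ?f x"
      proof (cases "\<bar>x\<bar> > M")
        case True
        then show ?thesis using grad_eq_0_outside[OF out, of x] by simp
      next
        case False
        then have "x \<in> {- (M + 1)..M + 1}" by auto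
        then show ?thesis by simp
      qed
    qed
    moreover have "(LINT x|lborel. ?f x * indicator {- (M + 1)..M + 1} x) = F (P (M + 1) y) - F (P (- (M + 1)) y)"
    proof (rule integral_FTC_Icc_real)
      show "- (M + 1) \<le> M + 1" using M(2) by simp
      fix x
      have P: "P x y = y *\<^sub>R axis j 1 + x *\<^sub>R axis i 1" for x by (simp add: P_def)
      show "((\<lambda>x. F (P x y)) has_real_derivative ?f x) (at x)"
        unfolding P using line_derivative[OF diff, of "y *\<^sub>R axis j 1" "axis i 1" x]
        by (simp add: inner_axis)
      have "continuous_on UNIV ?f"
        by (rule continuous_on_compose2[OF contc]) (auto intro!: continuous_intros)
      then show "isCont ?f x" by (simp add: continuous_on_eq_continuous_at)
    qed
    ultimately show ?thesis using out0[of "M + 1"] out0[of "- (M + 1)"] M(2) by simp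
  qed
  then show ?thesis using lborel_integral_frame(2)[OF int] by simp
qed

lemma smooth_H1:
  assumes S: "bounded S" "open S" and \<phi>: "smooth \<phi>"
  shows "H1_with_grad S \<phi> (grad \<phi>)"
  unfolding H1_with_grad_def
proof (intro conjI allI impI)
  have c: "continuous_on UNIV \<phi>" "continuous_on UNIV (grad \<phi>)"
    using \<phi> by (auto intro: smooth_continuous smooth_continuous_grad)
  obtain B where B: "\<And>x. x \<in> S \<Longrightarrow> norm (\<phi> x) \<le> B" "0 \<le> B" using continuous_bounded_on[OF c(1) S(1)] by blast
  obtain B' where B': "\<And>x. x \<in> S \<Longrightarrow> norm (grad \<phi> x) \<le> B'" "0 \<le> B'" using continuous_bounded_on[OF c(2) S(1)] by blast
  have m [measurable]: "\<phi> \<in> borel_measurable borel" "grad \<phi> \<in> borel_measurable borel"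
    using c by (auto intro: borel_measurable_continuous_onI)
  show "square_integrable (lebesgue_on S) \<phi>" unfolding square_integrable_def
    using B by (intro conjI borel_imp_measurable_lebesgue_on integrable_lebesgue_on_bounded[OF S, where B="B\<^sup>2"])
      (auto intro!: power_mono simp: abs_le_square_iff[symmetric])
  show "square_integrable (lebesgue_on S) (grad \<phi>)" unfolding square_integrable_def
    using B' by (intro conjI borel_imp_measurable_lebesgue_on integrable_lebesgue_on_bounded[OF S, where B="B'\<^sup>2"])
      (auto intro!: power_mono)
  fix \<psi> i assume "test_function S \<psi>"
  then have \<psi>: "smooth \<psi>" "compact (closure {x. \<psi> x \<noteq> 0})" "closure {x. \<psi> x \<noteq> 0} \<subseteq> S"
    by (auto simp: test_function_def)
  have c': "continuous_on UNIV \<psi>" "continuous_on UNIV (grad \<psi>)"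
    using \<psi> by (auto intro: smooth_continuous smooth_continuous_grad)
  have m' [measurable]: "\<psi> \<in> borel_measurable borel" "grad \<psi> \<in> borel_measurable borel"
    using c' by (auto intro: borel_measurable_continuous_onI)
  let ?F = "\<lambda>z. \<phi> z * \<psi> z"
  have d: "?F differentiable (at z)" for z
    using smooth_differentiable[OF \<phi>] smooth_differentiable[OF \<psi>(1)] by (intro differentiable_mult)
  have g: "grad ?F z = \<phi> z *\<^sub>R grad \<psi> z + \<psi> z *\<^sub>R grad \<phi> z" for z by (rule grad_mult[OF \<phi> \<psi>(1)])
  have gi: "grad ?F z $ i = \<phi> z * grad \<psi> z $ i + grad \<phi> z $ i * \<psi> z" for z
    by (simp add: g)
  have sub: "closure {z. ?F z \<noteq> 0} \<subseteq> closure {x. \<psi> x \<noteq> 0}" by (intro closure_mono) auto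
  have "compact (closure {z. ?F z \<noteq> 0})"
    using \<psi>(2) unfolding compact_closure by (rule bounded_subset) auto
  then have 0: "(LINT z|lborel. grad ?F z $ i) = 0"
    by (intro integral_grad_eq_0 d) (unfold g, intro continuous_intros c c')
  have i1: "integrable (lebesgue_on S) (\<lambda>z. \<phi> z * grad \<psi> z $ i)" 
   and i2: "integrable (lebesgue_on S) (\<lambda>z. grad \<phi> z $ i * \<psi> z)"
    by (rule integrable_lebesgue_on_continuous[OF S], intro continuous_on_mult continuous_on_component c c')+
  have "(LINT z|lebesgue_on S. \<phi> z * grad \<psi> z $ i) + (LINT z|lebesgue_on S. grad \<phi> z $ i * \<psi> z)
      = (LINT z|lebesgue_on S. grad ?F z $ i)"
    by (simp only: gi Bochner_Integration.integral_add[OF i1 i2])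
  also have "\<dots> = (LINT z|lborel. indicator S z * grad ?F z $ i)"
    unfolding gi using S(2)
    by (intro lebesgue_on_lborel borel_measurable_continuous_onI continuous_intros c c') simp
  also have "(\<lambda>z. indicator S z * grad ?F z $ i) = (\<lambda>z. grad ?F z $ i)"
  proof
    fix z show "indicator S z * grad ?F z $ i = grad ?F z $ i"
    proof (cases "z \<in> S")
      case False
      then have "z \<notin> closure {z. ?F z \<noteq> 0}" using sub \<psi>(3) by blast
      from grad_eq_0_outside[OF this] show ?thesis by (simp only: zero_index mult_zero_right)
    qed simp
  qed
  finally show "(LINT x|lebesgue_on S. \<phi> x * grad \<psi> x $ i) = - (LINT x|lebesgue_on S. grad \<phi> x $ i * \<psi> x)"
    using 0 by simp
qed

context frame begin

lemma smooth_potential: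
  "elementary (\<lambda>z. (X z)\<^sup>2 - (Y z)\<^sup>2 - k)"
  and grad_potential: "grad (\<lambda>z. (X z)\<^sup>2 - (Y z)\<^sup>2 - k) z = (2 * X z) *\<^sub>R e - (2 * Y z) *\<^sub>R e'"
proof -
  have XY: "X z = e \<bullet> z - e \<bullet> c" "Y z = e' \<bullet> z - e' \<bullet> c" for z
    unfolding X_def Y_def inner_diff_left by (simp_all add: inner_commute)
  show "elementary (\<lambda>z. (X z)\<^sup>2 - (Y z)\<^sup>2 - k)"
    unfolding XY power2_eq_square
    by (intro elementary_diff elementary.mult elementary.inner elementary.const)
  show "grad (\<lambda>z. (X z)\<^sup>2 - (Y z)\<^sup>2 - k) z = (2 * X z) *\<^sub>R e - (2 * Y z) *\<^sub>R e'"
    by (rule grad_eqI, unfold X_def Y_def)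
      (auto intro!: derivative_eq_intros simp: inner_diff_left inner_commute algebra_simps)
qed

text \<open>
Both axes of the frame are needed; \<open>A\<close> is the coordinate along \<open>e1\<close> and \<open>B\<close> the other one.
\<close>

lemma variation_bound:
  fixes e1 :: "real^2"
  assumes m: "0 \<le> m"
    and ax: "(e1 = e \<and> (\<forall>z. A z = X z \<and> B z = Y z)) \<or> (e1 = e' \<and> (\<forall>z. A z = Y z \<and> B z = X z))"
    and \<eta>: "smooth \<eta>" "unimodal_along e1 \<eta>"
  shows "(\<integral>\<^sup>+z. ennreal \<bar>grad \<eta> z \<bullet> e1\<bar> * indicator {z. \<bar>A z\<bar> \<le> M \<and> \<bar>B z\<bar> \<le> m} z \<partial>lborel) \<le> ennreal (4 * m)"
proof -
  have line: "(\<integral>\<^sup>+t. ennreal \<bar>grad \<eta> (z + t *\<^sub>R e1) \<bullet> e1\<bar> * indicator {-M..M} t \<partial>lborel) \<le> 2" for z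
    by (rule variation_on_line[OF \<eta>(2)])
  have g [measurable]: "grad \<eta> \<in> borel_measurable borel"
    using \<eta>(1) by (intro borel_measurable_continuous_onI smooth_continuous_grad)
  have AB: "(A = X \<and> B = Y) \<or> (A = Y \<and> B = X)" using ax by auto
  have [measurable]: "A \<in> borel_measurable borel" "B \<in> borel_measurable borel" using AB by auto
  let ?H = "\<lambda>z. ennreal \<bar>grad \<eta> z \<bullet> e1\<bar> * indicator {z. \<bar>A z\<bar> \<le> M \<and> \<bar>B z\<bar> \<le> m} z"
  have H: "?H \<in> borel_measurable borel" by measurable
  have "\<exists>Q. (\<forall>s. \<exists>z. \<forall>t. Q t s = z + t *\<^sub>R e1) \<and> (\<forall>t s. A (Q t s) = t \<and> B (Q t s) = s) \<and>
      (\<integral>\<^sup>+z. ?H z \<partial>lborel) = (\<integral>\<^sup>+s. \<integral>\<^sup>+t. ?H (Q t s) \<partial>lborel \<partial>lborel)"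
    using ax
  proof
    assume a: "e1 = e \<and> (\<forall>z. A z = X z \<and> B z = Y z)"
    show ?thesis
    proof (intro exI[of _ P] conjI allI)
      show "\<exists>z. \<forall>t. P t s = z + t *\<^sub>R e1" for s
        using a by (intro exI[of _ "c + s *\<^sub>R e'"]) (simp add: P_def)
      show "(\<integral>\<^sup>+z. ?H z \<partial>lborel) = (\<integral>\<^sup>+s. \<integral>\<^sup>+t. ?H (P t s) \<partial>lborel \<partial>lborel)"
        by (rule nn_integral_frame(2)[OF H])
    qed (use a in auto)
  next
    assume a: "e1 = e' \<and> (\<forall>z. A z = Y z \<and> B z = X z)"
    show ?thesis
    proof (intro exI[of _ "\<lambda>t s. P s t"] conjI allI)
      show "\<exists>z. \<forall>t. P s t = z + t *\<^sub>R e1" for s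
        using a by (intro exI[of _ "c + s *\<^sub>R e"]) (simp add: P_def)
      show "(\<integral>\<^sup>+z. ?H z \<partial>lborel) = (\<integral>\<^sup>+s. \<integral>\<^sup>+t. ?H (P s t) \<partial>lborel \<partial>lborel)"
        by (rule nn_integral_frame(1)[OF H])
    qed (use a in auto)
  qed
  then obtain Q where Q: "\<And>s. \<exists>z. \<forall>t. Q t s = z + t *\<^sub>R e1" "\<And>t s. A (Q t s) = t" "\<And>t s. B (Q t s) = s"
      "(\<integral>\<^sup>+z. ?H z \<partial>lborel) = (\<integral>\<^sup>+s. \<integral>\<^sup>+t. ?H (Q t s) \<partial>lborel \<partial>lborel)"
    by (elim exE conjE) blast
  have inner: "(\<integral>\<^sup>+t. ?H (Q t s) \<partial>lborel) \<le> 2 * indicator {-m..m} s" for s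
  proof (cases "s \<in> {-m..m}")
    case True
    obtain z where z: "\<And>t. Q t s = z + t *\<^sub>R e1" using Q(1) by blast
    have "(\<integral>\<^sup>+t. ?H (Q t s) \<partial>lborel) = (\<integral>\<^sup>+t. ennreal \<bar>grad \<eta> (z + t *\<^sub>R e1) \<bullet> e1\<bar> * indicator {-M..M} t \<partial>lborel)"
    proof (rule nn_integral_cong)
      fix t
      have "(\<bar>A (Q t s)\<bar> \<le> M \<and> \<bar>B (Q t s)\<bar> \<le> m) \<longleftrightarrow> t \<in> {-M..M}"
        using True unfolding Q(2,3) by auto
      then show "?H (Q t s) = ennreal \<bar>grad \<eta> (z + t *\<^sub>R e1) \<bullet> e1\<bar> * indicator {-M..M} t"
        by (simp add: z indicator_def)
    qed
    then show ?thesis using line[of z] True by simp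
  next
    case False
    then have "Q t s \<notin> {z. \<bar>A z\<bar> \<le> M \<and> \<bar>B z\<bar> \<le> m}" for t using Q(3)[of t s] by auto
    then have "indicator {z. \<bar>A z\<bar> \<le> M \<and> \<bar>B z\<bar> \<le> m} (Q t s) = (0 :: ennreal)" for t
      by (rule indicator_simps(2))
    then have "(\<integral>\<^sup>+t. ?H (Q t s) \<partial>lborel) = (\<integral>\<^sup>+t. 0 \<partial>(lborel :: real measure))"
      by (intro nn_integral_cong) (simp only: mult_zero_right)
    then show ?thesis by (simp only: nn_integral_const mult_zero_left zero_le)
  qed
  have "(\<integral>\<^sup>+z. ?H z \<partial>lborel) \<le> (\<integral>\<^sup>+s. 2 * indicator {-m..m} s \<partial>lborel)"
    unfolding Q(4) by (intro nn_integral_mono inner)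
  also have "\<dots> = 2 * ennreal (2 * m)" using m by (simp add: nn_integral_cmult)
  also have "\<dots> = ennreal (4 * m)" using m ennreal_mult[of 2 "2 * m"] by simp
  finally show ?thesis .
qed

text \<open>
The vector field \<open>\<eta> \<nabla>\<phi>\<close>, with \<open>\<phi> = X\<^sup>2 - Y\<^sup>2\<close>, is an admissible test field. Its divergence is
\<open>\<nabla>\<eta> \<bullet> \<nabla>\<phi>\<close> because \<open>\<phi>\<close> is harmonic, so only values of \<open>u\<close> where \<open>\<nabla>\<eta>\<close> does not vanish contribute.
On \<open>S\<close> the components of \<open>\<nabla>\<phi>\<close> are at most \<open>2 M\<close> and \<open>2 m\<close>, and the corresponding variations of \<open>\<eta>\<close> are at most \<open>4 m\<close> and \<open>4 M\<close>.
\<close>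

lemma green_cutoff:
  assumes S: "open S" "bounded S" and box: "\<And>z. z \<in> S \<Longrightarrow> \<bar>X z\<bar> \<le> M \<and> \<bar>Y z\<bar> \<le> m"
    and Mm: "0 \<le> M" "0 \<le> m" and s: "0 \<le> s"
    and u: "H1_with_grad S u g"
    and \<eta>: "test_function S \<eta>" "elementary \<eta>"
    and us: "\<And>z. z \<in> S \<Longrightarrow> grad \<eta> z \<noteq> 0 \<Longrightarrow> \<bar>u z\<bar> \<le> s"
    and tv: "\<And>v. unimodal_along v \<eta>"
  shows "\<bar>LINT z|lebesgue_on S. \<eta> z * (g z \<bullet> ((2 * X z) *\<^sub>R e - (2 * Y z) *\<^sub>R e'))\<bar> \<le> 16 * m * M * s"
proof -
  have sm: "smooth \<eta>" using \<eta>(2) by (rule elementary_smooth)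
  have fin: "finite_measure (lebesgue_on S)" using S by (intro finite_measure_lebesgue_on lmeasurable_open)
  have iu: "integrable (lebesgue_on S) u" and ig: "integrable (lebesgue_on S) g"
    using u fin by (auto simp: H1_with_grad_def intro: square_integrable_imp_integrable)
  define G where "G z = (2 * X z) *\<^sub>R e - (2 * Y z) *\<^sub>R e'" for z
  have XY: "X z = e \<bullet> z - e \<bullet> c" "Y z = e' \<bullet> z - e' \<bullet> c" for z
    unfolding X_def Y_def inner_diff_left by (simp_all add: inner_commute)
  have elG: "elementary (\<lambda>z. G z $ i)" for i
  proof -
    have "elementary (\<lambda>z. (2 * e $ i) * (e \<bullet> z - e \<bullet> c) - (2 * e' $ i) * (e' \<bullet> z - e' \<bullet> c))"
      by (intro elementary_diff elementary.mult elementary.const elementary.inner)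
    then show ?thesis by (simp add: G_def XY mult.commute mult.left_commute)
  qed
  have gradG: "grad (\<lambda>z. G z $ i) z = (2 * e $ i) *\<^sub>R e - (2 * e' $ i) *\<^sub>R e'" for i z
    by (rule grad_eqI, unfold G_def XY)
      (auto intro!: derivative_eq_intros simp: inner_diff_left algebra_simps)
  have cG: "continuous_on UNIV (\<lambda>z. G z $ i)" for i using elG by (intro smooth_continuous elementary_smooth)
  have c\<eta>: "continuous_on UNIV \<eta>" "continuous_on UNIV (grad \<eta>)"
    using sm by (auto intro: smooth_continuous smooth_continuous_grad)
  define \<psi> where "\<psi> i z = \<eta> z * G z $ i" for i z
  have el\<psi>: "elementary (\<psi> i)" for i unfolding \<psi>_def by (intro elementary.mult \<eta> elG)
  have c\<psi>: "continuous_on UNIV (\<psi> i)" "continuous_on UNIV (grad (\<psi> i))" for i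
    using el\<psi> by (auto intro: smooth_continuous smooth_continuous_grad elementary_smooth)
  have test: "test_function S (\<psi> i)" for i
  proof -
    have sub: "closure {z. \<psi> i z \<noteq> 0} \<subseteq> closure {z. \<eta> z \<noteq> 0}"
      by (intro closure_mono) (auto simp: \<psi>_def)
    moreover have "compact (closure {z. \<psi> i z \<noteq> 0})"
      using \<eta>(1) unfolding test_function_def compact_closure
      by (auto intro: bounded_subset simp: \<psi>_def)
    ultimately show ?thesis
      using \<eta>(1) elementary_smooth[OF el\<psi>] unfolding test_function_def by blast
  qed
  have weak: "(LINT z|lebesgue_on S. u z * grad (\<psi> i) z $ i) = - (LINT z|lebesgue_on S. g z $ i * \<psi> i z)" for i
    using u test unfolding H1_with_grad_def by blast
  have bm: "integrable (lebesgue_on S) (\<lambda>z. f z * h z)"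
    if f: "integrable (lebesgue_on S) f" and h: "continuous_on UNIV h" for f h :: "real^2 \<Rightarrow> real"
  proof -
    obtain B where "\<And>x. x \<in> S \<Longrightarrow> norm (h x) \<le> B" using continuous_bounded_on[OF h S(2)] by blast
    then show ?thesis
      using f h by (intro integrable_mult_bounded[where B=B] borel_imp_measurable_lebesgue_on
          borel_measurable_continuous_onI) (auto simp: space_restrict_space)
  qed
  have igi: "integrable (lebesgue_on S) (\<lambda>z. g z $ i)" for i
    using integrable_bounded_linear[OF bounded_linear_vec_nth ig] .
  have i1: "integrable (lebesgue_on S) (\<lambda>z. u z * grad (\<psi> i) z $ i)" for i
    by (intro bm iu continuous_on_component c\<psi>)
  have i2: "integrable (lebesgue_on S) (\<lambda>z. g z $ i * \<psi> i z)" for i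
    by (intro bm igi c\<psi>)
  \<comment> \<open>Harmonicity: the divergence of \<open>G\<close> is \<open>2 (e \<bullet> e) - 2 (e' \<bullet> e') = 0\<close>.\<close>
  have div: "(\<Sum>i\<in>UNIV. grad (\<psi> i) z $ i) = grad \<eta> z \<bullet> G z" for z
  proof -
    have "grad (\<psi> i) z = \<eta> z *\<^sub>R grad (\<lambda>z. G z $ i) z + G z $ i *\<^sub>R grad \<eta> z" for i
      unfolding \<psi>_def by (rule grad_mult[OF sm elementary_smooth[OF elG]])
    then have "grad (\<psi> i) z $ i = \<eta> z * (2 * (e $ i * e $ i) - 2 * (e' $ i * e' $ i)) + G z $ i * grad \<eta> z $ i" for i
      unfolding gradG by simp
    then have "(\<Sum>i\<in>UNIV. grad (\<psi> i) z $ i) =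
        \<eta> z * (2 * (e \<bullet> e) - 2 * (e' \<bullet> e')) + grad \<eta> z \<bullet> G z"
      by (simp only: sum_2 inner_vec_def inner_real_def) (simp add: algebra_simps)
    then show ?thesis by (simp add: inner_frame)
  qed
  have inner_sum: "\<eta> z * (g z \<bullet> G z) = (\<Sum>i\<in>UNIV. g z $ i * \<psi> i z)" for z
    by (simp add: \<psi>_def inner_vec_def sum_distrib_left mult.left_commute)
  have usum: "u z * (grad \<eta> z \<bullet> G z) = (\<Sum>i\<in>UNIV. u z * grad (\<psi> i) z $ i)" for z
    unfolding div[symmetric] by (simp add: sum_distrib_left)
  have "(LINT z|lebesgue_on S. \<eta> z * (g z \<bullet> G z)) = (\<Sum>i\<in>UNIV. LINT z|lebesgue_on S. g z $ i * \<psi> i z)"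
    unfolding inner_sum using i2 by (intro Bochner_Integration.integral_sum)
  also have "\<dots> = - (\<Sum>i\<in>UNIV. LINT z|lebesgue_on S. u z * grad (\<psi> i) z $ i)"
    unfolding weak by (simp add: sum_negf)
  also have "\<dots> = - (LINT z|lebesgue_on S. u z * (grad \<eta> z \<bullet> G z))"
    unfolding usum using i1 by (subst Bochner_Integration.integral_sum) auto
  finally have main: "\<bar>LINT z|lebesgue_on S. \<eta> z * (g z \<bullet> G z)\<bar> = \<bar>LINT z|lebesgue_on S. u z * (grad \<eta> z \<bullet> G z)\<bar>"
    by simp
  let ?a = "\<lambda>z. \<bar>grad \<eta> z \<bullet> e\<bar>" and ?b = "\<lambda>z. \<bar>grad \<eta> z \<bullet> e'\<bar>"
  have ca: "continuous_on UNIV ?a" "continuous_on UNIV ?b"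
    by (intro continuous_on_rabs continuous_on_inner continuous_on_const c\<eta>)+
  have ia: "integrable (lebesgue_on S) ?a" "integrable (lebesgue_on S) ?b"
    by (intro integrable_lebesgue_on_continuous S ca)+
  have pw: "\<bar>u z * (grad \<eta> z \<bullet> G z)\<bar> \<le> s * (2 * M * ?a z + 2 * m * ?b z)" if z: "z \<in> S" for z
  proof (cases "grad \<eta> z = 0")
    case False
    have "\<bar>grad \<eta> z \<bullet> G z\<bar> \<le> 2 * \<bar>X z\<bar> * ?a z + 2 * \<bar>Y z\<bar> * ?b z"
      unfolding G_def inner_diff_right inner_scaleR_right
      by (rule order_trans[OF abs_triangle_ineq4]) (simp add: abs_mult)
    also have "\<dots> \<le> 2 * M * ?a z + 2 * m * ?b z"
      using box[OF z] by (intro add_mono mult_right_mono) auto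
    finally show ?thesis
      unfolding abs_mult using us[OF z False] s by (intro mult_mono) auto
  qed simp
  have "\<bar>LINT z|lebesgue_on S. u z * (grad \<eta> z \<bullet> G z)\<bar> \<le> (LINT z|lebesgue_on S. \<bar>u z * (grad \<eta> z \<bullet> G z)\<bar>)"
    by (rule integral_abs_bound)
  also have "\<dots> \<le> (LINT z|lebesgue_on S. s * (2 * M * ?a z + 2 * m * ?b z))"
  proof (rule integral_mono)
    have "integrable (lebesgue_on S) (\<lambda>z. \<Sum>i\<in>UNIV. u z * grad (\<psi> i) z $ i)"
      using i1 by (intro Bochner_Integration.integrable_sum) auto
    then show "integrable (lebesgue_on S) (\<lambda>z. \<bar>u z * (grad \<eta> z \<bullet> G z)\<bar>)"
      unfolding usum by (rule integrable_abs)
    show "integrable (lebesgue_on S) (\<lambda>z. s * (2 * M * ?a z + 2 * m * ?b z))"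
      using ia by simp
  qed (use pw in \<open>simp add: space_restrict_space\<close>)
  also have "\<dots> = s * (2 * M * (LINT z|lebesgue_on S. ?a z) + 2 * m * (LINT z|lebesgue_on S. ?b z))"
    using ia by simp
  also have "\<dots> \<le> s * (2 * M * (4 * m) + 2 * m * (4 * M))"
  proof -
    have le: "(LINT z|lebesgue_on S. \<bar>grad \<eta> z \<bullet> v\<bar>) \<le> r"
      if c: "continuous_on UNIV (\<lambda>z. \<bar>grad \<eta> z \<bullet> v\<bar>)" and r: "0 \<le> r" and T: "S \<subseteq> T"
        and n: "(\<integral>\<^sup>+z. ennreal \<bar>grad \<eta> z \<bullet> v\<bar> * indicator T z \<partial>lborel) \<le> ennreal r"
      for v r T
    proof -
      have b: "(\<lambda>z. \<bar>grad \<eta> z \<bullet> v\<bar>) \<in> borel_measurable borel" using c by (rule borel_measurable_continuous_onI)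
      have Sb: "S \<in> sets borel" using S(1) by simp
      have i: "integrable lborel (\<lambda>z. indicator S z * \<bar>grad \<eta> z \<bullet> v\<bar>)"
        using integrable_lebesgue_on_continuous[OF S(2,1) c] lebesgue_on_lborel(2)[OF Sb b] by blast
      have "ennreal (LINT z|lborel. indicator S z * \<bar>grad \<eta> z \<bullet> v\<bar>) = (\<integral>\<^sup>+z. ennreal (indicator S z * \<bar>grad \<eta> z \<bullet> v\<bar>) \<partial>lborel)"
        using i by (intro nn_integral_eq_integral[symmetric]) auto
      also have "\<dots> \<le> (\<integral>\<^sup>+z. ennreal \<bar>grad \<eta> z \<bullet> v\<bar> * indicator T z \<partial>lborel)"
        using T by (intro nn_integral_mono) (auto simp: indicator_def)
      also have "\<dots> \<le> ennreal r" by (rule n)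
      finally show ?thesis unfolding lebesgue_on_lborel(1)[OF Sb b] using r by simp
    qed
    have "(LINT z|lebesgue_on S. ?a z) \<le> 4 * m"
    proof (rule le[OF ca(1)])
      show "(\<integral>\<^sup>+z. ennreal (?a z) * indicator {z. \<bar>X z\<bar> \<le> M \<and> \<bar>Y z\<bar> \<le> m} z \<partial>lborel) \<le> ennreal (4 * m)"
        by (rule variation_bound[OF Mm(2) _ sm tv]) simp
    qed (use box Mm in auto)
    moreover have "(LINT z|lebesgue_on S. ?b z) \<le> 4 * M"
    proof (rule le[OF ca(2)])
      show "(\<integral>\<^sup>+z. ennreal (?b z) * indicator {z. \<bar>Y z\<bar> \<le> m \<and> \<bar>X z\<bar> \<le> M} z \<partial>lborel) \<le> ennreal (4 * M)"
        by (rule variation_bound[OF Mm(1) _ sm tv]) simp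
    qed (use box Mm in auto)
    ultimately show ?thesis using Mm s by (intro mult_left_mono add_mono) auto
  qed
  also have "\<dots> = 16 * m * M * s" by (simp add: algebra_simps)
  finally show ?thesis using main unfolding G_def by simp
qed

text \<open>
Let the cut-offs of the preceding estimate exhaust the domain. They are chosen equal to 1 on the compact set where
\<open>\<bar>u\<bar> \<ge> s + \<epsilon>\<close>, which keeps away from the boundary; so they feel \<open>u\<close> only where \<open>\<bar>u\<bar> < s + \<epsilon>\<close>.
\<close>

lemma green_bound:
  assumes S: "open S" "convex S" "bounded S" "S \<noteq> {}"
    and box: "\<And>z. z \<in> S \<Longrightarrow> \<bar>X z\<bar> \<le> M \<and> \<bar>Y z\<bar> \<le> m"
    and Mm: "0 \<le> M" "0 \<le> m" and s: "0 \<le> s"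
    and u: "H1_with_grad S u g" and cu: "continuous_on (closure S) u"
    and us: "\<And>z. z \<in> frontier S \<Longrightarrow> \<bar>u z\<bar> \<le> s"
  shows "\<bar>LINT z|lebesgue_on S. g z \<bullet> ((2 * X z) *\<^sub>R e - (2 * Y z) *\<^sub>R e')\<bar> \<le> 16 * m * M * s"
proof -
  define G where "G z = (2 * X z) *\<^sub>R e - (2 * Y z) *\<^sub>R e'" for z
  have fr: "frontier S = closure S - S" using S(1) by (simp add: frontier_def interior_open)
  have fr_ne: "frontier S \<noteq> {}"
    using S(3,4) frontier_eq_empty not_bounded_UNIV by blast
  have fin: "finite_measure (lebesgue_on S)" using S by (intro finite_measure_lebesgue_on lmeasurable_open)
  have ig: "integrable (lebesgue_on S) g"
    using u fin by (auto simp: H1_with_grad_def intro: square_integrable_imp_integrable)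
  have cG: "continuous_on UNIV G" unfolding G_def by (intro continuous_intros)
  have igG: "integrable (lebesgue_on S) (\<lambda>z. g z \<bullet> G z)"
  proof -
    obtain B where B: "\<And>x. x \<in> S \<Longrightarrow> norm (G x) \<le> B" using continuous_bounded_on[OF cG S(3)] by blast
    have [measurable]: "g \<in> borel_measurable (lebesgue_on S)" using ig by simp
    have [measurable]: "G \<in> borel_measurable (lebesgue_on S)"
      by (intro borel_imp_measurable_lebesgue_on borel_measurable_continuous_onI cG)
    show ?thesis
    proof (rule Bochner_Integration.integrable_bound)
      show "integrable (lebesgue_on S) (\<lambda>z. B * norm (g z))" using ig by simp
      show "AE z in lebesgue_on S. norm (g z \<bullet> G z) \<le> norm (B * norm (g z))"
      proof (rule AE_I2)
        fix z assume "z \<in> space (lebesgue_on S)"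
        then have z: "norm (G z) \<le> B" using B by (simp add: space_restrict_space)
        have "\<bar>g z \<bullet> G z\<bar> \<le> norm (g z) * norm (G z)" by (rule Cauchy_Schwarz_ineq2)
        also have "\<dots> \<le> norm (g z) * \<bar>B\<bar>" using z by (intro mult_left_mono) auto
        finally show "norm (g z \<bullet> G z) \<le> norm (B * norm (g z))" by (simp add: abs_mult mult.commute)
      qed
    qed measurable
  qed
  have eps: "\<bar>LINT z|lebesgue_on S. g z \<bullet> G z\<bar> \<le> 16 * m * M * (s + \<epsilon>)" if \<epsilon>: "0 < \<epsilon>" for \<epsilon>
  proof -
    define K where "K n = {z \<in> closure S. s + \<epsilon> \<le> \<bar>u z\<bar>} \<union>
        {z \<in> closure S. 1 / real (Suc n) \<le> infdist z (frontier S)}" for n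
    have cc: "compact {z \<in> closure S. a \<le> f z}" if "continuous_on (closure S) f" for f :: "real^2 \<Rightarrow> real" and a
    proof -
      have "closed (closure S \<inter> f -` {a..})"
        using that by (intro continuous_closed_preimage) auto
      moreover have "closure S \<inter> f -` {a..} = {z \<in> closure S. a \<le> f z}" by auto
      moreover have "bounded {z \<in> closure S. a \<le> f z}"
        by (rule bounded_subset[OF bounded_closure[OF S(3)]]) simp
      ultimately show ?thesis by (simp add: compact_eq_bounded_closed)
    qed
    have K: "compact (K n)" "K n \<subseteq> S" for n
    proof -
      show "compact (K n)" unfolding K_def
        by (intro compact_Un cc continuous_on_rabs cu continuous_on_infdist continuous_on_id)
      show "K n \<subseteq> S"
      proof
        fix z assume z: "z \<in> K n"
        show "z \<in> S"
        proof (rule ccontr)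
          assume "z \<notin> S"
          then have zf: "z \<in> frontier S" using z by (auto simp: K_def fr)
          then have "infdist z (frontier S) = 0" by simp
          moreover have "\<bar>u z\<bar> < s + \<epsilon>" using us[OF zf] \<epsilon> by simp
          moreover have "0 < 1 / real (Suc n)" by simp
          ultimately show False using z by (auto simp: K_def simp del: of_nat_Suc)
        qed
      qed
    qed
    have "\<exists>\<eta>. test_function S \<eta> \<and> elementary \<eta> \<and> (\<forall>z. 0 \<le> \<eta> z \<and> \<eta> z \<le> 1) \<and> (\<forall>z\<in>K n. \<eta> z = 1) \<and>
        (\<forall>v. unimodal_along v \<eta>)" for n
    proof -
      show ?thesis
      proof (rule cutoff[OF S(1,2) K(1)[of n] K(2)[of n]])
        fix \<eta> assume "test_function S \<eta>" "elementary \<eta>" "\<And>z. 0 \<le> \<eta> z" "\<And>z. \<eta> z \<le> 1"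
          "\<And>z. z \<in> K n \<Longrightarrow> \<eta> z = 1" "\<And>v. unimodal_along v \<eta>"
        then show ?thesis by (intro exI[of _ \<eta>]) simp
      qed
    qed
    then obtain \<eta> where \<eta>: "\<And>n. test_function S (\<eta> n)" "\<And>n. elementary (\<eta> n)"
      "\<And>n z. 0 \<le> \<eta> n z \<and> \<eta> n z \<le> 1" "\<And>n z. z \<in> K n \<Longrightarrow> \<eta> n z = 1"
      "\<And>n v. unimodal_along v (\<eta> n)"
      by metis
    have grad0: "grad (\<eta> n) z = 0" if z: "z \<in> K n" for n z
    proof -
      have d: "(\<eta> n has_derivative (\<lambda>v. grad (\<eta> n) z \<bullet> v)) (at z)"
        using elementary_smooth[OF \<eta>(2)] by (intro has_derivative_grad smooth_differentiable)
      have "(\<lambda>v. grad (\<eta> n) z \<bullet> v) = (\<lambda>v. 0)"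
        by (rule differential_zero_maxmin[OF _ open_UNIV d])
          (use \<eta>(3)[of n] \<eta>(4)[OF z] in auto)
      then have "grad (\<eta> n) z \<bullet> grad (\<eta> n) z = 0" by (rule fun_cong)
      then show ?thesis by simp
    qed
    have b: "\<bar>LINT z|lebesgue_on S. \<eta> n z * (g z \<bullet> G z)\<bar> \<le> 16 * m * M * (s + \<epsilon>)" for n
      unfolding G_def
    proof (rule green_cutoff[OF S(1,3) box Mm _ u \<eta>(1,2) _ \<eta>(5)])
      show "0 \<le> s + \<epsilon>" using s \<epsilon> by simp
      fix z assume z: "z \<in> S" "grad (\<eta> n) z \<noteq> 0"
      then have "z \<notin> K n" using grad0 by blast
      then show "\<bar>u z\<bar> \<le> s + \<epsilon>" using z(1) closure_subset[of S] by (auto simp: K_def)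
    qed
    have "(\<lambda>n. LINT z|lebesgue_on S. \<eta> n z * (g z \<bullet> G z)) \<longlonglongrightarrow> (LINT z|lebesgue_on S. g z \<bullet> G z)"
    proof (rule integral_dominated_convergence)
      show "integrable (lebesgue_on S) (\<lambda>z. norm (g z \<bullet> G z))" using igG by (rule integrable_norm)
      show "(\<lambda>z. g z \<bullet> G z) \<in> borel_measurable (lebesgue_on S)" using igG by simp
      have "\<eta> n \<in> borel_measurable (lebesgue_on S)" for n
        by (intro borel_imp_measurable_lebesgue_on borel_measurable_continuous_onI smooth_continuous
            elementary_smooth \<eta>)
      then show "(\<lambda>z. \<eta> n z * (g z \<bullet> G z)) \<in> borel_measurable (lebesgue_on S)" for n
        using igG by simp
      show "AE z in lebesgue_on S. norm (\<eta> n z * (g z \<bullet> G z)) \<le> norm (g z \<bullet> G z)" for n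
        using \<eta>(3) by (intro AE_I2) (auto simp: abs_mult intro: mult_left_le_one_le)
      show "AE z in lebesgue_on S. (\<lambda>n. \<eta> n z * (g z \<bullet> G z)) \<longlonglongrightarrow> g z \<bullet> G z"
      proof (rule AE_I2)
        fix z assume "z \<in> space (lebesgue_on S)"
        then have z: "z \<in> S" by (simp add: space_restrict_space)
        have "0 < infdist z (frontier S)"
          using z fr by (intro infdist_pos_not_in_closed[OF frontier_closed fr_ne]) simp
        then obtain N where N: "1 / real (Suc N) < infdist z (frontier S)"
          by (rule nat_approx_posE)
        have "\<eta> n z = 1" if "N \<le> n" for n
        proof (rule \<eta>(4))
          have "1 / real (Suc n) \<le> 1 / real (Suc N)" using that by (intro divide_left_mono) auto
          then show "z \<in> K n" using N z closure_subset[of S] by (auto simp: K_def)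
        qed
        then have "\<forall>\<^sub>F n in sequentially. g z \<bullet> G z = \<eta> n z * (g z \<bullet> G z)"
          by (intro eventually_sequentiallyI[of N]) simp
        then show "(\<lambda>n. \<eta> n z * (g z \<bullet> G z)) \<longlonglongrightarrow> g z \<bullet> G z"
          by (rule Lim_transform_eventually[OF tendsto_const])
      qed
    qed
    then have "(\<lambda>n. \<bar>LINT z|lebesgue_on S. \<eta> n z * (g z \<bullet> G z)\<bar>) \<longlonglongrightarrow> \<bar>LINT z|lebesgue_on S. g z \<bullet> G z\<bar>"
      by (rule tendsto_rabs)
    then show ?thesis using b by (intro LIMSEQ_le_const2) auto
  qed
  have "((\<lambda>\<epsilon>. 16 * m * M * (s + \<epsilon>)) \<longlongrightarrow> 16 * m * M * (s + 0)) (at_right 0)"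
    by (intro tendsto_intros)
  then have "\<bar>LINT z|lebesgue_on S. g z \<bullet> G z\<bar> \<le> 16 * m * M * (s + 0)"
    by (rule tendsto_lowerbound) (use eps in \<open>auto simp: eventually_at_right_field intro: exI[of _ 1]\<close>)
  then show ?thesis by (simp add: G_def)
qed

end

section \<open>The weak equation tested with smooth functions\<close>

lemma finite_boundary_measure:
  assumes "emeasure hausdorff1 (frontier S) < \<infinity>"
  shows "finite_measure (boundary_measure S)"
  using assms unfolding boundary_measure_def
  by (intro finite_measureI) (simp add: space_restrict_space emeasure_restrict_space top.not_eq_extremum)

lemma borel_imp_measurable_boundary:
  "F \<in> borel_measurable borel \<Longrightarrow> F \<in> borel_measurable (boundary_measure S)"
  unfolding boundary_measure_def by (intro measurable_restrict_space1) (simp cong: measurable_cong_sets)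

lemma space_boundary_measure [simp]: "space (boundary_measure S) = frontier S"
  by (simp add: boundary_measure_def space_restrict_space)

lemma integrable_boundary_bounded:
  fixes F :: "real^2 \<Rightarrow> real"
  assumes "emeasure hausdorff1 (frontier S) < \<infinity>" "F \<in> borel_measurable borel"
    and "\<And>z. z \<in> frontier S \<Longrightarrow> \<bar>F z\<bar> \<le> B"
  shows "integrable (boundary_measure S) F"
  using assms finite_boundary_measure borel_imp_measurable_boundary
  by (intro finite_measure.integrable_const_bound[where B=B]) auto

text \<open>
A smooth function is its own trace, approximated by the constant sequence.
\<close>

lemma neumann_test:
  assumes u: "neumann_weak_solution S u" and S: "open S" "bounded S"
    and fin: "emeasure hausdorff1 (frontier S) < \<infinity>"
  obtains g where "H1_with_grad S u g"
    "\<And>\<phi>. smooth \<phi> \<Longrightarrow> (LINT z|lebesgue_on S. g z \<bullet> grad \<phi> z) = (LINT z|lebesgue_on S. \<phi> z)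
        - measure lebesgue S / perimeter S * (LINT z|boundary_measure S. \<phi> z)"
proof -
  obtain g where g: "H1_with_grad S u g"
    "\<And>\<phi> h w. H1_with_grad S \<phi> h \<Longrightarrow> is_trace S \<phi> h w \<Longrightarrow>
           (LINT x|lebesgue_on S. g x \<bullet> h x) =
             (LINT x|lebesgue_on S. \<phi> x)
             - measure lebesgue S / perimeter S * (LINT x|boundary_measure S. w x)"
    using u unfolding neumann_weak_solution_def by blast
  have "is_trace S \<phi> (grad \<phi>) \<phi>" if \<phi>: "smooth \<phi>" for \<phi>
    unfolding is_trace_def
  proof (intro conjI exI[of _ "\<lambda>_. \<phi>"] allI)
    have c: "continuous_on UNIV \<phi>" using \<phi> by (rule smooth_continuous)
    then have m: "\<phi> \<in> borel_measurable borel" by (rule borel_measurable_continuous_onI)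
    have "bounded (frontier S)" 
      by (rule bounded_subset[OF bounded_closure[OF S(2)]]) (simp add: frontier_def)
    then obtain B where B: "\<And>x. x \<in> frontier S \<Longrightarrow> norm (\<phi> x) \<le> B"
      using continuous_bounded_on[OF c] by metis
    have "integrable (boundary_measure S) (\<lambda>z. (norm (\<phi> z))\<^sup>2)"
    proof (rule integrable_boundary_bounded[OF fin, where B="B\<^sup>2"])
      show "(\<lambda>z. (norm (\<phi> z))\<^sup>2) \<in> borel_measurable borel" using m by measurable
      show "\<bar>(norm (\<phi> z))\<^sup>2\<bar> \<le> B\<^sup>2" if "z \<in> frontier S" for z
        unfolding abs_power2 using B[OF that] by (intro power_mono) auto
    qed
    then show "square_integrable (boundary_measure S) \<phi>"
      unfolding square_integrable_def using m by (intro conjI borel_imp_measurable_boundary)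
  qed (simp_all add: \<phi>)
  then have "(LINT z|lebesgue_on S. g z \<bullet> grad \<phi> z) = (LINT z|lebesgue_on S. \<phi> z)
        - measure lebesgue S / perimeter S * (LINT z|boundary_measure S. \<phi> z)" if "smooth \<phi>" for \<phi>
    using that by (intro g(2) smooth_H1 S)
  with g(1) show ?thesis by (rule that)
qed

text \<open>
Tested with the constant 1, the weak equation reads \<open>0 = A - (A / P) P\<close>, with area \<open>A\<close> and perimeter \<open>P\<close>. For a null
boundary measure the last term vanishes, which leaves \<open>A = 0\<close>.
\<close>

lemma hausdorff1_nonnull:
  assumes u: "neumann_weak_solution S u" and S: "open S" "bounded S"
    and area: "measure lebesgue S \<noteq> 0"
  shows "emeasure hausdorff1 UNIV \<noteq> 0"
proof
  assume 0: "emeasure hausdorff1 UNIV = 0"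
  have null: "emeasure hausdorff1 (frontier S) = 0"
    using emeasure_mono[of "frontier S" UNIV hausdorff1] 0 by simp
  then have fin: "emeasure hausdorff1 (frontier S) < \<infinity>" by simp
  obtain g where "H1_with_grad S u g" and g: "\<And>\<phi>. smooth \<phi> \<Longrightarrow> (LINT z|lebesgue_on S. g z \<bullet> grad \<phi> z) = (LINT z|lebesgue_on S. \<phi> z)
        - measure lebesgue S / perimeter S * (LINT z|boundary_measure S. \<phi> z)"
    using neumann_test[OF u S fin] by blast
  have "grad (\<lambda>z. 1) z = 0" for z by (rule grad_eqI) simp
  then have "0 = (LINT z|lebesgue_on S. (1::real))
        - measure lebesgue S / perimeter S * (LINT z|boundary_measure S. 1)"
    using g[OF elementary_smooth[OF elementary.const[of 1]]] by simp
  moreover have "perimeter S = 0" using null by (simp add: perimeter_def measure_def)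
  moreover have "(LINT z|lebesgue_on S. (1::real)) = measure lebesgue S"
    using S(1) by (simp add: measure_restrict_space space_restrict_space)
  ultimately show False using area by simp
qed

section \<open>Arc length of the boundary of a thin domain\<close>

text \<open>
The shape of a convex domain of area \<open>\<pi>\<close> and large diameter. The chord from \<open>X = -R\<close> to \<open>X = R\<close> on the axis lies in the open
domain, which is possible as it is only almost longest; in return the domain may stick out beyond the chord by \<open>d\<close>.
The last assumption makes the boundary measure a genuine arc length.
\<close>

locale thin_domain = frame +
  fixes S :: "(real^2) set" and R d :: real
  assumes S: "open S" "convex S" "bounded S"
    and area: "measure lebesgue S = pi"
    and R: "1000 \<le> R" and d: "0 \<le> d" "d \<le> 1 / R ^ 3"
    and axis: "\<And>x. \<bar>x\<bar> \<le> R \<Longrightarrow> P x 0 \<in> S"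
    and wide: "\<And>z. z \<in> closure S \<Longrightarrow> \<bar>X z\<bar> \<le> R + d"
    and thin: "\<And>z. z \<in> closure S \<Longrightarrow> \<bar>Y z\<bar> \<le> pi / R"
    and proper: "emeasure hausdorff1 UNIV \<noteq> 0"
begin

lemma d_le: "d \<le> 1 / 1000"
proof -
  have "1000 ^ 3 \<le> R ^ 3" using R by (intro power_mono) auto
  then have "1 / R ^ 3 \<le> 1 / 1000 ^ 3" using R by (intro divide_left_mono) auto
  then show ?thesis using d(2) by simp
qed

lemma frontier_eq: "frontier S = closure S - S"
  using S(1) by (simp add: frontier_def interior_open)

lemma emeasure_H: "A \<in> sets borel \<Longrightarrow> emeasure hausdorff1 A = hausdorff1_outer A"
  using emeasure_hausdorff1[OF proper] .

lemma exit_point: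
  assumes z: "z \<in> closure S" and v: "v \<noteq> 0"
  obtains t where "0 \<le> t" "z + t *\<^sub>R v \<in> frontier S" "z \<in> S \<Longrightarrow> 0 < t"
proof (cases "z \<in> S")
  case True
  then obtain t where "0 < t" "z + t *\<^sub>R v \<in> frontier S"
    using ray_to_frontier[of S z v] S v by (auto simp: interior_open)
  then show ?thesis using that by (metis less_imp_le)
next
  case False
  then show ?thesis using that[of 0] z frontier_eq by auto
qed

lemma X_lipschitz: "\<bar>X z - X w\<bar> \<le> dist z w"
proof -
  have "\<bar>X z - X w\<bar>\<^sup>2 \<le> (dist z w)\<^sup>2" unfolding dist_XY by simp
  then show ?thesis by (rule power2_le_imp_le) simp
qed

definition arc :: "real \<Rightarrow> (real^2) set" where
  "arc \<tau> = {z \<in> frontier S. 0 < \<tau> * Y z}"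

lemma arc_borel [measurable]: "arc \<tau> \<in> sets borel"
proof -
  have "arc \<tau> = frontier S \<inter> {z \<in> space borel. 0 < \<tau> * Y z}" by (auto simp: arc_def)
  then show ?thesis by simp
qed

lemma arc_X_borel: "Q \<in> sets borel \<Longrightarrow> arc \<tau> \<inter> X -` Q \<in> sets borel"
  using measurable_sets[OF measurable_XY(1), of Q] by auto

lemma axis_or_arc:
  assumes "z \<in> frontier S" "\<bar>X z\<bar> \<le> R" shows "Y z \<noteq> 0"
proof
  assume "Y z = 0"
  then have "z = P (X z) 0" using P_X_Y[of z] by simp
  then show False using axis[OF assms(2)] assms(1) frontier_eq by auto
qed

text \<open>
Over every point of the chord, the vertical line leaves the domain on either side, so each arc projects onto the chord.
\<close>

lemma arc_projection:
  assumes \<tau>: "\<tau> = 1 \<or> \<tau> = -1" and B: "B \<in> sets borel" "B \<subseteq> {-R..R}"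
  shows "emeasure lborel B \<le> emeasure hausdorff1 (arc \<tau> \<inter> X -` B)"
  unfolding emeasure_H[OF arc_X_borel[OF B(1)]]
proof (rule lborel_le_hausdorff1_outer[OF B(1) _ X_lipschitz])
  show "B \<subseteq> X ` (arc \<tau> \<inter> X -` B)"
  proof
    fix x assume x: "x \<in> B"
    then have "x \<in> {-R..R}" using B(2) by blast
    then have s: "P x 0 \<in> S" by (intro axis) (simp add: abs_le_iff)
    have "e' \<noteq> 0" using inner_frame by auto
    then have "\<tau> *\<^sub>R e' \<noteq> 0" using \<tau> by auto
    with s closure_subset obtain t where t: "0 \<le> t" "P x 0 + t *\<^sub>R \<tau> *\<^sub>R e' \<in> frontier S" "P x 0 \<in> S \<Longrightarrow> 0 < t"
      using exit_point by blast
    have "P x 0 + t *\<^sub>R \<tau> *\<^sub>R e' = P x (t * \<tau>)" by (simp add: P_def)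
    then have "P x (t * \<tau>) \<in> arc \<tau>" using t s \<tau> by (auto simp: arc_def)
    then show "x \<in> X ` (arc \<tau> \<inter> X -` B)" using x by (intro image_eqI[of _ _ "P x (t * \<tau>)"]) auto
  qed
qed

text \<open>
Suppose the arc rises faster from \<open>z\<close> to \<open>w\<close>. The segment from \<open>w\<close> to the end of the chord beyond \<open>z\<close> descends at most with the
slope on the right-hand side, so it passes strictly above \<open>z\<close>; then \<open>z\<close> is an interior point.
\<close>

lemma arc_slope:
  assumes \<tau>: "\<tau> = 1 \<or> \<tau> = -1" and z: "z \<in> arc \<tau>" "w \<in> arc \<tau>"
    and r: "\<bar>X z\<bar> \<le> r" "\<bar>X w\<bar> \<le> r" "r < R"
  shows "\<bar>Y z - Y w\<bar> \<le> pi / R / (R - r) * \<bar>X z - X w\<bar>"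
proof -
  have *: "\<tau> * Y w - \<tau> * Y z \<le> pi / R / (R - r) * \<bar>X z - X w\<bar>"
    if z: "z \<in> arc \<tau>" "w \<in> arc \<tau>" and r: "\<bar>X z\<bar> \<le> r" "\<bar>X w\<bar> \<le> r" "r < R" for z w
  proof (rule ccontr)
    assume "\<not> ?thesis"
    then have gt: "pi / R / (R - r) * \<bar>X z - X w\<bar> < \<tau> * Y w - \<tau> * Y z" by simp
    obtain \<rho> where \<rho>: "\<rho> = 1 \<or> \<rho> = (-1::real)" "\<rho> * X z \<le> \<rho> * X w" "\<bar>X z - X w\<bar> = \<rho> * (X w - X z)"
      by (cases "X z \<le> X w") (auto intro: that[of 1] that[of "-1"])
    have r0: "\<bar>\<rho> * X z\<bar> \<le> r" "\<bar>\<rho> * X w\<bar> \<le> r" using r \<rho>(1) by auto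
    define t where "t = \<rho> * (X w - X z) / (R + \<rho> * X w)"
    have pos: "0 < R + \<rho> * X w" "R - r \<le> R + \<rho> * X w" using r0 r(3) by linarith+
    have t: "0 \<le> t" "t < 1"
    proof -
      show "0 \<le> t" using \<rho>(2) pos by (simp add: t_def algebra_simps)
      have "\<rho> * (X w - X z) < R + \<rho> * X w" using r0 r(3) by (simp add: algebra_simps)
      then show "t < 1" using pos by (simp add: t_def)
    qed
    define p where "p = P (- \<rho> * R) 0"
    have pS: "p \<in> S" unfolding p_def using \<rho>(1) R by (intro axis) auto
    define q where "q = (1 - t) *\<^sub>R w + t *\<^sub>R p"
    have wc: "w \<in> closure S" using z by (auto simp: arc_def frontier_eq)
    have Xq: "X q = X z"
    proof -
      have "X q = X w - t * (X w + \<rho> * R)" 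
        unfolding q_def X_affine p_def X_P by (simp add: algebra_simps)
      also have "t * (X w + \<rho> * R) = X w - X z"
        using \<rho>(1) pos by (auto simp: t_def field_simps)
      finally show ?thesis by simp
    qed
    have Yq: "Y q = (1 - t) * Y w" unfolding q_def Y_affine p_def Y_P by simp
    have Yw: "0 < \<tau> * Y w" "\<tau> * Y w \<le> pi / R"
      using z(2) thin[OF wc] \<tau> by (auto simp: arc_def)
    have "t * (\<tau> * Y w) \<le> \<rho> * (X w - X z) / (R - r) * (pi / R)"
    proof (intro mult_mono)
      show "t \<le> \<rho> * (X w - X z) / (R - r)"
        unfolding t_def using \<rho>(2) pos r(3) by (intro divide_left_mono mult_pos_pos) (auto simp: right_diff_distrib)
      then show "0 \<le> \<rho> * (X w - X z) / (R - r)" using t(1) by linarith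
    qed (use Yw in auto)
    also have "\<dots> < \<tau> * Y w - \<tau> * Y z" using gt \<rho>(3) by (simp add: mult.commute)
    finally have less: "\<tau> * Y z < \<tau> * Y q" by (simp add: Yq algebra_simps)
    \<comment> \<open>So \<open>z\<close> lies strictly between a point of the axis and the point \<open>q\<close> of the closure.\<close>
    define l where "l = Y z / Y q"
    have Yz: "0 < \<tau> * Y z" using z(1) by (simp add: arc_def)
    have l: "0 < l" "l < 1"
      using less Yz \<tau> by (auto simp: l_def divide_simps)
    have "z = (1 - l) *\<^sub>R P (X z) 0 + l *\<^sub>R q"
    proof -
      have "Y q \<noteq> 0" using less Yz by auto
      then have lY: "l * Y q = Y z" by (simp add: l_def)
      have lX: "(1 - l) * X z + l * X q = X z" unfolding Xq by (simp add: algebra_simps)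
      have "(1 - l) *\<^sub>R P (X z) 0 + l *\<^sub>R q = P ((1 - l) * X z + l * X q) ((1 - l) * 0 + l * Y q)"
        by (simp only: P_affine P_X_Y)
      also have "\<dots> = z" unfolding lX lY by simp
      finally show ?thesis by simp
    qed
    moreover have "P (X z) 0 \<in> S" using r by (intro axis) auto
    moreover have "q \<in> closure S"
    proof -
      have "p \<in> closure S" using pS closure_subset by blast
      then show ?thesis unfolding q_def
        using convexD_alt[OF convex_closure[OF S(2)] wc, of p t] t by simp
    qed
    ultimately have "q - (1 - l) *\<^sub>R (q - P (X z) 0) \<in> interior S" "z = q - (1 - l) *\<^sub>R (q - P (X z) 0)"
      using mem_interior_closure_convex_shrink[OF S(2), of "P (X z) 0" q "1 - l"] S(1) l
      by (simp_all add: interior_open algebra_simps)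
    then have "z \<in> interior S" by simp
    then show False using z(1) S(1) by (simp add: arc_def frontier_eq interior_open)
  qed
  show ?thesis
    using *[OF z r] *[OF z(2,1) r(2,1,3), unfolded abs_minus_commute[of "X w"]] \<tau>
    unfolding abs_le_iff by fastforce
qed

lemma middle_arc_length:
  assumes \<tau>: "\<tau> = 1 \<or> \<tau> = -1" and r: "0 \<le> r" "r < R"
  shows "emeasure hausdorff1 (arc \<tau> \<inter> X -` {-r..r}) \<le> ennreal (sqrt (1 + (pi / R / (R - r))\<^sup>2) * (2 * r))"
proof -
  let ?A = "arc \<tau> \<inter> X -` {-r..r}"
  define L where "L = pi / R / (R - r)"
  have d: "dist z w \<le> sqrt (1 + L\<^sup>2) * \<bar>X z - X w\<bar>" if zw: "z \<in> ?A" "w \<in> ?A" for z w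
  proof -
    have "\<bar>Y z - Y w\<bar> \<le> L * \<bar>X z - X w\<bar>"
      unfolding L_def using zw r by (intro arc_slope[OF \<tau>]) auto
    then have "\<bar>Y z - Y w\<bar>\<^sup>2 \<le> (L * \<bar>X z - X w\<bar>)\<^sup>2" by (intro power_mono) auto
    then have "(dist z w)\<^sup>2 \<le> (1 + L\<^sup>2) * \<bar>X z - X w\<bar>\<^sup>2"
      unfolding dist_XY by (simp add: power_mult_distrib algebra_simps)
    also have "\<dots> = (sqrt (1 + L\<^sup>2) * \<bar>X z - X w\<bar>)\<^sup>2"
      by (simp add: power_mult_distrib)
    finally show ?thesis by (rule power2_le_imp_le) simp
  qed
  have inj: "inj_on X ?A"
  proof (rule inj_onI)
    fix z w assume "z \<in> ?A" "w \<in> ?A" "X z = X w"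
    then show "z = w" using d[of z w] by simp
  qed
  let ?\<gamma> = "inv_into ?A X"
  have im: "?\<gamma> ` (X ` ?A) = ?A"
    using inj by (simp add: inv_into_image_cancel)
  have "hausdorff1_outer (?\<gamma> ` (X ` ?A)) \<le> ennreal (sqrt (1 + L\<^sup>2) * (r - (- r)))"
  proof (rule hausdorff1_outer_lipschitz_image)
    fix x y assume "x \<in> X ` ?A" "y \<in> X ` ?A"
    then have "?\<gamma> x \<in> ?A" "?\<gamma> y \<in> ?A" "X (?\<gamma> x) = x" "X (?\<gamma> y) = y"
      by (simp_all only: inv_into_into f_inv_into_f)
    then show "dist (?\<gamma> x) (?\<gamma> y) \<le> sqrt (1 + L\<^sup>2) * \<bar>x - y\<bar>"
      using d[of "?\<gamma> x" "?\<gamma> y"] by simp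
  qed (use r in auto)
  then show ?thesis
    unfolding im L_def[symmetric] using emeasure_H[OF arc_X_borel[of "{-r..r}" \<tau>]] by simp
qed

text \<open>
Use the linear function in the direction from \<open>z\<close> to the end \<open>q\<close> of the chord as a 1-Lipschitz map. It maps the segment
from \<open>z\<close> to \<open>q\<close> onto an interval of length \<open>sqrt (T\<^sup>2 + b\<^sup>2)\<close>; moving outwards along its level lines, from the segment to the boundary,
shows that the arc has the same image.
\<close>

lemma end_arc_length:
  assumes \<tau>: "\<tau> = 1 \<or> \<tau> = -1" and \<rho>: "\<rho> = 1 \<or> \<rho> = (-1::real)"
    and z: "z \<in> closure S" "\<rho> * X z = R - T" "\<tau> * Y z = b" and b: "0 < b" and T: "0 < T"
  shows "ennreal (sqrt (T\<^sup>2 + b\<^sup>2)) \<le> emeasure hausdorff1 (arc \<tau> \<inter> X -` {x. R - T \<le> \<rho> * x})"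
proof -
  let ?A = "arc \<tau> \<inter> X -` {x. R - T \<le> \<rho> * x}"
  define h where "h = sqrt (T\<^sup>2 + b\<^sup>2)"
  have h: "0 < h" "h\<^sup>2 = T\<^sup>2 + b\<^sup>2"
    using b T by (auto simp: h_def intro!: real_sqrt_gt_zero add_pos_pos)
  define f where "f w = (T * (\<rho> * X w) - b * (\<tau> * Y w)) / h" for w
  define q where "q = P (\<rho> * R) 0"
  have qS: "q \<in> S" unfolding q_def using \<rho> R by (intro axis) auto
  have \<rho>2: "\<rho> * \<rho> = 1" and \<tau>2: "\<tau> * \<tau> = 1" using \<rho> \<tau> by auto
  have fz: "f q - f z = h"
  proof -
    have "f q - f z = (T\<^sup>2 + b\<^sup>2) / h"
      unfolding f_def z(2,3) using h \<rho>2
      by (simp add: q_def divide_simps power2_eq_square algebra_simps)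
    also have "\<dots> = h\<^sup>2 / h" by (simp only: h(2))
    also have "\<dots> = h" using h(1) by (simp add: power2_eq_square)
    finally show ?thesis .
  qed
  have lip: "\<bar>f v - f w\<bar> \<le> dist v w" for v w
  proof -
    let ?x = "\<rho> * X v - \<rho> * X w" and ?y = "\<tau> * Y v - \<tau> * Y w"
    have "f v - f w = (T * ?x - b * ?y) / h"
      using h by (simp add: f_def divide_simps algebra_simps)
    then have "\<bar>f v - f w\<bar>\<^sup>2 = (T * ?x - b * ?y)\<^sup>2 / h\<^sup>2" by (simp add: power_divide)
    also have "\<dots> \<le> (?x\<^sup>2 + ?y\<^sup>2)"
    proof -
      have "(T * ?x - b * ?y)\<^sup>2 + (T * ?y + b * ?x)\<^sup>2 = (?x\<^sup>2 + ?y\<^sup>2) * h\<^sup>2"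
        unfolding h(2) by (simp add: power2_eq_square algebra_simps)
      then have "(T * ?x - b * ?y)\<^sup>2 \<le> (?x\<^sup>2 + ?y\<^sup>2) * h\<^sup>2"
        using zero_le_power2[of "T * ?y + b * ?x"] by linarith
      then show ?thesis using h(1) by (simp add: divide_simps)
    qed
    also have "\<dots> = (dist v w)\<^sup>2"
      unfolding dist_XY right_diff_distrib[symmetric] power_mult_distrib
      using \<rho> \<tau> by auto
    finally show ?thesis by (rule power2_le_imp_le) simp
  qed
  have meas: "?A \<in> sets borel" by (rule arc_X_borel) measurable
  have sub: "{f z..f q} \<subseteq> f ` ?A"
  proof
    fix y assume y: "y \<in> {f z..f q}"
    define s where "s = (y - f z) / h"
    have s: "0 \<le> s" "s \<le> 1" "y = f z + s * h"
      using y h fz by (auto simp: s_def divide_simps)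
    define w where "w = (1 - s) *\<^sub>R z + s *\<^sub>R q"
    have "q \<in> closure S" using qS closure_subset by blast
    then have wc: "w \<in> closure S"
      unfolding w_def using convexD_alt[OF convex_closure[OF S(2)] z(1), of q s] s by simp
    have Xw: "\<rho> * X w = R - T + s * T"
    proof -
      have "\<rho> * X w = (1 - s) * (\<rho> * X z) + s * ((\<rho> * \<rho>) * R)"
        unfolding w_def X_affine q_def X_P by (simp add: algebra_simps)
      then show ?thesis unfolding z(2) \<rho>2 by (simp add: algebra_simps)
    qed
    have Yw: "\<tau> * Y w = (1 - s) * b"
      unfolding w_def Y_affine q_def Y_P z(3)[symmetric] by simp
    have "f w = y"
    proof -
      have "f w = (T * (R - T) - b * b + s * (T\<^sup>2 + b\<^sup>2)) / h"
        unfolding f_def Xw Yw by (simp add: power2_eq_square algebra_simps)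
      also have "\<dots> = f z + s * h"
        unfolding f_def z(2,3) h(2)[symmetric] using h(1) by (simp add: power2_eq_square field_simps)
      finally show ?thesis using s(3) by simp
    qed
    let ?v = "(b * \<rho>) *\<^sub>R e + (T * \<tau>) *\<^sub>R e'"
    have "?v \<bullet> e' = T * \<tau>" by (simp add: inner_add_left inner_frame)
    then have "?v \<noteq> 0" using T \<tau> by auto
    then obtain t where t: "0 \<le> t" "w + t *\<^sub>R ?v \<in> frontier S" "w \<in> S \<Longrightarrow> 0 < t"
      using exit_point[OF wc] by blast
    define w' where "w' = w + t *\<^sub>R ?v"
    have X': "X w' = X w + t * (b * \<rho>)" and Y': "Y w' = Y w + t * (T * \<tau>)"
      by (simp_all add: w'_def X_def Y_def inner_diff_left inner_add_left inner_frame algebra_simps)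
    have "\<rho> * X w' = \<rho> * X w + t * b * (\<rho> * \<rho>)" "\<tau> * Y w' = \<tau> * Y w + t * T * (\<tau> * \<tau>)"
      unfolding X' Y' by (simp_all add: algebra_simps)
    then have XY': "\<rho> * X w' = \<rho> * X w + t * b" "\<tau> * Y w' = \<tau> * Y w + t * T"
      unfolding \<rho>2 \<tau>2 by simp_all
    have "0 < \<tau> * Y w'"
    proof (cases "s = 1")
      case True
      then have "w \<in> S" using qS by (simp add: w_def)
      then have "0 < t * T" using t T by simp
      then show ?thesis unfolding XY' Yw using True by simp
    next
      case False
      then have "0 < (1 - s) * b" using s b by simp
      then show ?thesis unfolding XY' Yw using t T by (simp add: add_pos_nonneg)
    qed
    moreover have "R - T \<le> \<rho> * X w'" unfolding XY' Xw using s T t b by simp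
    moreover have "f w' = y"
      unfolding \<open>f w = y\<close>[symmetric] f_def XY' by (simp add: algebra_simps)
    ultimately show "y \<in> f ` ?A"
      using t(2) by (intro image_eqI[of _ _ w']) (auto simp: arc_def w'_def)
  qed
  have "ennreal h = emeasure lborel {f z..f q}" using fz h by simp
  also have "\<dots> \<le> hausdorff1_outer ?A"
    by (rule lborel_le_hausdorff1_outer[OF _ sub lip]) simp
  finally show ?thesis unfolding h_def emeasure_H[OF meas] .
qed

lemma frontier_length: "emeasure hausdorff1 (frontier S) \<le> ennreal ((R + d + pi / R) * (2 * pi))"
proof -
  have "closure S \<subseteq> cball c (R + d + pi / R)"
  proof
    fix z assume z: "z \<in> closure S"
    have "(dist c z)\<^sup>2 = \<bar>X z\<bar>\<^sup>2 + \<bar>Y z\<bar>\<^sup>2" by (simp add: dist_XY X_def Y_def)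
    also have "\<dots> \<le> (\<bar>X z\<bar> + \<bar>Y z\<bar>)\<^sup>2" by (simp add: power2_sum)
    finally have "dist c z \<le> \<bar>X z\<bar> + \<bar>Y z\<bar>" by (rule power2_le_imp_le) simp
    then show "z \<in> cball c (R + d + pi / R)" using wide[OF z] thin[OF z] by simp
  qed
  moreover have "S \<noteq> {}" using axis[of 0] R by auto
  moreover have "frontier S \<in> sets borel" by simp
  ultimately show ?thesis
    using hausdorff1_outer_frontier_le[OF S(2,1)] emeasure_H by metis
qed

lemma frontier_finite: "emeasure hausdorff1 (frontier S) < \<infinity>"
  using frontier_length by (rule le_less_trans) simp

end

context thin_domain begin

lemma boundary_integral:
  fixes F :: "real^2 \<Rightarrow> real"
  assumes "F \<in> borel_measurable borel"
  shows "(LINT z|boundary_measure S. F z) = (LINT z|hausdorff1. indicator (frontier S) z * F z)"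
  unfolding boundary_measure_def by (subst integral_restrict_space) auto

lemma bounded_coordinates:
  assumes "z \<in> frontier S"
  shows "\<bar>X z\<bar> \<le> 2 * R" "\<bar>Y z\<bar> \<le> pi / R"
proof -
  have z: "z \<in> closure S" using assms frontier_eq by auto
  show "\<bar>X z\<bar> \<le> 2 * R" using wide[OF z] R d_le by linarith
  show "\<bar>Y z\<bar> \<le> pi / R" by (rule thin[OF z])
qed

lemma integrable_X:
  fixes w :: "real \<Rightarrow> real"
  assumes w: "w \<in> borel_measurable borel" "\<And>x. \<bar>x\<bar> \<le> 2 * R \<Longrightarrow> \<bar>w x\<bar> \<le> W"
  shows "integrable (boundary_measure S) (\<lambda>z. indicator (arc \<tau>) z * w (X z))"
proof (rule integrable_boundary_bounded[OF frontier_finite, where B="\<bar>W\<bar>"])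
  have [measurable]: "(\<lambda>z. w (X z)) \<in> borel_measurable borel"
    using w(1) measurable_XY(1) by (rule measurable_compose[rotated])
  show "(\<lambda>z. indicator (arc \<tau>) z * w (X z)) \<in> borel_measurable borel" by measurable
  fix z assume "z \<in> frontier S"
  then have "\<bar>w (X z)\<bar> \<le> W" using bounded_coordinates w(2) by blast
  then show "\<bar>indicator (arc \<tau>) z * w (X z)\<bar> \<le> \<bar>W\<bar>"
    by (cases "z \<in> arc \<tau>") auto
qed

text \<open>
The domination of Lebesgue measure by arc length, passed from sets to integrals.
\<close>

lemma arc_integral:
  fixes w :: "real \<Rightarrow> real"
  assumes \<tau>: "\<tau> = 1 \<or> \<tau> = -1"
    and w: "w \<in> borel_measurable borel" "\<And>x. 0 \<le> w x" "\<And>x. w x \<le> W" "\<And>x. x \<notin> {-R..R} \<Longrightarrow> w x = 0"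
  shows "(LINT x|lborel. w x) \<le> (LINT z|boundary_measure S. indicator (arc \<tau>) z * w (X z))"
proof -
  have W: "0 \<le> W" using w(2,3) order_trans by blast
  note [measurable] = w(1)
  define \<mu>1 where "\<mu>1 = density lborel (indicator {-R..R} :: real \<Rightarrow> ennreal)"
  define \<mu>2 where "\<mu>2 = distr (density hausdorff1 (indicator (arc \<tau>) :: real^2 \<Rightarrow> ennreal)) borel X"
  have mX: "X \<in> borel_measurable (density hausdorff1 (indicator (arc \<tau>) :: real^2 \<Rightarrow> ennreal))"
    by simp
  \<comment> \<open>Push arc length on the arc forward to the axis and compare with Lebesgue measure on the chord.\<close>
  have "emeasure \<mu>1 B \<le> emeasure \<mu>2 B" if B: "B \<in> sets borel" for B
  proof -
    \<comment> \<open>Push arc length on the arc forward to the axis and compare with Lebesgue measure on the chord.\<close>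
  have "emeasure \<mu>1 B = emeasure lborel (B \<inter> {-R..R})"
      unfolding \<mu>1_def using B by (simp add: emeasure_density Int_commute flip: indicator_inter_arith)
    also have "\<dots> \<le> emeasure hausdorff1 (arc \<tau> \<inter> X -` (B \<inter> {-R..R}))"
      using B by (intro arc_projection[OF \<tau>]) auto
    also have "\<dots> \<le> emeasure hausdorff1 (arc \<tau> \<inter> X -` B)"
      using arc_X_borel[OF B] by (intro emeasure_mono) auto
    also have "\<dots> = emeasure \<mu>2 B"
      unfolding \<mu>2_def using B mX arc_X_borel[OF B, of \<tau>] measurable_sets[OF measurable_XY(1) B]
      by (simp add: emeasure_distr emeasure_density flip: indicator_inter_arith)
    finally show ?thesis .
  qed
  then have "\<mu>1 \<le> \<mu>2"
    by (subst le_measure) (auto simp: \<mu>1_def \<mu>2_def)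
  then have le: "(\<integral>\<^sup>+x. ennreal (w x) \<partial>\<mu>1) \<le> (\<integral>\<^sup>+x. ennreal (w x) \<partial>\<mu>2)"
    by (intro nn_integral_mono_measure) (auto simp: \<mu>1_def \<mu>2_def)
  have e1: "(\<integral>\<^sup>+x. ennreal (w x) \<partial>\<mu>1) = (\<integral>\<^sup>+x. ennreal (w x) \<partial>lborel)"
    unfolding \<mu>1_def using w(4)
    by (subst nn_integral_density) (auto intro!: nn_integral_cong simp: indicator_def)
  have e2: "(\<integral>\<^sup>+x. ennreal (w x) \<partial>\<mu>2) = (\<integral>\<^sup>+z. indicator (arc \<tau>) z * ennreal (w (X z)) \<partial>hausdorff1)"
    unfolding \<mu>2_def using mX
    by (subst nn_integral_distr) (auto simp: nn_integral_density)
  have e3: "(\<integral>\<^sup>+z. indicator (arc \<tau>) z * ennreal (w (X z)) \<partial>hausdorff1)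
      = (\<integral>\<^sup>+z. ennreal (indicator (arc \<tau>) z * w (X z)) \<partial>boundary_measure S)"
    unfolding boundary_measure_def
    by (subst nn_integral_restrict_space)
      (auto intro!: nn_integral_cong simp: arc_def indicator_def)
  have i1: "integrable lborel w"
  proof (rule Bochner_Integration.integrable_bound)
    show "integrable lborel (\<lambda>x. W * indicator {-R..R} x)"
      using R by (auto intro!: integrable_real_indicator)
    show "AE x in lborel. norm (w x) \<le> norm (W * indicator {-R..R} x :: real)"
      using w(2,3,4) W by (intro AE_I2) (auto simp: indicator_def)
  qed simp
  have i2: "integrable (boundary_measure S) (\<lambda>z. indicator (arc \<tau>) z * w (X z))"
    using w(2,3) by (intro integrable_X[where W=W]) (auto simp: abs_of_nonneg)
  have "ennreal (LINT x|lborel. w x) \<le> ennreal (LINT z|boundary_measure S. indicator (arc \<tau>) z * w (X z))"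
    using le nn_integral_eq_integral[OF i1] nn_integral_eq_integral[OF i2] w(2)
    unfolding e1 e2 e3 by simp
  then show ?thesis using w(2) by (simp add: integral_nonneg_AE)
qed

lemma measure_boundary: "A \<in> sets borel \<Longrightarrow> A \<subseteq> frontier S \<Longrightarrow>
    (LINT z|boundary_measure S. indicator A z) = measure hausdorff1 A"
  by (subst boundary_integral) (auto simp: indicator_inter_arith[symmetric] Int_absorb1)

lemma finite_arc: "A \<in> sets borel \<Longrightarrow> emeasure hausdorff1 (arc \<tau> \<inter> A) < \<infinity>"
proof -
  have "arc \<tau> \<inter> A \<subseteq> frontier S" by (auto simp: arc_def)
  then have "emeasure hausdorff1 (arc \<tau> \<inter> A) \<le> emeasure hausdorff1 (frontier S)"
    by (intro emeasure_mono) auto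
  then show ?thesis using frontier_finite by (rule le_less_trans)
qed

text \<open>
Below \<open>x\<^sup>2 - k\<close> one places a function \<open>w \<ge> 0\<close>, integrated by comparison with Lebesgue measure, the constant
\<open>\<alpha>\<close> on the set \<open>E\<close>, whose arc length is known to be large, and \<open>-k\<close> in the middle, where the arc length is bounded above. The one
upper bound for arc length that enters is that of a single interval.
\<close>

lemma arc_moment:
  fixes w :: "real \<Rightarrow> real"
  assumes \<tau>: "\<tau> = 1 \<or> \<tau> = -1" and r: "0 \<le> r" "r < R" and k: "0 \<le> k"
    and w: "w \<in> borel_measurable borel" "\<And>x. 0 \<le> w x" "\<And>x. w x \<le> W" "\<And>x. x \<notin> {-R..R} \<Longrightarrow> w x = 0"
    and E: "E \<in> sets borel"
    and below: "\<And>x. w x + \<alpha> * indicator E x - k * indicator {-r..r} x \<le> x\<^sup>2 - k"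
  shows "(LINT x|lborel. w x) + \<alpha> * measure hausdorff1 (arc \<tau> \<inter> X -` E)
      - k * (sqrt (1 + (pi / R / (R - r))\<^sup>2) * (2 * r))
    \<le> (LINT z|boundary_measure S. indicator (arc \<tau>) z * ((X z)\<^sup>2 - k))"
proof -
  let ?N = "boundary_measure S" and ?I = "\<lambda>z. indicator (arc \<tau>) z :: real"
  have 1: "measure hausdorff1 (arc \<tau> \<inter> X -` {-r..r}) \<le> sqrt (1 + (pi / R / (R - r))\<^sup>2) * (2 * r)"
    unfolding measure_def using middle_arc_length[OF \<tau> r] r
    by (intro enn2real_leI) auto
  have ind: "integrable ?N (\<lambda>z. ?I z * indicator Q (X z))" if "Q \<in> sets borel" for Q :: "real set"
    using that by (intro integrable_X[where W=1]) (auto simp: indicator_def)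
  have indm: "(LINT z|?N. ?I z * indicator Q (X z)) = measure hausdorff1 (arc \<tau> \<inter> X -` Q)"
    if "Q \<in> sets borel" for Q :: "real set"
  proof -
    have "(\<lambda>z. ?I z * indicator Q (X z)) = (\<lambda>z. indicator (arc \<tau> \<inter> X -` Q) z)"
      by (auto simp: indicator_def)
    then show ?thesis using measure_boundary[OF arc_X_borel[OF that, of \<tau>]] by (simp add: arc_def subset_iff)
  qed
  have iw: "integrable ?N (\<lambda>z. ?I z * w (X z))"
    using w by (intro integrable_X[where W=W]) auto
  have i2: "integrable ?N (\<lambda>z. ?I z * ((X z)\<^sup>2 - k))"
  proof (rule integrable_X[where W="(2 * R)\<^sup>2 + k"])
    fix x :: real assume "\<bar>x\<bar> \<le> 2 * R"
    then have "x\<^sup>2 \<le> (2 * R)\<^sup>2" using abs_le_square_iff[of x "2 * R"] by simp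
    then show "\<bar>x\<^sup>2 - k\<bar> \<le> (2 * R)\<^sup>2 + k"
      unfolding abs_le_iff using k zero_le_power2[of x] zero_le_power2[of "2 * R"] by linarith
  qed measurable
  have ik: "integrable ?N (\<lambda>z. k * (?I z * indicator {-r..r} (X z)))"
    and iE: "integrable ?N (\<lambda>z. \<alpha> * (?I z * indicator E (X z)))"
    using ind[of "{-r..r}"] ind[OF E] by auto
  have "(LINT x|lborel. w x) + \<alpha> * measure hausdorff1 (arc \<tau> \<inter> X -` E)
      - k * (sqrt (1 + (pi / R / (R - r))\<^sup>2) * (2 * r))
    \<le> (LINT z|?N. ?I z * w (X z)) + \<alpha> * measure hausdorff1 (arc \<tau> \<inter> X -` E)
      - k * measure hausdorff1 (arc \<tau> \<inter> X -` {-r..r})"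
    using arc_integral[OF \<tau> w] mult_left_mono[OF 1 k] by linarith
  also have "\<dots> = (LINT z|?N. ?I z * w (X z) + \<alpha> * (?I z * indicator E (X z)) - k * (?I z * indicator {-r..r} (X z)))"
    using iw ik iE indm[OF E] indm[of "{-r..r}"] by simp
  also have "\<dots> \<le> (LINT z|?N. ?I z * ((X z)\<^sup>2 - k))"
  proof (rule integral_mono)
    show "integrable ?N (\<lambda>z. ?I z * w (X z) + \<alpha> * (?I z * indicator E (X z)) - k * (?I z * indicator {-r..r} (X z)))"
      using iw ik iE by simp
    show "?I z * w (X z) + \<alpha> * (?I z * indicator E (X z)) - k * (?I z * indicator {-r..r} (X z)) \<le> ?I z * ((X z)\<^sup>2 - k)" for z
      using below[of "X z"] by (cases "z \<in> arc \<tau>") auto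
  qed (rule i2)
  finally show ?thesis .
qed

end

section \<open>The boundary moment\<close>

lemma pi_bounds: "3 \<le> pi" "pi < 4"
proof -
  show "3 \<le> pi" using sin_x_le_x[of "pi / 6"] by (simp add: sin_30)
qed (rule pi_less_4)

context thin_domain begin

text \<open>
The mean of \<open>x\<^sup>2\<close> over \<open>[-R, R]\<close>.
\<close>

definition k :: real where "k = R\<^sup>2 / 3"

text \<open>
This is \<open>x\<^sup>2\<close> in the middle and \<open>x\<^sup>2 - k\<close> in the outer part of the chord. The cut at \<open>3/5 R\<close> is beyond the zero \<open>R / sqrt 3\<close>
of \<open>x\<^sup>2 - k\<close>, so the function is nonnegative, and it stays at a distance of order \<open>R\<close> from the ends, so the arcs are flat before it.
\<close>

definition profile :: "real \<Rightarrow> real" where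
  "profile x = (x\<^sup>2 - k) * indicator {-R..R} x + k * indicator {-(3/5 * R)..3/5 * R} x"

lemma k_le: "3/5 * R < \<bar>x\<bar> \<Longrightarrow> k \<le> x\<^sup>2"
proof -
  assume "3/5 * R < \<bar>x\<bar>"
  then have "(3/5 * R)\<^sup>2 \<le> \<bar>x\<bar>\<^sup>2" using R by (intro power_mono) auto
  then have "9/25 * R\<^sup>2 \<le> x\<^sup>2" by (simp add: power2_eq_square)
  then show ?thesis unfolding k_def using zero_le_power2[of x] zero_le_power2[of R] by linarith
qed

lemma k_nonneg: "0 \<le> k" by (simp add: k_def)

lemma profile_nonneg: "0 \<le> profile x"
  using k_le[of x] k_nonneg R by (auto simp: profile_def indicator_def abs_if split: if_splits)

lemma profile_le: "profile x \<le> R\<^sup>2"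
proof (cases "x \<in> {-R..R}")
  case True
  then have "\<bar>x\<bar> \<le> R" by auto
  then have "x\<^sup>2 \<le> R\<^sup>2" using abs_le_square_iff[of x R] R by simp
  then show ?thesis using k_nonneg True by (auto simp: profile_def indicator_def)
next
  case False
  then have "x \<notin> {-(3/5 * R)..3/5 * R}" using R by auto
  then show ?thesis using False by (simp add: profile_def)
qed

lemma profile_measurable [measurable]: "profile \<in> borel_measurable borel"
  unfolding profile_def by measurable

lemma profile_outside: "x \<notin> {-R..R} \<Longrightarrow> profile x = 0"
  using R by (auto simp: profile_def indicator_def)

lemma quadratic_integral:
  fixes a b q :: real
  assumes "a \<le> b"
  shows "integrable lborel (\<lambda>x. (x\<^sup>2 - q) * indicator {a..b} x)"
    and "(LINT x|lborel. (x\<^sup>2 - q) * indicator {a..b} x) = (b^3 - a^3) / 3 - q * (b - a)"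
proof -
  have "has_bochner_integral lborel (\<lambda>x. (x\<^sup>2 - q) * indicator {a..b} x)
      ((b^3 / 3 - q * b) - (a^3 / 3 - q * a))"
    by (rule has_bochner_integral_FTC_Icc_real[OF assms])
      (auto intro!: derivative_eq_intros simp: power2_eq_square)
  then show "integrable lborel (\<lambda>x. (x\<^sup>2 - q) * indicator {a..b} x)"
    "(LINT x|lborel. (x\<^sup>2 - q) * indicator {a..b} x) = (b^3 - a^3) / 3 - q * (b - a)"
    by (auto simp: has_bochner_integral_iff field_simps)
qed

lemma profile_integral:
  shows "integrable lborel profile" "(LINT x|lborel. profile x) = k * (2 * (3/5 * R))"
proof -
  have i: "integrable lborel (\<lambda>x. (x\<^sup>2 - k) * indicator {-R..R} x)"
    using R by (intro quadratic_integral) auto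
  have j: "integrable lborel (\<lambda>x. k * indicator {-(3/5 * R)..3/5 * R} x)"
    using R by (auto intro!: integrable_real_indicator)
  show "integrable lborel profile" unfolding profile_def using i j by simp
  have "(LINT x|lborel. (x\<^sup>2 - k) * indicator {-R..R} x) = 0"
    using R by (subst quadratic_integral(2)) (auto simp: k_def power2_eq_square power3_eq_cube)
  moreover have "(LINT x|lborel. k * indicator {-(3/5 * R)..3/5 * R} x) = k * (2 * (3/5 * R))"
    using R by simp
  ultimately show "(LINT x|lborel. profile x) = k * (2 * (3/5 * R))"
    unfolding profile_def using i j by simp
qed

lemma middle_excess:
  "k * (sqrt (1 + (pi / R / (R - 3/5 * R))\<^sup>2) * (2 * (3/5 * R))) \<le> k * (2 * (3/5 * R)) + 20 / R"
proof -
  define L where "L = pi / R / (R - 3/5 * R)"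
  have L: "L = 5/2 * pi / R\<^sup>2" using R by (simp add: L_def field_simps power2_eq_square)
  have "1 + L\<^sup>2 \<le> (1 + L\<^sup>2 / 2)\<^sup>2" using zero_le_power2[of "L\<^sup>2 / 2"] by (simp add: power2_sum)
  then have "sqrt (1 + L\<^sup>2) \<le> 1 + L\<^sup>2 / 2"
    by (intro real_le_lsqrt) (auto intro!: add_nonneg_nonneg)
  then have "k * (sqrt (1 + L\<^sup>2) * (2 * (3/5 * R))) \<le> k * ((1 + L\<^sup>2 / 2) * (2 * (3/5 * R)))"
    using R k_nonneg by (intro mult_left_mono mult_right_mono) auto
  also have "\<dots> = k * (2 * (3/5 * R)) + k * L\<^sup>2 * (3/5 * R)" by (simp add: algebra_simps)
  also have "k * L\<^sup>2 * (3/5 * R) = 5/4 * pi\<^sup>2 / R"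
    using R by (simp add: k_def L power_divide power_mult_distrib field_simps power2_eq_square)
  also have "\<dots> \<le> 20 / R"
  proof -
    have "pi\<^sup>2 \<le> 4\<^sup>2" using pi_bounds by (intro power_mono) auto
    then show ?thesis using R by (intro divide_right_mono) auto
  qed
  finally show ?thesis unfolding L_def by simp
qed

lemma arc_moment_lower:
  assumes \<tau>: "\<tau> = 1 \<or> \<tau> = -1"
  shows "- (20 / R) \<le> (LINT z|boundary_measure S. indicator (arc \<tau>) z * ((X z)\<^sup>2 - k))"
proof -
  have "(LINT x|lborel. profile x) + 0 * measure hausdorff1 (arc \<tau> \<inter> X -` {})
      - k * (sqrt (1 + (pi / R / (R - 3/5 * R))\<^sup>2) * (2 * (3/5 * R)))
    \<le> (LINT z|boundary_measure S. indicator (arc \<tau>) z * ((X z)\<^sup>2 - k))"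
  proof (rule arc_moment[OF \<tau> _ _ k_nonneg profile_measurable profile_nonneg profile_le profile_outside])
    fix x :: real
    show "profile x + 0 * indicator {} x - k * indicator {-(3/5 * R)..3/5 * R} x \<le> x\<^sup>2 - k"
      using k_le[of x] R by (auto simp: profile_def indicator_def abs_if)
  qed (use R in auto)
  then show ?thesis using middle_excess profile_integral(2) by linarith
qed

text \<open>
The mean height of a domain of area \<open>\<pi>\<close> over a chord of length \<open>2R\<close>, used as the length scale at the ends.
\<close>

definition T :: real where "T = pi / (2 * R)"

lemma T: "0 < T" "T < R / 5" "R * T = pi / 2"
proof -
  show "0 < T" "R * T = pi / 2" using R by (auto simp: T_def)
  have "5 * pi < 2 * (R * R)"
  proof -
    have "R * 1 \<le> R * R" using R by (intro mult_left_mono) auto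
    then show ?thesis using R pi_bounds by linarith
  qed
  then show "T < R / 5" using R by (simp add: T_def field_simps)
qed

lemma end_quadratic:
  assumes "R - T \<le> \<bar>x\<bar>" shows "(R - T)\<^sup>2 \<le> x\<^sup>2"
proof -
  have "\<bar>R - T\<bar> \<le> \<bar>x\<bar>" using assms T by linarith
  then show ?thesis by (simp add: abs_le_square_iff)
qed

text \<open>
Over the last piece of length \<open>T\<close> the arc has length at least \<open>sqrt (T\<^sup>2 + (T / 8)\<^sup>2) \<ge> T (1 + 1 / 130)\<close>. The gain \<open>T / 130\<close> is weighted with about
\<open>R\<^sup>2 - k = 2/3 R\<^sup>2\<close> and therefore is of order \<open>R\<close>, while the variation of \<open>x\<^sup>2\<close> over that piece costs only \<open>O(T)\<close>.
\<close>

lemma arc_moment_excess: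
  assumes \<tau>: "\<tau> = 1 \<or> \<tau> = -1" and \<rho>: "\<rho> = 1 \<or> \<rho> = (-1::real)"
    and z: "z \<in> closure S" "\<rho> * X z = R - T" "T / 8 \<le> \<tau> * Y z"
  shows "pi * R / 400 - 20 / R \<le> (LINT z|boundary_measure S. indicator (arc \<tau>) z * ((X z)\<^sup>2 - k))"
proof -
  define E where "E = {x :: real. R - T \<le> \<rho> * x}"
  have E: "E \<in> sets borel" unfolding E_def by measurable
  define J where "J = (if \<rho> = 1 then {R - T..R} else {-R..-(R - T)})"
  have J: "x \<in> J \<longleftrightarrow> x \<in> E \<and> x \<in> {-R..R}" for x
    using \<rho> T by (auto simp: J_def E_def)
  define w where "w x = profile x - (x\<^sup>2 - k) * indicator J x" for x
  have wJ: "w x = (if x \<in> J then 0 else profile x)" for x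
    using T J[of x] \<rho> R by (auto simp: w_def profile_def E_def)
  let ?q = "(R - T)\<^sup>2 - k"
  have q: "2/3 * R\<^sup>2 - pi \<le> ?q" "0 \<le> ?q"
  proof -
    have "(R - T)\<^sup>2 = R\<^sup>2 - pi + T\<^sup>2" using T(3) by (simp add: power2_diff)
    then show "2/3 * R\<^sup>2 - pi \<le> ?q" by (simp add: k_def)
    have "3/5 * R < \<bar>R - T\<bar>" using T(1,2) R by linarith
    then show "0 \<le> ?q" using k_le[of "R - T"] by simp
  qed
  have wi: "(LINT x|lborel. w x) \<ge> k * (2 * (3/5 * R)) - T * (R\<^sup>2 - k)"
  proof -
    have Jm: "J \<in> sets borel" unfolding J_def by simp
    have Jl: "measure lborel J = T" and Jf: "emeasure lborel J < \<infinity>" using T \<rho> by (auto simp: J_def)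
    have b: "(x\<^sup>2 - k) * indicator J x \<le> (R\<^sup>2 - k) * indicator J x" for x
    proof (cases "x \<in> J")
      case True
      then have "x \<in> {-R..R}" using J[of x] by blast
      then have "\<bar>x\<bar> \<le> \<bar>R\<bar>" using R by auto
      then have "x\<^sup>2 \<le> R\<^sup>2" by (simp add: abs_le_square_iff)
      then show ?thesis using True by simp
    qed simp
    have iJ: "integrable lborel (\<lambda>x. (x\<^sup>2 - k) * indicator J x)"
      unfolding J_def using quadratic_integral(1)[of "R - T" R k] quadratic_integral(1)[of "-R" "-(R-T)" k] T(1)
      by (auto split: if_split)
    have "(LINT x|lborel. (x\<^sup>2 - k) * indicator J x) \<le> (LINT x|lborel. (R\<^sup>2 - k) * indicator J x)"
      using iJ b Jm Jf by (intro integral_mono) (auto intro!: integrable_real_indicator)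
    also have "\<dots> = (R\<^sup>2 - k) * T" using Jm Jl by simp
    finally show ?thesis
      unfolding w_def using iJ profile_integral by (simp add: mult.commute)
  qed
  have len: "sqrt (T\<^sup>2 + (\<tau> * Y z)\<^sup>2) \<le> measure hausdorff1 (arc \<tau> \<inter> X -` E)"
  proof -
    have "0 < \<tau> * Y z" using z(3) T(1) by linarith
    from end_arc_length[OF \<tau> \<rho> z(1,2) refl this T(1)]
    show ?thesis unfolding E_def measure_def
      using finite_arc[OF measurable_sets[OF measurable_XY(1) E, simplified], of \<tau>] unfolding E_def
      by (metis enn2real_mono enn2real_ennreal real_sqrt_ge_zero sum_power2_ge_zero infinity_ennreal_def)
  qed
  have h: "T * (1 + 1/130) \<le> sqrt (T\<^sup>2 + (\<tau> * Y z)\<^sup>2)"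
  proof (rule real_le_rsqrt)
    have "(T / 8)\<^sup>2 \<le> (\<tau> * Y z)\<^sup>2" using z(3) T(1) by (intro power_mono) auto
    then have "T\<^sup>2 / 64 \<le> (\<tau> * Y z)\<^sup>2" by (simp add: power_divide)
    moreover have "(T * (1 + 1/130))\<^sup>2 = T\<^sup>2 * (17161 / 16900)"
      by (simp add: power2_eq_square)
    moreover have "0 \<le> T\<^sup>2" by simp
    ultimately show "(T * (1 + 1/130))\<^sup>2 \<le> T\<^sup>2 + (\<tau> * Y z)\<^sup>2" by linarith
  qed
  have gain: "pi * R / 400 \<le> ?q * (T * (1 + 1/130)) - T * (R\<^sup>2 - k)"
  proof -
    have R2: "1000 * 1000 \<le> R\<^sup>2" unfolding power2_eq_square using R by (intro mult_mono) auto
    \<comment> \<open>\<open>2/3 R\<^sup>2 / 130 = R\<^sup>2 / 195\<close>; the difference to \<open>R\<^sup>2 / 200\<close> absorbs the constant terms as \<open>R \<ge> 1000\<close>.\<close>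
    have "R\<^sup>2 / 200 \<le> (2/3 * R\<^sup>2 - pi) * (1 + 1/130) - (R\<^sup>2 - k)"
      using R2 pi_bounds by (simp add: k_def algebra_simps)
    also have "\<dots> \<le> ?q * (1 + 1/130) - (R\<^sup>2 - k)" using q(1) by (simp add: mult_right_mono)
    finally have "T * (R\<^sup>2 / 200) \<le> T * (?q * (1 + 1/130) - (R\<^sup>2 - k))"
      using T(1) by (intro mult_left_mono) auto
    moreover have "T * (R\<^sup>2 / 200) = pi * R / 400" using R by (simp add: T_def power2_eq_square)
    moreover have "T * (x * y - z) = x * (T * y) - T * z" for x y z by (simp add: algebra_simps)
    ultimately show ?thesis by metis
  qed
  have "(LINT x|lborel. w x) + ?q * measure hausdorff1 (arc \<tau> \<inter> X -` E)
      - k * (sqrt (1 + (pi / R / (R - 3/5 * R))\<^sup>2) * (2 * (3/5 * R)))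
    \<le> (LINT z|boundary_measure S. indicator (arc \<tau>) z * ((X z)\<^sup>2 - k))"
  proof (rule arc_moment[OF \<tau> _ _ k_nonneg _ _ _ _ E])
    show "w \<in> borel_measurable borel" unfolding w_def J_def by measurable
    show "0 \<le> w x" "w x \<le> R\<^sup>2" for x using wJ profile_nonneg profile_le by auto
    show "w x = 0" if "x \<notin> {-R..R}" for x using that wJ profile_outside by auto
    fix x :: real
    show "w x + ?q * indicator E x - k * indicator {-(3/5 * R)..3/5 * R} x \<le> x\<^sup>2 - k"
    proof (cases "x \<in> E")
      case True
      then have a: "R - T \<le> \<bar>x\<bar>" using \<rho> by (auto simp: E_def)
      then have "x \<notin> {-(3/5 * R)..3/5 * R}" using T(2) R by auto
      moreover have "w x = 0" using wJ[of x] J[of x] True profile_outside[of x] by auto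
      ultimately show ?thesis using True end_quadratic[OF a] by simp
    next
      case False
      then have "w x = profile x" using wJ[of x] J[of x] by auto
      then show ?thesis using False k_le[of x] R by (auto simp: profile_def indicator_def abs_if)
    qed
  qed (use R in auto)
  moreover have "?q * (T * (1 + 1/130)) \<le> ?q * measure hausdorff1 (arc \<tau> \<inter> X -` E)"
    using h len q(2) by (intro mult_left_mono) auto
  ultimately show ?thesis using middle_excess wi gain by linarith
qed

lemma perimeter_bounds: "2 * R \<le> perimeter S" "perimeter S \<le> 9 * R"
proof -
  have "emeasure lborel {-R..R} \<le> emeasure hausdorff1 (arc 1 \<inter> X -` {-R..R})"
    by (intro arc_projection) auto
  also have "\<dots> \<le> emeasure hausdorff1 (frontier S)" by (intro emeasure_mono) (auto simp: arc_def)
  finally have "ennreal (2 * R) \<le> emeasure hausdorff1 (frontier S)" using R by simp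
  then show "2 * R \<le> perimeter S"
    unfolding perimeter_def measure_def using frontier_finite R
    by (metis enn2real_ennreal enn2real_mono infinity_ennreal_def mult_nonneg_nonneg order_trans zero_le_numeral)
  have "pi / R \<le> 1" using R pi_bounds by (simp add: field_simps)
  then have "R + d + pi / R \<le> R + R / 500" using R d_le by linarith
  then have "(R + d + pi / R) * (2 * pi) \<le> (R + R / 500) * (2 * 4)"
    using R pi_bounds d(1) by (intro mult_mono) auto
  also have "\<dots> \<le> 9 * R" using R by simp
  finally have "emeasure hausdorff1 (frontier S) \<le> ennreal (9 * R)"
    using frontier_length by (meson ennreal_leI order_trans)
  then show "perimeter S \<le> 9 * R"
    unfolding perimeter_def measure_def using R by (intro enn2real_leI) auto
qed

lemma boundary_moment:
  fixes I :: "real \<Rightarrow> real"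
  defines "I \<equiv> \<lambda>\<tau>. LINT z|boundary_measure S. indicator (arc \<tau>) z * ((X z)\<^sup>2 - k)"
  shows "I 1 + I (-1) - 144 / R \<le> (LINT z|boundary_measure S. (X z)\<^sup>2 - (Y z)\<^sup>2 - k)"
proof -
  let ?N = "boundary_measure S"
  have bx: "\<bar>(X z)\<^sup>2 - k\<bar> \<le> (2 * R)\<^sup>2 + k" if "z \<in> frontier S" for z
  proof -
    have "(X z)\<^sup>2 \<le> (2 * R)\<^sup>2"
      using bounded_coordinates(1)[OF that] abs_le_square_iff[of "X z" "2 * R"] by simp
    then show ?thesis
      unfolding abs_le_iff using k_nonneg zero_le_power2[of "X z"] zero_le_power2[of "2 * R"] by linarith
  qed
  have by': "(Y z)\<^sup>2 \<le> (pi / R)\<^sup>2" if "z \<in> frontier S" for z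
    using bounded_coordinates(2)[OF that] abs_le_square_iff[of "Y z" "pi / R"] R by simp
  have i1: "integrable ?N (\<lambda>z. indicator (arc \<tau>) z * ((X z)\<^sup>2 - k))" for \<tau>
    using bx by (intro integrable_boundary_bounded[OF frontier_finite, where B="(2 * R)\<^sup>2 + k"])
      (auto simp: indicator_def k_nonneg add_nonneg_nonneg)
  have i2: "integrable ?N (\<lambda>z. (X z)\<^sup>2 - k)"
    using bx by (intro integrable_boundary_bounded[OF frontier_finite]) auto
  have i3: "integrable ?N (\<lambda>z. (Y z)\<^sup>2)"
    using by' by (intro integrable_boundary_bounded[OF frontier_finite]) auto
  have "I 1 + I (-1) = (LINT z|?N. indicator (arc 1) z * ((X z)\<^sup>2 - k) + indicator (arc (-1)) z * ((X z)\<^sup>2 - k))"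
    unfolding I_def using i1 by simp
  also have "\<dots> \<le> (LINT z|?N. (X z)\<^sup>2 - k)"
  proof (rule integral_mono)
    show "integrable ?N (\<lambda>z. indicator (arc 1) z * ((X z)\<^sup>2 - k) + indicator (arc (-1)) z * ((X z)\<^sup>2 - k))"
      using i1 by simp
    fix z assume "z \<in> space ?N"
    then have z: "z \<in> frontier S" by simp
    show "indicator (arc 1) z * ((X z)\<^sup>2 - k) + indicator (arc (-1)) z * ((X z)\<^sup>2 - k) \<le> (X z)\<^sup>2 - k"
    proof (cases "\<bar>X z\<bar> \<le> R")
      case True
      then have "Y z \<noteq> 0" using axis_or_arc z by blast
      then show ?thesis using z by (auto simp: arc_def indicator_def)
    next
      case False
      then have "k \<le> (X z)\<^sup>2" using R by (intro k_le) auto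
      then show ?thesis by (auto simp: arc_def indicator_def)
    qed
  qed (rule i2)
  finally have 1: "I 1 + I (-1) \<le> (LINT z|?N. (X z)\<^sup>2 - k)" .
  have "(LINT z|?N. (Y z)\<^sup>2) \<le> (LINT z|?N. (pi / R)\<^sup>2)"
    using by' finite_boundary_measure[OF frontier_finite] i3
    by (intro integral_mono) (auto simp: finite_measure.integrable_const)
  also have "\<dots> = perimeter S * (pi / R)\<^sup>2"
    unfolding perimeter_def boundary_measure_def
    by (simp add: measure_restrict_space space_restrict_space)
  also have "\<dots> \<le> 9 * R * (4 / R)\<^sup>2"
    using perimeter_bounds R pi_bounds by (intro mult_mono power_mono divide_right_mono) auto
  also have "\<dots> = 144 / R" using R by (simp add: power2_eq_square)
  finally have 2: "(LINT z|?N. (Y z)\<^sup>2) \<le> 144 / R" .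
  have "(LINT z|?N. (X z)\<^sup>2 - (Y z)\<^sup>2 - k) = (LINT z|?N. ((X z)\<^sup>2 - k) - (Y z)\<^sup>2)"
    by (simp add: algebra_simps)
  also have "\<dots> = (LINT z|?N. (X z)\<^sup>2 - k) - (LINT z|?N. (Y z)\<^sup>2)"
    using i2 i3 by simp
  finally show ?thesis using 1 2 by linarith
qed

lemma boundary_lower: "- (184 / R) \<le> (LINT z|boundary_measure S. (X z)\<^sup>2 - (Y z)\<^sup>2 - k)"
  using boundary_moment arc_moment_lower[of 1] arc_moment_lower[of "-1"] by simp

lemma boundary_excess:
  assumes z: "z \<in> closure S" "\<bar>X z\<bar> = R - T" "T / 8 < \<bar>Y z\<bar>"
  shows "7/1000 * R \<le> (LINT z|boundary_measure S. (X z)\<^sup>2 - (Y z)\<^sup>2 - k)"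
proof -
  obtain \<rho> where \<rho>: "\<rho> = 1 \<or> \<rho> = (-1::real)" "\<rho> * X z = R - T"
    using z(2) by (cases "0 \<le> X z") (auto intro: that[of 1] that[of "-1"])
  obtain \<tau> where \<tau>: "\<tau> = 1 \<or> \<tau> = (-1::real)" "T / 8 \<le> \<tau> * Y z"
    using z(3) by (cases "0 \<le> Y z") (auto intro: that[of 1] that[of "-1"])
  have "pi * R / 400 - 20 / R \<le> (LINT z|boundary_measure S. indicator (arc \<tau>) z * ((X z)\<^sup>2 - k))"
    by (rule arc_moment_excess[OF \<tau>(1) \<rho>(1) z(1) \<rho>(2) \<tau>(2)])
  moreover have "- (20 / R) \<le> (LINT z|boundary_measure S. indicator (arc (- \<tau>)) z * ((X z)\<^sup>2 - k))"
    using \<tau>(1) by (intro arc_moment_lower) auto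
  ultimately have "pi * R / 400 - 184 / R \<le> (LINT z|boundary_measure S. (X z)\<^sup>2 - (Y z)\<^sup>2 - k)"
    using boundary_moment \<tau>(1) by auto
  moreover have "7/1000 * R \<le> pi * R / 400 - 184 / R"
  proof -
    have "184 / R \<le> 184 / 1000" using R by (intro divide_left_mono) auto
    moreover have "3 * R \<le> pi * R" using pi_bounds R by (intro mult_right_mono) auto
    ultimately show ?thesis using R by linarith
  qed
  ultimately show ?thesis by linarith
qed

end

section \<open>The area moment\<close>

lemma measure_open_interval:
  fixes I :: "real set"
  assumes I: "open I" "convex I" "bounded I" "I \<noteq> {}"
  shows "measure lborel I = Sup I - Inf I"
proof -
  have bd: "bdd_above I" "bdd_below I"
    using I(3) by (auto intro: bounded_imp_bdd_above bounded_imp_bdd_below)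
  have le: "Inf I \<le> Sup I" using I(4) bd by (rule cInf_le_cSup)
  have sub1: "{Inf I<..<Sup I} \<subseteq> I"
  proof
    fix y assume "y \<in> {Inf I<..<Sup I}"
    then have y: "Inf I < y" "y < Sup I" by auto
    obtain a where a: "a \<in> I" "a < y" using cInf_lessD[OF I(4) y(1)] by blast
    obtain b where b: "b \<in> I" "y < b" using less_cSupD[OF I(4) y(2)] by blast
    have "is_interval I" using I(2) by (simp add: is_interval_convex_1)
    then show "y \<in> I" using a b unfolding is_interval_1 by (meson less_imp_le)
  qed
  have sub2: "I \<subseteq> {Inf I..Sup I}" using bd by (auto intro: cInf_lower cSup_upper)
  have fm: "I \<in> fmeasurable lborel"
    using I emeasure_bounded_finite[of I] by (intro fmeasurableI) auto
  have fI: "{Inf I..Sup I} \<in> fmeasurable lborel" by (intro fmeasurable_compact) simp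
  have "measure lborel {Inf I<..<Sup I} \<le> measure lborel I"
    using sub1 fm by (intro measure_mono_fmeasurable) auto
  moreover have "measure lborel I \<le> measure lborel {Inf I..Sup I}"
    using sub2 I(1) fI by (intro measure_mono_fmeasurable) auto
  ultimately show ?thesis using le by simp
qed

context thin_domain begin

definition slice :: "real \<Rightarrow> real set" where "slice x = {y. P x y \<in> S}"
definition h :: "real \<Rightarrow> real" where "h x = measure lborel (slice x)"

lemma slice_open: "open (slice x)"
proof -
  have "slice x = (\<lambda>y. P x y) -` S" by (auto simp: slice_def)
  moreover have "continuous_on UNIV (\<lambda>y. P x y)" by (intro continuous_P continuous_on_const continuous_on_id)
  ultimately show ?thesis using open_vimage[OF S(1)] by metis
qed

lemma slice_thin: "y \<in> slice x \<Longrightarrow> \<bar>y\<bar> \<le> pi / R"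
  using thin[of "P x y"] closure_subset[of S] by (auto simp: slice_def)

lemma slice_bounded: "bounded (slice x)"
  unfolding bounded_iff using slice_thin by auto

lemma slice_combination:
  assumes "y \<in> slice x" "y' \<in> slice x'" "0 \<le> t" "t \<le> 1"
  shows "(1 - t) * y + t * y' \<in> slice ((1 - t) * x + t * x')"
  using convexD_alt[OF S(2), of "P x y" "P x' y'" t] assms by (simp add: slice_def P_affine)

lemma slice_convex: "convex (slice x)"
  unfolding convex_alt using slice_combination[of _ x _ x] by (auto simp: algebra_simps)

lemma slice_axis: "\<bar>x\<bar> \<le> R \<Longrightarrow> 0 \<in> slice x"
  using axis by (simp add: slice_def)

lemma h_nonneg: "0 \<le> h x" by (simp add: h_def)

lemma h_le:
  assumes "\<And>y. y \<in> slice x \<Longrightarrow> \<bar>y\<bar> \<le> b" "0 \<le> b"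
  shows "h x \<le> 2 * b"
proof -
  have "h x \<le> measure lborel {-b..b}"
    unfolding h_def
  proof (rule measure_mono_fmeasurable)
    show "slice x \<subseteq> {-b..b}"
    proof
      fix y assume "y \<in> slice x"
      from assms(1)[OF this] show "y \<in> {-b..b}" unfolding abs_le_iff by simp
    qed
    show "{-b..b} \<in> fmeasurable lborel" by (intro fmeasurable_compact) simp
  qed (use slice_open in auto)
  then show ?thesis using assms(2) by simp
qed

lemma h_le_thin: "h x \<le> 8 / R"
proof -
  have "h x \<le> 2 * (pi / R)" using slice_thin R by (intro h_le) auto
  also have "\<dots> \<le> 8 / R" using pi_bounds R by (simp add: divide_right_mono)
  finally show ?thesis .
qed

lemma h_outside: "R + d < \<bar>x\<bar> \<Longrightarrow> h x = 0"
proof -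
  assume "R + d < \<bar>x\<bar>"
  then have "slice x = {}"
    using wide closure_subset[of S] by (force simp: slice_def)
  then show ?thesis by (simp add: h_def)
qed

text \<open>
Brunn's theorem for slices by parallel lines: by convexity the upper end of the slice is concave in \<open>x\<close> and the lower end convex.
\<close>

lemma h_concave:
  assumes x: "\<bar>x\<bar> \<le> R" "\<bar>x'\<bar> \<le> R" and t: "0 \<le> t" "t \<le> 1"
  shows "(1 - t) * h x + t * h x' \<le> h ((1 - t) * x + t * x')"
proof -
  let ?x = "(1 - t) * x + t * x'"
  have ne: "slice x \<noteq> {}" "slice x' \<noteq> {}" "slice ?x \<noteq> {}"
    using slice_axis[OF x(1)] slice_axis[OF x(2)] slice_combination[of 0 x 0 x' t] t by auto
  have bd: "bdd_above (slice ?x)" "bdd_below (slice ?x)"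
    using slice_bounded by (auto intro: bounded_imp_bdd_above bounded_imp_bdd_below)
  have hs: "h x = Sup (slice x) - Inf (slice x)" if "slice x \<noteq> {}" for x
    unfolding h_def using slice_open slice_convex slice_bounded that by (intro measure_open_interval)
  have "(1 - t) * Sup (slice x) + t * Sup (slice x') \<le> Sup (slice ?x) + \<epsilon>" if \<epsilon>: "0 < \<epsilon>" for \<epsilon>
  proof -
    obtain y where y: "y \<in> slice x" "Sup (slice x) - \<epsilon> < y"
      using less_cSupD[OF ne(1), of "Sup (slice x) - \<epsilon>"] \<epsilon> by auto
    obtain y' where y': "y' \<in> slice x'" "Sup (slice x') - \<epsilon> < y'"
      using less_cSupD[OF ne(2), of "Sup (slice x') - \<epsilon>"] \<epsilon> by auto
    have "(1 - t) * Sup (slice x) + t * Sup (slice x') \<le> (1 - t) * (y + \<epsilon>) + t * (y' + \<epsilon>)"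
      using y y' t by (intro add_mono mult_left_mono) auto
    also have "\<dots> = (1 - t) * y + t * y' + \<epsilon>" by (simp add: algebra_simps)
    also have "(1 - t) * y + t * y' \<le> Sup (slice ?x)"
      using slice_combination[OF y(1) y'(1) t] bd by (intro cSup_upper)
    finally show ?thesis by simp
  qed
  then have up: "(1 - t) * Sup (slice x) + t * Sup (slice x') \<le> Sup (slice ?x)"
    by (rule field_le_epsilon)
  have "Inf (slice ?x) \<le> (1 - t) * Inf (slice x) + t * Inf (slice x') + \<epsilon>" if \<epsilon>: "0 < \<epsilon>" for \<epsilon>
  proof -
    obtain y where y: "y \<in> slice x" "y < Inf (slice x) + \<epsilon>"
      using cInf_lessD[OF ne(1), of "Inf (slice x) + \<epsilon>"] \<epsilon> by auto
    obtain y' where y': "y' \<in> slice x'" "y' < Inf (slice x') + \<epsilon>"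
      using cInf_lessD[OF ne(2), of "Inf (slice x') + \<epsilon>"] \<epsilon> by auto
    have "Inf (slice ?x) \<le> (1 - t) * y + t * y'"
      using slice_combination[OF y(1) y'(1) t] bd by (intro cInf_lower)
    also have "\<dots> \<le> (1 - t) * (Inf (slice x) + \<epsilon>) + t * (Inf (slice x') + \<epsilon>)"
      using y y' t by (intro add_mono mult_left_mono) auto
    also have "\<dots> = (1 - t) * Inf (slice x) + t * Inf (slice x') + \<epsilon>" by (simp add: algebra_simps)
    finally show ?thesis .
  qed
  then have "Inf (slice ?x) \<le> (1 - t) * Inf (slice x) + t * Inf (slice x')"
    by (rule field_le_epsilon)
  then show ?thesis
    unfolding hs[OF ne(1)] hs[OF ne(2)] hs[OF ne(3)] right_diff_distrib using up by linarith
qed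

text \<open>
Symmetrising does not change integrals against even weights, and turns concavity into monotonicity in \<open>\<bar>x\<bar>\<close>.
\<close>

definition H :: "real \<Rightarrow> real" where "H x = h x + h (- x)"

lemma H_even: "H (- x) = H x" by (simp add: H_def)

lemma H_nonneg: "0 \<le> H x" by (simp add: H_def h_nonneg)

lemma H_concave:
  assumes x: "\<bar>x\<bar> \<le> R" "\<bar>x'\<bar> \<le> R" and t: "0 \<le> t" "t \<le> 1"
  shows "(1 - t) * H x + t * H x' \<le> H ((1 - t) * x + t * x')"
  using h_concave[OF x t] h_concave[of "- x" "- x'" t] x t unfolding H_def
  by (simp add: algebra_simps)

lemma H_decreasing:
  assumes "\<bar>x\<bar> \<le> \<bar>x'\<bar>" "\<bar>x'\<bar> \<le> R"
  shows "H x' \<le> H x"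
proof (cases "x' = 0")
  case True
  then show ?thesis using assms by simp
next
  case False
  define t where "t = (x' - x) / (2 * x')"
  have t: "0 \<le> t" "t \<le> 1" using assms(1) False by (auto simp: t_def divide_simps abs_if split: if_splits)
  have "(1 - t) * x' + t * (- x') = x" using False by (simp add: t_def field_simps)
  moreover have "(1 - t) * H x' + t * H (- x') = H x'" by (simp add: H_even algebra_simps)
  ultimately show ?thesis using H_concave[of x' "- x'" t] assms(2) t by simp
qed

lemma slice_integral:
  fixes f :: "real \<Rightarrow> real"
  assumes f: "f \<in> borel_measurable borel" and b: "\<And>z. z \<in> S \<Longrightarrow> \<bar>f (X z)\<bar> \<le> B"
  shows "integrable lborel (\<lambda>x. f x * h x)"
    and "(LINT z|lebesgue_on S. f (X z)) = (LINT x|lborel. f x * h x)"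
proof -
  have m: "(\<lambda>z. f (X z)) \<in> borel_measurable borel"
    using f measurable_XY(1) by (rule measurable_compose[rotated])
  have Sb: "S \<in> sets borel" using S(1) by simp
  have "integrable (lebesgue_on S) (\<lambda>z. f (X z))"
    by (rule integrable_lebesgue_on_bounded[OF S(3,1) m b])
  then have i: "integrable lborel (\<lambda>z. indicator S z * f (X z))"
    using lebesgue_on_lborel(2)[OF Sb m] by blast
  have inner: "(LINT y|lborel. indicator S (P x y) * f (X (P x y))) = f x * h x" for x
  proof -
    have "(\<lambda>y. indicator S (P x y) * f (X (P x y))) = (\<lambda>y. f x * indicator (slice x) y)"
      by (auto simp: slice_def indicator_def)
    then show ?thesis by (simp add: h_def slice_open)
  qed
  show "integrable lborel (\<lambda>x. f x * h x)"
    using lborel_integral_frame(3)[OF i] unfolding inner .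
  show "(LINT z|lebesgue_on S. f (X z)) = (LINT x|lborel. f x * h x)"
    using lborel_integral_frame(1)[OF i] unfolding inner lebesgue_on_lborel(1)[OF Sb m] .
qed

text \<open>
The part of the domain that sticks out beyond the chord has width at most \<open>d \<le> 1 / R\<^sup>3\<close> and height \<open>O(1 / R)\<close>. A weight of
order \<open>R\<^sup>2\<close> still makes it negligible.
\<close>

lemma tail_bound:
  fixes f :: "real \<Rightarrow> real"
  assumes f: "f \<in> borel_measurable borel" "\<And>x. \<bar>x\<bar> \<le> R + d \<Longrightarrow> \<bar>f x\<bar> \<le> 2 * R\<^sup>2"
  shows "integrable lborel (\<lambda>x. f x * h x)"
    and "integrable lborel (\<lambda>x. f x * indicator {-R..R} x * h x)"
    and "(LINT x|lborel. f x * h x) \<le> (LINT x|lborel. f x * indicator {-R..R} x * h x) + 1 / 1000"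
proof -
  have R1: "d \<le> R" using d_le R by linarith
  have b: "\<bar>f (X z)\<bar> \<le> 2 * R\<^sup>2" "\<bar>f (X z) * indicator {-R..R} (X z)\<bar> \<le> 2 * R\<^sup>2" if "z \<in> S" for z
  proof -
    have "\<bar>X z\<bar> \<le> R + d" using wide[of z] closure_subset[of S] that by blast
    then show "\<bar>f (X z)\<bar> \<le> 2 * R\<^sup>2" by (rule f(2))
    then show "\<bar>f (X z) * indicator {-R..R} (X z)\<bar> \<le> 2 * R\<^sup>2"
      by (simp add: indicator_def)
  qed
  show i: "integrable lborel (\<lambda>x. f x * h x)"
    by (rule slice_integral(1)[OF f(1), of "2 * R\<^sup>2"]) (rule b(1))
  show j: "integrable lborel (\<lambda>x. f x * indicator {-R..R} x * h x)"
  proof (rule slice_integral(1)[where B="2 * R\<^sup>2"])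
    show "(\<lambda>x. f x * indicator {-R..R} x) \<in> borel_measurable borel" using f(1) by measurable
  qed (rule b(2))
  define K where "K x = (16 * R) * (indicator {-(R + d)..-R} x + indicator {R..R + d} x)" for x :: real
  have K: "integrable lborel K" "(LINT x|lborel. K x) = 32 * R * d"
    unfolding K_def using d(1) by (auto intro!: integrable_real_indicator)
  have le: "f x * h x \<le> f x * indicator {-R..R} x * h x + K x" for x
  proof -
    consider "x \<in> {-R..R}" | "x \<notin> {-R..R}" "\<bar>x\<bar> \<le> R + d" | "R + d < \<bar>x\<bar>" by linarith
    then show ?thesis
    proof cases
      case 1
      then show ?thesis using R by (simp add: K_def)
    next
      case 2
      have "f x * h x \<le> \<bar>f x\<bar> * h x" using h_nonneg[of x] by (intro mult_right_mono) auto
      also have "\<dots> \<le> (2 * R\<^sup>2) * (8 / R)"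
        using f(2)[of x] h_le_thin[of x] h_nonneg[of x] 2 R1 by (intro mult_mono) auto
      also have "\<dots> = 16 * R" using R by (simp add: power2_eq_square)
      also have "\<dots> \<le> K x" using 2 R by (auto simp: K_def indicator_def)
      finally show ?thesis using 2 by simp
    next
      case 3
      then show ?thesis using h_outside[of x] R by (simp add: K_def)
    qed
  qed
  have "(LINT x|lborel. f x * h x) \<le> (LINT x|lborel. f x * indicator {-R..R} x * h x + K x)"
    using i j K le by (intro integral_mono) auto
  also have "\<dots> = (LINT x|lborel. f x * indicator {-R..R} x * h x) + 32 * R * d"
    using j K by simp
  also have "32 * R * d \<le> 1 / 1000"
  proof -
    have "32 * R * d \<le> 32 * R * (1 / R ^ 3)" using d(2) R by (intro mult_left_mono) auto
    also have "\<dots> = 32 / (R * R)" using R by (simp add: power3_eq_cube)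
    also have "\<dots> \<le> 32 / (1000 * 1000)" using R by (intro divide_left_mono mult_mono mult_pos_pos) auto
    finally show ?thesis by simp
  qed
  finally show "(LINT x|lborel. f x * h x) \<le> (LINT x|lborel. f x * indicator {-R..R} x * h x) + 1 / 1000"
    by simp
qed

lemma symmetrised_integral:
  fixes f :: "real \<Rightarrow> real"
  assumes f: "f \<in> borel_measurable borel" "\<And>x. \<bar>x\<bar> \<le> R + d \<Longrightarrow> \<bar>f x\<bar> \<le> 2 * R\<^sup>2" and even: "\<And>x. f (- x) = f x"
  shows "integrable lborel (\<lambda>x. f x * indicator {-R..R} x * H x)"
    and "2 * (LINT x|lborel. f x * indicator {-R..R} x * h x) = (LINT x|lborel. f x * indicator {-R..R} x * H x)"
proof -
  let ?g = "\<lambda>x. f x * indicator {-R..R} x * h x"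
  have i: "integrable lborel ?g" by (rule tail_bound[OF f])
  have refl: "f x * indicator {-R..R} x * h (- x) = ?g (0 + (-1) * x)" for x
    by (auto simp: even indicator_def)
  have i': "integrable lborel (\<lambda>x. f x * indicator {-R..R} x * h (- x))"
    unfolding refl using i by (intro lborel_integrable_real_affine) auto
  have e: "(LINT x|lborel. f x * indicator {-R..R} x * h (- x)) = (LINT x|lborel. ?g x)"
    unfolding refl using lborel_integral_real_affine[of "-1" ?g 0] by simp
  have split: "f x * indicator {-R..R} x * H x = ?g x + f x * indicator {-R..R} x * h (- x)" for x
    by (simp add: H_def algebra_simps)
  show "integrable lborel (\<lambda>x. f x * indicator {-R..R} x * H x)"
    unfolding split using i i' by simp
  show "2 * (LINT x|lborel. ?g x) = (LINT x|lborel. f x * indicator {-R..R} x * H x)"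
    unfolding split using i i' e by simp
qed

text \<open>
Subtract the constant \<open>H x0\<close>, which is harmless since \<open>k - x\<^sup>2\<close> has integral 0. By monotonicity \<open>(k - x\<^sup>2) (H x - H x0)\<close> is nonnegative
everywhere, both factors changing sign at \<open>\<bar>x\<bar> = x0\<close>; the left-hand side bounds the contribution of the two end pieces of length \<open>T\<close> from below.
\<close>

lemma inner_moment:
  assumes x0: "0 \<le> x0" "x0\<^sup>2 = k"
  shows "((R - T)\<^sup>2 - k) * (H x0 - H (R - T)) * T \<le> (LINT x|lborel. (k - x\<^sup>2) * indicator {-R..R} x * h x)"
proof -
  have x0R: "x0 < R - T"
  proof -
    have "x0\<^sup>2 < (R - T)\<^sup>2"
    proof -
      have "(4/5 * R)\<^sup>2 \<le> (R - T)\<^sup>2" using T R by (intro power_mono) auto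
      moreover have "k < (4/5 * R)\<^sup>2" using R by (simp add: k_def power2_eq_square)
      ultimately show ?thesis using x0 by linarith
    qed
    then show ?thesis using T R by (intro power2_less_imp_less[of x0 "R - T"]) auto
  qed
  \<comment> \<open>Halved, the weight meets the bound required for symmetrising.\<close>
  have fb: "\<bar>k - x\<^sup>2\<bar> \<le> 4 * R\<^sup>2" if "\<bar>x\<bar> \<le> 2 * R" for x
  proof -
    have "x\<^sup>2 \<le> (2 * R)\<^sup>2" using that abs_le_square_iff[of x "2 * R"] R by simp
    then have "x\<^sup>2 \<le> 4 * R\<^sup>2" by (simp add: power_mult_distrib)
    then show ?thesis
      unfolding abs_le_iff k_def using zero_le_power2[of x] zero_le_power2[of R] by linarith
  qed
  let ?f = "\<lambda>x. (k - x\<^sup>2) / 2"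
  have fb': "\<bar>?f x\<bar> \<le> 2 * R\<^sup>2" if "\<bar>x\<bar> \<le> R + d" for x using fb[of x] that d_le R by simp
  have sym: "integrable lborel (\<lambda>x. ?f x * indicator {-R..R} x * H x)"
    "2 * (LINT x|lborel. ?f x * indicator {-R..R} x * h x) = (LINT x|lborel. ?f x * indicator {-R..R} x * H x)"
    by (rule symmetrised_integral; use fb' in simp)+
  let ?J = "\<lambda>x. indicator {-R..-(R - T)} x + indicator {R - T..R} x :: real"
  define a where "a = ((R - T)\<^sup>2 - k) / 2 * (H x0 - H (R - T))"
  have a0: "0 \<le> a"
    unfolding a_def using x0R x0 T k_le[of "R - T"] R by (intro mult_nonneg_nonneg) (auto intro: H_decreasing)
  have z: "integrable lborel (\<lambda>x. ?f x * indicator {-R..R} x)" "(LINT x|lborel. ?f x * indicator {-R..R} x) = 0"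
  proof -
    have e: "?f x * indicator {-R..R} x = (- 1 / 2) * ((x\<^sup>2 - k) * indicator {-R..R} x)" for x
      by (cases "x \<in> {-R..R}") (simp_all add: field_simps)
    show "integrable lborel (\<lambda>x. ?f x * indicator {-R..R} x)"
      unfolding e using quadratic_integral(1)[of "-R" R k] R by (intro integrable_mult_right) auto
    show "(LINT x|lborel. ?f x * indicator {-R..R} x) = 0"
      unfolding e integral_mult_right_zero using quadratic_integral(2)[of "-R" R k] R
      by (simp add: k_def power2_eq_square power3_eq_cube)
  qed
  have iJ: "integrable lborel (\<lambda>x. a * ?J x)" "(LINT x|lborel. a * ?J x) = a * (2 * T)"
    using T by (auto intro!: integrable_real_indicator)
  have pw: "a * ?J x \<le> ?f x * indicator {-R..R} x * H x - H x0 * (?f x * indicator {-R..R} x)" for x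
  proof (cases "x \<in> {-R..R}")
    case True
    then have xR: "\<bar>x\<bar> \<le> R" by auto
    have eq: "?f x * indicator {-R..R} x * H x - H x0 * (?f x * indicator {-R..R} x) = (x\<^sup>2 - k) / 2 * (H x0 - H x)"
      using True by (simp add: field_simps)
    show ?thesis
    proof (cases "R - T \<le> \<bar>x\<bar>")
      case True
      have "H x \<le> H (R - T)" using True xR T by (intro H_decreasing) auto
      moreover have "(R - T)\<^sup>2 \<le> x\<^sup>2" by (rule end_quadratic[OF True])
      moreover have "k \<le> (R - T)\<^sup>2" using k_le[of "R - T"] T R by simp
      moreover have "H (R - T) \<le> H x0" using x0R x0 T by (intro H_decreasing) auto
      ultimately have "a \<le> (x\<^sup>2 - k) / 2 * (H x0 - H x)"
        unfolding a_def by (intro mult_mono) auto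
      moreover have "?J x \<le> 1" using T R by (auto simp: indicator_def)
      then have "a * ?J x \<le> a * 1" using a0 by (intro mult_left_mono)
      ultimately show ?thesis unfolding eq by linarith
    next
      case False
      then have J0: "?J x = 0" by (auto simp: indicator_def)
      have "0 \<le> (x\<^sup>2 - k) / 2 * (H x0 - H x)"
      proof (cases "\<bar>x\<bar> \<le> x0")
        case True
        then have "x\<^sup>2 \<le> k" using abs_le_square_iff[of x x0] x0 by simp
        moreover have "H x0 \<le> H x" using True x0 x0R T by (intro H_decreasing) auto
        ultimately show ?thesis by (intro mult_nonpos_nonpos) auto
      next
        case False
        then have "k \<le> x\<^sup>2" using abs_le_square_iff[of x0 x] x0 by simp
        moreover have "H x \<le> H x0" using False x0 xR by (intro H_decreasing) auto
        ultimately show ?thesis by (intro mult_nonneg_nonneg) auto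
      qed
      then show ?thesis unfolding J0 eq by simp
    qed
  next
    case False
    then have "?J x = 0" using T by (auto simp: indicator_def)
    then show ?thesis using False by simp
  qed
  have "a * (2 * T) \<le> (LINT x|lborel. ?f x * indicator {-R..R} x * H x - H x0 * (?f x * indicator {-R..R} x))"
    unfolding iJ(2)[symmetric]
    by (rule integral_mono[OF iJ(1) _ pw])
      (intro Bochner_Integration.integrable_diff integrable_mult_right sym(1) z(1))
  also have "\<dots> = (LINT x|lborel. ?f x * indicator {-R..R} x * H x)"
    by (simp only: Bochner_Integration.integral_diff[OF sym(1) integrable_mult_right[OF z(1)]]
        integral_mult_right_zero z(2) mult_zero_right diff_zero)
  also have "\<dots> = 2 * (LINT x|lborel. ?f x * indicator {-R..R} x * h x)" using sym(2) by simp
  also have "\<dots> = (LINT x|lborel. (k - x\<^sup>2) * indicator {-R..R} x * h x)"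
    by (subst integral_mult_right_zero[symmetric]) simp
  finally show ?thesis by (simp add: a_def)
qed

end

context thin_domain begin

lemma area_moment_le:
  assumes x0: "0 \<le> x0" "x0\<^sup>2 = k"
  shows "(LINT z|lebesgue_on S. (X z)\<^sup>2 - (Y z)\<^sup>2 - k) \<le> 1 / 1000 - ((R - T)\<^sup>2 - k) * (H x0 - H (R - T)) * T"
proof -
  have cont: "continuous_on UNIV (\<lambda>z. (X z)\<^sup>2 - (Y z)\<^sup>2 - k)" "continuous_on UNIV (\<lambda>z. (X z)\<^sup>2 - k)"
    by (intro continuous_intros)+
  have fb: "\<bar>x\<^sup>2 - k\<bar> \<le> 2 * R\<^sup>2" if "\<bar>x\<bar> \<le> R + d" for x
  proof -
    have "x\<^sup>2 \<le> (3/2 * R)\<^sup>2" using that abs_le_square_iff[of x "3/2 * R"] R d_le by simp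
    then have "x\<^sup>2 \<le> 9/4 * R\<^sup>2" by (simp add: power_mult_distrib power2_eq_square)
    then show ?thesis
      unfolding abs_le_iff k_def using zero_le_power2[of x] zero_le_power2[of R] by linarith
  qed
  have "(LINT z|lebesgue_on S. (X z)\<^sup>2 - (Y z)\<^sup>2 - k) \<le> (LINT z|lebesgue_on S. (X z)\<^sup>2 - k)"
    using S cont by (intro integral_mono integrable_lebesgue_on_continuous) auto
  also have "\<dots> = (LINT x|lborel. (x\<^sup>2 - k) * h x)"
  proof (rule slice_integral(2))
    show "\<bar>(X z)\<^sup>2 - k\<bar> \<le> 2 * R\<^sup>2" if "z \<in> S" for z
      using wide[of z] closure_subset[of S] that by (intro fb) auto
  qed measurable
  also have "\<dots> \<le> (LINT x|lborel. (x\<^sup>2 - k) * indicator {-R..R} x * h x) + 1 / 1000"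
    by (rule tail_bound) (use fb in auto)
  also have "(LINT x|lborel. (x\<^sup>2 - k) * indicator {-R..R} x * h x) = - (LINT x|lborel. (k - x\<^sup>2) * indicator {-R..R} x * h x)"
    by (subst Bochner_Integration.integral_minus[symmetric]) (simp add: algebra_simps)
  finally show ?thesis using inner_moment[OF x0] by linarith
qed

lemma k_root: "0 \<le> sqrt k" "(sqrt k)\<^sup>2 = k" "sqrt k \<le> 29/50 * R"
proof -
  show "0 \<le> sqrt k" "(sqrt k)\<^sup>2 = k" using k_nonneg by auto
  show "sqrt k \<le> 29/50 * R"
    using R by (intro real_le_lsqrt) (auto simp: k_def power2_eq_square)
qed

lemma end_height: "k \<le> (R - T)\<^sup>2" "R\<^sup>2 / 2 \<le> (R - T)\<^sup>2 - k"
proof -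
  show "k \<le> (R - T)\<^sup>2" using k_le[of "R - T"] T R by simp
  have "(R - T)\<^sup>2 = R\<^sup>2 - pi + T\<^sup>2" using T(3) by (simp add: power2_diff)
  moreover have "1000 * 1000 \<le> R\<^sup>2" unfolding power2_eq_square using R by (intro mult_mono) auto
  ultimately show "R\<^sup>2 / 2 \<le> (R - T)\<^sup>2 - k" using pi_bounds zero_le_power2[of T]
    unfolding k_def by linarith
qed

lemma area_moment_small: "(LINT z|lebesgue_on S. (X z)\<^sup>2 - (Y z)\<^sup>2 - k) \<le> 1 / 1000"
proof -
  have "H (R - T) \<le> H (sqrt k)"
    using k_root T R by (intro H_decreasing) auto
  then have "0 \<le> ((R - T)\<^sup>2 - k) * (H (sqrt k) - H (R - T)) * T"
    using end_height T by (intro mult_nonneg_nonneg) auto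
  then show ?thesis using area_moment_le[OF k_root(1,2)] by linarith
qed

lemma central_height: "(pi - 1 / 1000) / R \<le> H 0"
proof -
  have sq: "1 \<le> 2 * R\<^sup>2"
  proof -
    have "1 * 1 \<le> R * R" using R by (intro mult_mono) auto
    then show ?thesis by (simp add: power2_eq_square)
  qed
  have "pi = (LINT z|lebesgue_on S. 1)"
    using area S(1) by (simp add: measure_restrict_space space_restrict_space)
  also have "\<dots> = (LINT x|lborel. 1 * h x)"
    by (rule slice_integral(2)[where f="\<lambda>_. 1" and B=1]) auto
  also have "\<dots> \<le> (LINT x|lborel. 1 * indicator {-R..R} x * h x) + 1 / 1000"
    by (rule tail_bound(3)) (use sq in auto)
  finally have "pi \<le> (LINT x|lborel. 1 * indicator {-R..R} x * h x) + 1 / 1000" .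
  moreover have "integrable lborel (\<lambda>x. 1 * indicator {-R..R} x * H x)"
    "2 * (LINT x|lborel. 1 * indicator {-R..R} x * h x) = (LINT x|lborel. 1 * indicator {-R..R} x * H x)"
    by (rule symmetrised_integral; use sq in simp)+
  moreover have "(LINT x|lborel. 1 * indicator {-R..R} x * H x) \<le> (LINT x|lborel. H 0 * indicator {-R..R} x)"
  proof (rule integral_mono)
    show "integrable lborel (\<lambda>x. H 0 * indicator {-R..R} x)"
      using R by (auto intro!: integrable_real_indicator)
    show "1 * indicator {-R..R} x * H x \<le> H 0 * indicator {-R..R} x" for x
      using H_decreasing[of 0 x] by (auto simp: indicator_def)
  qed fact
  moreover have "(LINT x|lborel. H 0 * indicator {-R..R} x) = 2 * (H 0 * R)" using R by simp
  ultimately have "pi - 1 / 1000 \<le> H 0 * R" by linarith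
  then show ?thesis using R by (simp add: divide_le_eq)
qed

text \<open>
If both ends are low, \<open>H\<close> drops from \<open>H x0 \<ge> 0.42 H 0\<close>, by concavity, where \<open>H 0\<close> is at least about \<open>\<pi> / R\<close>, to at most
\<open>\<pi> / (4 R)\<close> at distance \<open>T\<close> from the ends. This drop makes the end contribution in \<open>inner_moment\<close> at least \<open>3 / 8\<close>.
\<close>

lemma area_moment_tapered:
  assumes thin_ends: "\<And>z. z \<in> closure S \<Longrightarrow> \<bar>X z\<bar> = R - T \<Longrightarrow> \<bar>Y z\<bar> \<le> T / 8"
  shows "(LINT z|lebesgue_on S. (X z)\<^sup>2 - (Y z)\<^sup>2 - k) \<le> - (3 / 10)"
proof -
  have e: "h x \<le> 2 * (T / 8)" if "\<bar>x\<bar> = R - T" for x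
    using thin_ends closure_subset[of S] that T by (intro h_le) (force simp: slice_def)+
  have "H (R - T) \<le> T / 2"
    using e[of "R - T"] e[of "-(R - T)"] T by (simp add: H_def)
  also have "T / 2 = pi / 4 / R" by (simp add: T_def)
  finally have 1: "H (R - T) \<le> pi / 4 / R" .
  \<comment> \<open>Concavity between the centre and the end of the chord; \<open>sqrt k = R / sqrt 3 \<le> 0.58 R\<close>.\<close>
  define t where "t = sqrt k / R"
  have t: "0 \<le> t" "t \<le> 29/50" using k_root R by (auto simp: t_def divide_le_eq)
  have "(1 - t) * H 0 + t * H R \<le> H ((1 - t) * 0 + t * R)"
    using R t by (intro H_concave) auto
  moreover have "t * R = sqrt k" using R by (simp add: t_def)
  moreover have "0 \<le> t * H R" using t H_nonneg by simp
  moreover have "21/50 * H 0 \<le> (1 - t) * H 0" using t H_nonneg by (intro mult_right_mono) auto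
  ultimately have 2: "21/50 * H 0 \<le> H (sqrt k)" by simp
  have "1 / 2 \<le> 21/50 * (pi - 1 / 1000) - pi / 4" 
  proof -
    have "21/50 * (pi - 1 / 1000) - pi / 4 = 17/100 * pi - 21/50000" by (simp add: field_simps)
    then show ?thesis using pi_bounds(1) by linarith
  qed
  then have "1 / 2 / R \<le> (21/50 * (pi - 1 / 1000) - pi / 4) / R"
    using R by (intro divide_right_mono) auto
  also have "\<dots> = 21/50 * ((pi - 1 / 1000) / R) - pi / 4 / R" by (simp add: diff_divide_distrib)
  also have "\<dots> \<le> H (sqrt k) - H (R - T)" using 1 2 central_height by linarith
  finally have 3: "1 / 2 / R \<le> H (sqrt k) - H (R - T)" .
  have "3 / 8 \<le> (R\<^sup>2 / 2) * (1 / 2 / R) * T"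
    using R pi_bounds by (simp add: T_def power2_eq_square)
  also have "\<dots> \<le> ((R - T)\<^sup>2 - k) * (H (sqrt k) - H (R - T)) * T"
    using end_height 3 T R by (intro mult_right_mono mult_mono) auto
  finally show ?thesis using area_moment_le[OF k_root(1,2)] by linarith
qed

lemma moment_gap:
  "(LINT z|lebesgue_on S. (X z)\<^sup>2 - (Y z)\<^sup>2 - k)
     - pi / perimeter S * (LINT z|boundary_measure S. (X z)\<^sup>2 - (Y z)\<^sup>2 - k) \<le> - (1 / 1000)"
proof (cases "\<exists>z\<in>closure S. \<bar>X z\<bar> = R - T \<and> T / 8 < \<bar>Y z\<bar>")
  case True
  then have B: "7/1000 * R \<le> (LINT z|boundary_measure S. (X z)\<^sup>2 - (Y z)\<^sup>2 - k)"
    using boundary_excess by blast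
  have P: "0 < perimeter S" using perimeter_bounds(1) R by linarith
  have "1 / 500 \<le> 3 / (9 * R) * (7/1000 * R)" using R by simp
  also have "\<dots> \<le> pi / perimeter S * (LINT z|boundary_measure S. (X z)\<^sup>2 - (Y z)\<^sup>2 - k)"
    using B P perimeter_bounds pi_bounds R by (intro mult_mono frac_le) auto
  finally show ?thesis using area_moment_small by linarith
next
  case False
  then have A: "(LINT z|lebesgue_on S. (X z)\<^sup>2 - (Y z)\<^sup>2 - k) \<le> - (3 / 10)"
    by (intro area_moment_tapered) force
  have P: "0 < perimeter S" using perimeter_bounds(1) R by linarith
  have "- (1 / 10) \<le> pi / perimeter S * (LINT z|boundary_measure S. (X z)\<^sup>2 - (Y z)\<^sup>2 - k)"
  proof -
    have q: "0 \<le> pi / perimeter S" "pi / perimeter S \<le> 4 / (2 * R)"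
      using P by simp (rule frac_le; use perimeter_bounds pi_bounds R in simp)
    have "pi / perimeter S * (184 / R) \<le> 4 / (2 * R) * (184 / R)"
      using q R by (intro mult_right_mono) auto
    also have "\<dots> = 368 / (R * R)" by simp
    also have "\<dots> \<le> 368 / (1000 * 1000)" using R by (intro divide_left_mono mult_mono mult_pos_pos) auto
    finally have "pi / perimeter S * (184 / R) \<le> 1 / 10" by simp
    moreover have "pi / perimeter S * (- (184 / R)) \<le> pi / perimeter S * (LINT z|boundary_measure S. (X z)\<^sup>2 - (Y z)\<^sup>2 - k)"
      using boundary_lower q(1) by (rule mult_left_mono)
    ultimately show ?thesis by linarith
  qed
  then show ?thesis using A by linarith
qed

end

section \<open>Thin domains have large oscillation\<close>

lemma hoelder_imp_continuous:
  assumes "hoelder_continuous_on A u" shows "continuous_on A u"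
proof -
  obtain \<alpha> C where \<alpha>: "0 < \<alpha>" and C: "\<And>x y. x \<in> A \<Longrightarrow> y \<in> A \<Longrightarrow> \<bar>u x - u y\<bar> \<le> C * dist x y powr \<alpha>"
    using assms unfolding hoelder_continuous_on_def by blast
  show ?thesis unfolding continuous_on_def
  proof
    fix x assume x: "x \<in> A"
    have "((\<lambda>y. dist y x) \<longlongrightarrow> 0) (at x within A)"
    proof -
      have "((\<lambda>y. dist y x) \<longlongrightarrow> dist x x) (at x within A)" by (intro tendsto_intros)
      then show ?thesis by simp
    qed
    then have "((\<lambda>y. C * dist y x powr \<alpha>) \<longlongrightarrow> C * 0) (at x within A)"
      using \<alpha> by (intro tendsto_mult tendsto_const tendsto_zero_powrI[where b=\<alpha>]) auto
    then have lim: "((\<lambda>y. C * dist y x powr \<alpha>) \<longlongrightarrow> 0) (at x within A)" by simp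
    have "((\<lambda>y. u y - u x) \<longlongrightarrow> 0) (at x within A)"
      by (rule Lim_null_comparison[OF _ lim])
        (use C x in \<open>auto simp: eventually_at_filter intro!: always_eventually\<close>)
    then show "(u \<longlongrightarrow> u x) (at x within A)" by (rule LIM_zero_cancel)
  qed
qed

lemma (in thin_domain) oscillation_lower_bound:
  assumes u: "normalized_neumann_torsion_function S u"
  shows "1 / 100000 \<le> boundary_oscillation S u"
proof -
  have weak: "neumann_weak_solution S u" and hol: "hoelder_continuous_on (closure S) u"
    and mean: "(LINT z|boundary_measure S. u z) = 0"
    using u by (auto simp: normalized_neumann_torsion_function_def neumann_torsion_function_def)
  have cu: "continuous_on (closure S) u" using hol by (rule hoelder_imp_continuous)
  have cpt: "compact (frontier S)" using S(3) by (rule compact_frontier_bounded)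
  have "S \<noteq> {}" using axis[of 0] R by auto
  then have ne: "frontier S \<noteq> {}"
    using frontier_eq_empty[of S] not_bounded_UNIV S(3) by blast
  have cf: "continuous_on (frontier S) u" using cu by (rule continuous_on_subset) (simp add: frontier_def)
  have bd: "bdd_above (u ` frontier S)" "bdd_below (u ` frontier S)"
    using compact_imp_bounded[OF compact_continuous_image[OF cf cpt]]
    by (auto intro: bounded_imp_bdd_above bounded_imp_bdd_below)
  let ?s = "boundary_oscillation S u"
  have lo: "(INF x\<in>frontier S. u x) \<le> u z" and hi: "u z \<le> (SUP x\<in>frontier S. u x)" if "z \<in> frontier S" for z
    using bd that by (auto intro: cINF_lower cSUP_upper)
  have fin: "finite_measure (boundary_measure S)" by (rule finite_boundary_measure[OF frontier_finite])
  have total: "(LINT z|boundary_measure S. a) = a * perimeter S" for a :: real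
    unfolding perimeter_def boundary_measure_def by (simp add: measure_restrict_space space_restrict_space)
  have "integrable (boundary_measure S) u"
  proof (rule finite_measure.integrable_const_bound[OF fin, where B="\<bar>INF x\<in>frontier S. u x\<bar> + \<bar>SUP x\<in>frontier S. u x\<bar>"])
    show "AE z in boundary_measure S. norm (u z) \<le> \<bar>INF x\<in>frontier S. u x\<bar> + \<bar>SUP x\<in>frontier S. u x\<bar>"
      using lo hi by (intro AE_I2) (auto simp: abs_if; fastforce)
    have "u \<in> borel_measurable (restrict_space borel (frontier S))"
      using cf by (rule borel_measurable_continuous_on_restrict)
    moreover have "sets (boundary_measure S) = sets (restrict_space borel (frontier S))"
      unfolding boundary_measure_def by (simp add: sets_restrict_space)
    ultimately show "u \<in> borel_measurable (boundary_measure S)" by (simp cong: measurable_cong_sets)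
  qed
  then have "(INF x\<in>frontier S. u x) * perimeter S \<le> 0" "0 \<le> (SUP x\<in>frontier S. u x) * perimeter S"
    unfolding total[symmetric] mean[symmetric] using lo hi
    by (intro integral_mono finite_measure.integrable_const[OF fin]; simp)+
  \<comment> \<open>A function of mean zero takes both signs, so its modulus is at most its oscillation.\<close>
  then have sgn: "(INF x\<in>frontier S. u x) \<le> 0" "0 \<le> (SUP x\<in>frontier S. u x)"
    using perimeter_bounds(1) R by (auto simp: mult_le_0_iff zero_le_mult_iff)
  have us: "\<bar>u z\<bar> \<le> ?s" if "z \<in> frontier S" for z
    using lo[OF that] hi[OF that] sgn unfolding boundary_oscillation_def by linarith
  have s0: "0 \<le> ?s" using sgn unfolding boundary_oscillation_def by linarith
  obtain g where g: "H1_with_grad S u g"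
    "\<And>\<phi>. smooth \<phi> \<Longrightarrow> (LINT z|lebesgue_on S. g z \<bullet> grad \<phi> z) = (LINT z|lebesgue_on S. \<phi> z)
        - measure lebesgue S / perimeter S * (LINT z|boundary_measure S. \<phi> z)"
    using neumann_test[OF weak S(1,3) frontier_finite] by blast
  let ?I = "LINT z|lebesgue_on S. g z \<bullet> ((2 * X z) *\<^sub>R e - (2 * Y z) *\<^sub>R e')"
  have "?I = (LINT z|lebesgue_on S. (X z)\<^sup>2 - (Y z)\<^sup>2 - k)
     - pi / perimeter S * (LINT z|boundary_measure S. (X z)\<^sup>2 - (Y z)\<^sup>2 - k)"
    using g(2)[OF elementary_smooth[OF smooth_potential[of k]]] unfolding grad_potential area .
  then have "?I \<le> - (1 / 1000)" using moment_gap by simp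
  moreover have "\<bar>?I\<bar> \<le> 16 * (pi / R) * (R + d) * ?s"
  proof (rule green_bound[OF S(1,2,3) _ _ _ _ s0 g(1) cu us])
    show "S \<noteq> {}" using axis[of 0] R by auto
    show "\<bar>X z\<bar> \<le> R + d \<and> \<bar>Y z\<bar> \<le> pi / R" if "z \<in> S" for z
      using wide thin that closure_subset[of S] by blast
  qed (use R d in auto)
  moreover have "16 * (pi / R) * (R + d) * ?s \<le> 100 * ?s"
  proof (rule mult_right_mono[OF _ s0])
    have "16 * (pi / R) * (R + d) \<le> 16 * (4 / R) * (3/2 * R)"
      using pi_bounds R d d_le by (intro mult_mono divide_right_mono) auto
    also have "\<dots> \<le> 100" using R by simp
    finally show "16 * (pi / R) * (R + d) \<le> 100" .
  qed
  ultimately show ?thesis by linarith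
qed

text \<open>
The slice of \<open>S\<close> at height \<open>t Y z\<close> contains a segment of length \<open>2 R (1 - t)\<close>. Hence \<open>S\<close> is at least as large as the triangle
over the chord with apex \<open>z\<close>.
\<close>

lemma (in frame) triangle_area:
  assumes S: "open S" "convex S" "bounded S" and R: "0 < R"
    and axis: "P (- R) 0 \<in> S" "P R 0 \<in> S" and z: "z \<in> S"
  shows "R * \<bar>Y z\<bar> \<le> measure lebesgue S"
proof (cases "Y z = 0")
  case False
  define a b where "a = min 0 (Y z)" and "b = max 0 (Y z)"
  let ?f = "\<lambda>y. 2 * R * (1 - y / Y z)"
  let ?F = "\<lambda>y. 2 * R * (y - y\<^sup>2 / (2 * Y z))"
  have ab: "a \<le> b" by (simp add: a_def b_def)
  have st: "0 \<le> y / Y z" "y / Y z \<le> 1" if "a \<le> y" "y \<le> b" for y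
    using that False by (auto simp: a_def b_def divide_simps min_def max_def split: if_splits)
  have "ennreal (R * \<bar>Y z\<bar>) = ennreal (?F b - ?F a)"
    using False by (auto simp: a_def b_def min_def max_def power2_eq_square field_simps)
  also have "\<dots> = (\<integral>\<^sup>+y. ennreal (?f y) * indicator {a..b} y \<partial>lborel)"
  proof (rule nn_integral_FTC_Icc[symmetric, OF _ _ _ ab])
    show "(?F has_real_derivative ?f y) (at y)" for y
      using False by (auto intro!: derivative_eq_intros simp: field_simps)
    show "0 \<le> ?f y" if "y \<in> {a..b}" for y
      using st[of y] that R by simp
  qed measurable
  also have "\<dots> \<le> (\<integral>\<^sup>+y. \<integral>\<^sup>+x. indicator S (P x y) \<partial>lborel \<partial>lborel)"
  proof (rule nn_integral_mono)
    fix y :: real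
    show "ennreal (?f y) * indicator {a..b} y \<le> (\<integral>\<^sup>+x. indicator S (P x y) \<partial>lborel)"
    proof (cases "y \<in> {a..b}")
      case True
      define t where "t = y / Y z"
      have t: "0 \<le> t" "t \<le> 1" using st True by (auto simp: t_def)
      let ?J = "{- ((1 - t) * R) + t * X z .. (1 - t) * R + t * X z}"
      have "P x y \<in> S" if x: "x \<in> ?J" for x
      proof -
        have "\<exists>x'. \<bar>x'\<bar> \<le> R \<and> x = (1 - t) * x' + t * X z"
        proof (cases "t = 1")
          case True
          then show ?thesis using x R by (intro exI[of _ 0]) auto
        next
          case False
          then have p: "0 < 1 - t" using t by simp
          then show ?thesis using x
            by (intro exI[of _ "(x - t * X z) / (1 - t)"]) (auto simp: abs_le_iff divide_simps mult.commute)
        qed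
        then obtain x' where x': "\<bar>x'\<bar> \<le> R" "x = (1 - t) * x' + t * X z" by blast
        define s where "s = (x' + R) / (2 * R)"
        have s: "0 \<le> s" "s \<le> 1" using x'(1) R by (auto simp: s_def divide_simps)
        have "P ((1 - s) * (- R) + s * R) ((1 - s) * 0 + s * 0) \<in> S"
          unfolding P_affine using convexD_alt[OF S(2) axis s] .
        moreover have "(1 - s) * (- R) + s * R = x'" using R by (simp add: s_def field_simps)
        ultimately have "P x' 0 \<in> S" by simp
        then have "(1 - t) *\<^sub>R P x' 0 + t *\<^sub>R P (X z) (Y z) \<in> S"
          using convexD_alt[OF S(2) _ z t] by simp
        moreover have "t * Y z = y" using \<open>Y z \<noteq> 0\<close> by (simp add: t_def)
        ultimately show "P x y \<in> S" unfolding P_affine[symmetric] x'(2) by simp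
      qed
      then have "(\<integral>\<^sup>+x. indicator ?J x \<partial>lborel) \<le> (\<integral>\<^sup>+x. indicator S (P x y) \<partial>lborel)"
        by (intro nn_integral_mono) (auto simp: indicator_def)
      then have "emeasure lborel ?J \<le> (\<integral>\<^sup>+x. indicator S (P x y) \<partial>lborel)"
        by (subst (asm) nn_integral_indicator) auto
      moreover have "emeasure lborel ?J = ennreal (?f y)"
      proof -
        have "0 \<le> (1 - t) * R" using t R by simp
        then have "emeasure lborel ?J = ennreal (2 * ((1 - t) * R))"
          by (subst emeasure_lborel_Icc) (auto simp: algebra_simps)
        moreover have "2 * ((1 - t) * R) = ?f y" by (simp add: t_def)
        ultimately show ?thesis by (simp only:)
      qed
      ultimately show ?thesis using True by simp
    qed simp
  qed
  also have "\<dots> = (\<integral>\<^sup>+z. indicator S z \<partial>lborel)"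
    using S(1) by (intro nn_integral_frame(2)[symmetric]) auto
  also have "\<dots> = emeasure lebesgue S" using S(1) by simp
  also have "\<dots> = ennreal (measure lebesgue S)"
    using lmeasurable_open[OF S(3,1)] by (simp add: emeasure_eq_measure2)
  finally show ?thesis by simp
qed simp

text \<open>
Choose \<open>p\<close> and \<open>q\<close> in the open domain at a distance exceeding the diameter \<open>D\<close> minus \<open>1 / D\<^sup>3\<close>. No point of the domain is further than \<open>D\<close> from
\<open>p\<close> or \<open>q\<close>, which bounds \<open>X\<close>; the area of the triangle over the chord bounds \<open>Y\<close>.
\<close>

lemma thin_domain_of_diameter:
  assumes S: "open S" "convex S" "bounded S" "S \<noteq> {}" and area: "measure lebesgue S = pi"
    and proper: "emeasure hausdorff1 UNIV \<noteq> 0" and D: "3000 \<le> diameter S"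
  obtains c e e' R d where "thin_domain c e e' S R d"
proof -
  define D where "D = diameter S"
  have D: "3000 \<le> D" using D by (simp add: D_def)
  have d1: "0 < 1 / D ^ 3" "1 / D ^ 3 \<le> 1"
  proof -
    have "1 \<le> D ^ 3" using D by (intro one_le_power) auto
    then show "1 / D ^ 3 \<le> 1" using frac_le[of 1 1 1 "D ^ 3"] by simp
    show "0 < 1 / D ^ 3" using D by simp
  qed
  have "\<exists>p\<in>S. \<exists>q\<in>S. D - 1 / D ^ 3 < dist p q"
  proof (rule ccontr)
    assume "\<not> ?thesis"
    then have "\<And>p q. p \<in> S \<Longrightarrow> q \<in> S \<Longrightarrow> norm (p - q) \<le> D - 1 / D ^ 3"
      by (auto simp: dist_norm not_less)
    then have "diameter S \<le> D - 1 / D ^ 3" using S(4) by (intro diameter_le) auto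
    then show False using d1 by (simp add: D_def)
  qed
  then obtain p q where pq: "p \<in> S" "q \<in> S" "D - 1 / D ^ 3 < dist p q" by blast
  define R where "R = dist p q / 2"
  define c where "c = (1/2) *\<^sub>R (p + q)"
  define e where "e = (1 / (2 * R)) *\<^sub>R (q - p)"
  define e' :: "real^2" where "e' = vector [- (e $ 2), e $ 1]"
  have "dist p q \<le> D" unfolding D_def by (rule diameter_bounded_bound[OF S(3) pq(1,2)])
  then have R: "1000 \<le> R" "R \<le> D" "D < 2 * R + 1 / D ^ 3"
    using pq(3) d1 D unfolding R_def by linarith+
  have e1: "e \<bullet> e = 1"
  proof -
    have "norm (q - p) = 2 * R" by (simp add: R_def dist_norm norm_minus_commute)
    then have "norm e = 1" using R by (simp add: e_def)
    then show ?thesis by (simp add: norm_eq_1)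
  qed
  then have "(e $ 1)\<^sup>2 + (e $ 2)\<^sup>2 = 1" by (simp add: inner_vec_def sum_2 power2_eq_square)
  then have e2: "e' \<bullet> e' = 1" "e \<bullet> e' = 0"
    by (simp_all add: e'_def inner_vec_def sum_2 power2_eq_square)
  interpret frame c e e' by unfold_locales (use e1 e2 in auto)
  have Re: "R *\<^sub>R e = (1/2) *\<^sub>R (q - p)" using R by (simp add: e_def)
  have "P (- R) 0 = c - R *\<^sub>R e" "P R 0 = c + R *\<^sub>R e" by (simp_all add: P_def)
  moreover have "c - R *\<^sub>R e = (1/2) *\<^sub>R (p + p)" "c + R *\<^sub>R e = (1/2) *\<^sub>R (q + q)"
    unfolding Re c_def scaleR_diff_right scaleR_add_right by simp_all
  ultimately have ends: "P (- R) 0 = p" "P R 0 = q" by (simp_all flip: scaleR_2)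
  have wideS: "z \<in> S \<Longrightarrow> \<bar>X z\<bar> \<le> R + 1 / D ^ 3" for z
  proof -
    assume z: "z \<in> S"
    have "\<bar>X z - X w\<bar> \<le> D" if "w \<in> S" for w
    proof -
      have "\<bar>X z - X w\<bar>\<^sup>2 \<le> (dist z w)\<^sup>2" unfolding dist_XY by simp
      then have "\<bar>X z - X w\<bar> \<le> dist z w" by (rule power2_le_imp_le) simp
      also have "\<dots> \<le> D" unfolding D_def by (rule diameter_bounded_bound[OF S(3) z that])
      finally show ?thesis .
    qed
    from this[OF pq(1)] this[OF pq(2)] show "\<bar>X z\<bar> \<le> R + 1 / D ^ 3"
      unfolding ends[symmetric] X_P using R(3) by (auto simp: abs_le_iff)
  qed
  have thinS: "z \<in> S \<Longrightarrow> \<bar>Y z\<bar> \<le> pi / R" for z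
    using triangle_area[OF S(1,2,3), of R z] ends pq R area by (simp add: le_divide_eq mult.commute)
  have cl: "closure S \<subseteq> {z. f z \<le> b}" if "continuous_on UNIV f" "\<And>z. z \<in> S \<Longrightarrow> f z \<le> b"
    for f :: "real^2 \<Rightarrow> real" and b
  proof (rule closure_minimal)
    show "closed {z. f z \<le> b}" using that(1) by (intro closed_Collect_le continuous_on_const)
  qed (use that(2) in auto)
  have "thin_domain c e e' S R (1 / D ^ 3)"
  proof
    show "1 / D ^ 3 \<le> 1 / R ^ 3" using R by (intro divide_left_mono power_mono) auto
    show "P x 0 \<in> S" if x: "\<bar>x\<bar> \<le> R" for x
    proof -
      define s where "s = (x + R) / (2 * R)"
      have s: "0 \<le> s" "s \<le> 1" using x R by (auto simp: s_def divide_simps)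
      have "P ((1 - s) * (- R) + s * R) ((1 - s) * 0 + s * 0) \<in> S"
        unfolding P_affine using convexD_alt[OF S(2), of "P (- R) 0" "P R 0" s] ends pq s by simp
      moreover have "(1 - s) * (- R) + s * R = x" using R by (simp add: s_def field_simps)
      ultimately show ?thesis by simp
    qed
    show "\<bar>X z\<bar> \<le> R + 1 / D ^ 3" if "z \<in> closure S" for z
    proof -
      have "continuous_on UNIV (\<lambda>z. \<bar>X z\<bar>)"
        by (intro continuous_on_rabs continuous_X continuous_on_id)
      from subsetD[OF cl[OF this wideS] that] show ?thesis by simp
    qed
    show "\<bar>Y z\<bar> \<le> pi / R" if "z \<in> closure S" for z
    proof -
      have "continuous_on UNIV (\<lambda>z. \<bar>Y z\<bar>)"
        by (intro continuous_on_rabs continuous_Y continuous_on_id)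
      from subsetD[OF cl[OF this thinS] that] show ?thesis by simp
    qed
  qed (use S area proper R d1 in auto)
  then show ?thesis by (rule that)
qed

theorem theorem4p1:
  fixes \<Omega> :: "nat \<Rightarrow> (real^2) set" and u :: "nat \<Rightarrow> real^2 \<Rightarrow> real"
  assumes "\<And>k. open (\<Omega> k)" and "\<And>k. \<Omega> k \<noteq> {}" and "\<And>k. convex (\<Omega> k)"
    and "\<And>k. bounded (\<Omega> k)"
    and "\<And>k. measure lebesgue (\<Omega> k) = pi"
    and "\<And>k. normalized_neumann_torsion_function (\<Omega> k) (u k)"
    and "(\<lambda>k. boundary_oscillation (\<Omega> k) (u k)) \<longlonglongrightarrow> 0"
  shows "bdd_above (range (\<lambda>k. diameter (\<Omega> k)))"
proof -
  have large: "1 / 100000 \<le> boundary_oscillation (\<Omega> k) (u k)" if D: "3000 \<le> diameter (\<Omega> k)" for k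
  proof -
    have "neumann_weak_solution (\<Omega> k) (u k)"
      using assms(6)[of k] by (simp add: normalized_neumann_torsion_function_def neumann_torsion_function_def)
    then have "emeasure hausdorff1 UNIV \<noteq> 0"
      using assms(1,4,5)[of k] by (intro hausdorff1_nonnull) auto
    from thin_domain_of_diameter[OF assms(1)[of k] assms(3)[of k] assms(4)[of k] assms(2)[of k] assms(5)[of k] this D]
    obtain c e e' R d where "thin_domain c e e' (\<Omega> k) R d" by metis
    then show ?thesis using assms(6) by (rule thin_domain.oscillation_lower_bound)
  qed
  have "\<forall>\<^sub>F k in sequentially. boundary_oscillation (\<Omega> k) (u k) < 1 / 100000"
    using assms(7) by (rule order_tendstoD) simp
  then obtain N where N: "\<And>k. N \<le> k \<Longrightarrow> boundary_oscillation (\<Omega> k) (u k) < 1 / 100000"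
    unfolding eventually_sequentially by blast
  have "diameter (\<Omega> k) \<le> max 3000 (Max ((\<lambda>k. diameter (\<Omega> k)) ` {..N}))" for k
  proof (cases "N \<le> k")
    case True
    then have "diameter (\<Omega> k) < 3000" using large[of k] N[of k] by fastforce
    then show ?thesis by simp
  next
    case False
    then have "diameter (\<Omega> k) \<le> Max ((\<lambda>k. diameter (\<Omega> k)) ` {..N})" by (intro Max_ge) auto
    then show ?thesis by simp
  qed
  then show ?thesis by (rule bdd_aboveI2)
qed

end
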